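(* Let $k$ be a field, let $V$ be a $k$-vector space of finite dimension $n\ge 1$ with basis $\{x_1,\ldots,x_n\}$, and let $A=S(V)$ be the symmetric algebra of $V$. Let $c=1_A\otimes(x_1\wedge\ldots\wedge x_n)\in A\otimes W_n$. Let $M$ be an $A$-bimodule. For each Koszul $p$-cochain $f$ with coefficients in $M$, define the Koszul $(n-p)$-chain $\theta_M(f)$ with coefficients in $M$ by $$\theta_M(f)=c\frown f.$$ Then the linear map $\theta_M:\operatorname{Hom}(W_\bullet,M)\to M\otimes W_{n-\bullet}$ is a $(-n)$-degree complex isomorphism of dg $\tilde A$-bimodules.
   Context: $k$ is a field of arbitrary characteristic; $\otimes=\otimes_k$, $\operatorname{Hom}=\operatorname{Hom}_k$; bimodules are $k$-central. $A=S(V)=T(V)/(R)$ with $R\subseteq V\otimes V$ spanned by $x\otimes y-y\otimes x$ ($x,y\in V$). $W_0=k$, $W_1=V$, $W_2=R$, $W_p=\bigcap_{i+2+j=p}V^{\otimes i}\otimes R\otimes V^{\otimes j}$ for $p\ge3$. $W_p$ is the image of $\mathrm{Ant}_p(v_1\otimes\cdots\otimes v_p)=\sum_{\sigma\in\Sigma_p}\operatorname{sgn}(\sigma)v_{\sigma^{-1}(1)}\otimes\cdots\otimes v_{\sigma^{-1}(p)}$ on $V^{\otimes p}$, and $\mathrm{Ant}_p$ induces an isomorphism $\Lambda^p(V)\to W_p$ by which $\Lambda^p(V)$ and $W_p$ are identified. Elements of $W_p$ are written $y_1\ldots y_p$ (a sum of such products of elements of $V$ is understood), using $W_p\subseteq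 V^{\otimes q}\otimes W_r\otimes V^{\otimes s}$ for $q+r+s=p$. Koszul $p$-cochains with coefficients in an $A$-bimodule $M$ are elements of $\operatorname{Hom}(W_p,M)$, with differential $b_K(f)(y_1\ldots y_{p+1})=f(y_1\ldots y_p)y_{p+1}-(-1)^py_1f(y_2\ldots y_{p+1})$. Koszul $q$-chains are elements of $M\otimes W_q$, with differential $b^K(m\otimes y_1\ldots y_q)=my_1\otimes y_2\ldots y_q+(-1)^qy_qm\otimes y_1\ldots y_{q-1}$; $q$-chains are given cohomological degree $-q$. Cup product, for a $p$-cochain $f$ and a $q$-cochain $g$, one with coefficients in $A$ and the other in $A$ or $M$: $(f\smile g)(y_1\ldots y_{p+q})=(-1)^{pq}f(y_1\ldots y_p)g(y_{p+1}\ldots y_{p+q})$. Cap products, for a $p$-cochain $f$ and a $q$-chain $z=m\otimes y_1\ldots y_q$, at least one of them having coefficients in $A$: $f\frown z=(-1)^{(q-p)p}f(y_{q-p+1}\ldots y_q)m\otimes y_1\ldots y_{q-p}$, $z\frown f=(-1)^{pq}mf(y_1\ldots y_p)\otimes y_{p+1}\ldots y_q$ if $p\le q$, both zero if $p>q$. The Koszul cochain dg algebra is $\tilde A=(\operatorname{Hom}(W_\bullet,A),b_K,\smile)$. $\operatorname{Hom}(W_\bullet,M)$ and $M\otimes W_\bullet$ are dg $\tilde A$-bimodules via $\smile$ and $\frown$ respectively. A $(-n)$-degree complex isomorphism $\theta$ of dg $\tilde A$-bimodules is a bijective linear map sending $p$-cochains to $(n-p)$-chains, such that for $g\in\tilde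 A^q$ and any cochain $f$: $\theta(f\smile g)=\theta(f)\frown g$, $\theta(g\smile f)=(-1)^{nq}g\frown\theta(f)$, and $\theta(b_K(f))=(-1)^nb^K(\theta(f))$. *)

theory Defs
  imports
    "HOL-Algebra.Algebra"
    "HOL-Algebra.Algebraic_Closure_Type"
    "HOL-Library.Poly_Mapping"
    "HOL-Combinatorics.Permutations"
begin

text \<open>
  The vector space \<open>V\<close> is a type \<open>'v\<close> with a scalar multiplication \<open>s\<close> over a field type \<open>'k\<close>
  satisfying the locale predicate \<open>vector_space s\<close>. Algebras, bimodules and tensor products
  are records in the style of HOL-Algebra.
\<close>

subsection \<open>The tensor algebra and the symmetric algebra\<close>

text \<open>
  With lists as the free monoid, \<open>'v list \<Rightarrow>\<^sub>0 'k\<close> carries the convolution product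
  and is the free associative unital \<open>'k\<close>-algebra on the \<^emph>\<open>set\<close> of all vectors.
\<close>

instantiation list :: (type) monoid_add
begin
definition zero_list :: "'a list" where "zero_list = []"
definition plus_list :: "'a list \<Rightarrow> 'a list \<Rightarrow> 'a list" where "plus_list = (@)"
instance by standard (simp_all add: zero_list_def plus_list_def)
end

type_synonym ('v, 'k) tens = "('v list \<Rightarrow>\<^sub>0 'k) set"
type_synonym ('v, 'k) symm = "('v, 'k) tens set"

definition linearity_relations ::
  "('k::field \<Rightarrow> 'v::ab_group_add \<Rightarrow> 'v) \<Rightarrow> ('v list \<Rightarrow>\<^sub>0 'k) set" where
  "linearity_relations s =
     {Poly_Mapping.single [u + v] 1 - Poly_Mapping.single [u] 1 - Poly_Mapping.single [v] 1 | u v. True}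
   \<union> {Poly_Mapping.single [s a v] 1 - Poly_Mapping.single [v] a | a v. True}"

definition linearity_ideal ::
  "('k::field \<Rightarrow> 'v::ab_group_add \<Rightarrow> 'v) \<Rightarrow> ('v list \<Rightarrow>\<^sub>0 'k) set" where
  "linearity_ideal s = genideal ring_of_type_algebra (linearity_relations s)"

definition tensor_algebra ::
  "('k::field \<Rightarrow> 'v::ab_group_add \<Rightarrow> 'v) \<Rightarrow> ('v, 'k) tens ring" where
  "tensor_algebra s = ring_of_type_algebra Quot linearity_ideal s"

definition tclass ::
  "('k::field \<Rightarrow> 'v::ab_group_add \<Rightarrow> 'v) \<Rightarrow> ('v list \<Rightarrow>\<^sub>0 'k) \<Rightarrow> ('v, 'k) tens" where
  "tclass s f = linearity_ideal s +>\<^bsub>ring_of_type_algebra\<^esub> f"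

definition tvec ::
  "('k::field \<Rightarrow> 'v::ab_group_add \<Rightarrow> 'v) \<Rightarrow> 'v \<Rightarrow> ('v, 'k) tens" where
  "tvec s v = tclass s (Poly_Mapping.single [v] 1)"

definition tscalar ::
  "('k::field \<Rightarrow> 'v::ab_group_add \<Rightarrow> 'v) \<Rightarrow> 'k \<Rightarrow> ('v, 'k) tens" where
  "tscalar s a = tclass s (Poly_Mapping.single [] a)"

definition kspan ::
  "('k::field \<Rightarrow> 'v::ab_group_add \<Rightarrow> 'v) \<Rightarrow> ('v, 'k) tens set \<Rightarrow> ('v, 'k) tens set" where
  "kspan s U = generate (add_monoid (tensor_algebra s))
     {tscalar s a \<otimes>\<^bsub>tensor_algebra s\<^esub> t | a t. t \<in> U}"

text \<open>
  For subspaces \<open>U\<close> and \<open>U'\<close> of tensor powers of \<open>V\<close>, the subspace \<open>U \<otimes> U'\<close> of the tensor algebra.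
\<close>

definition tprod ::
  "('k::field \<Rightarrow> 'v::ab_group_add \<Rightarrow> 'v)
    \<Rightarrow> ('v, 'k) tens set \<Rightarrow> ('v, 'k) tens set \<Rightarrow> ('v, 'k) tens set" where
  "tprod s U U' = kspan s {t \<otimes>\<^bsub>tensor_algebra s\<^esub> u | t u. t \<in> U \<and> u \<in> U'}"

primrec tpower ::
  "('k::field \<Rightarrow> 'v::ab_group_add \<Rightarrow> 'v) \<Rightarrow> nat \<Rightarrow> ('v, 'k) tens set" where
  "tpower s 0 = range (tscalar s)"
| "tpower s (Suc p) = tprod s (tpower s p) (range (tvec s))"

definition comm_relations ::
  "('k::field \<Rightarrow> 'v::ab_group_add \<Rightarrow> 'v) \<Rightarrow> ('v, 'k) tens set" where
  "comm_relations s = kspan s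
     {(tvec s x \<otimes>\<^bsub>tensor_algebra s\<^esub> tvec s y) \<ominus>\<^bsub>tensor_algebra s\<^esub> (tvec s y \<otimes>\<^bsub>tensor_algebra s\<^esub> tvec s x)
      | x y. True}"

definition comm_ideal ::
  "('k::field \<Rightarrow> 'v::ab_group_add \<Rightarrow> 'v) \<Rightarrow> ('v, 'k) tens set" where
  "comm_ideal s = genideal (tensor_algebra s) (comm_relations s)"

definition sym_algebra ::
  "('k::field \<Rightarrow> 'v::ab_group_add \<Rightarrow> 'v) \<Rightarrow> ('v, 'k) symm ring" where
  "sym_algebra s = tensor_algebra s Quot comm_ideal s"

definition sclass ::
  "('k::field \<Rightarrow> 'v::ab_group_add \<Rightarrow> 'v) \<Rightarrow> ('v, 'k) tens \<Rightarrow> ('v, 'k) symm" where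
  "sclass s t = comm_ideal s +>\<^bsub>tensor_algebra s\<^esub> t"

subsection \<open>The spaces \<open>W\<^sub>p\<close>\<close>

definition W ::
  "('k::field \<Rightarrow> 'v::ab_group_add \<Rightarrow> 'v) \<Rightarrow> nat \<Rightarrow> ('v, 'k) tens set" where
  "W s p =
    (if p = 0 then tpower s 0
     else if p = 1 then tpower s 1
     else if p = 2 then comm_relations s
     else \<Inter> {tprod s (tprod s (tpower s i) (comm_relations s)) (tpower s j) | i j. i + 2 + j = p})"

text \<open>
  \<open>Ant\<^sub>p (x\<^sub>1 \<otimes> \<dots> \<otimes> x\<^sub>p)\<close>, the element of \<open>W\<^sub>p\<close> identified with \<open>x\<^sub>1 \<and> \<dots> \<and> x\<^sub>p\<close>.
\<close>

definition wedge ::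
  "('k::field \<Rightarrow> 'v::ab_group_add \<Rightarrow> 'v) \<Rightarrow> nat \<Rightarrow> (nat \<Rightarrow> 'v) \<Rightarrow> ('v, 'k) tens" where
  "wedge s p x = tclass s
     (\<Sum>\<sigma> | \<sigma> permutes {1..p}.
        Poly_Mapping.single (map (\<lambda>i. x (inv_into UNIV \<sigma> i)) [1..<Suc p]) (of_int (sign \<sigma>)))"

subsection \<open>Bimodules over the symmetric algebra\<close>

text \<open>
  As for the library's modules, the record extends \<^typ>\<open>'m ring\<close>, but its multiplication and
  unit are irrelevant.
\<close>

record ('a, 'm) bimodule = "'m ring" +
  lact :: "'a \<Rightarrow> 'm \<Rightarrow> 'm"
  ract :: "'m \<Rightarrow> 'a \<Rightarrow> 'm"

definition mscale ::
  "('k::field \<Rightarrow> 'v::ab_group_add \<Rightarrow> 'v) \<Rightarrow> (('v, 'k) symm, 'm, 'z) bimodule_scheme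
    \<Rightarrow> 'k \<Rightarrow> 'm \<Rightarrow> 'm" where
  "mscale s M a m = lact M (sclass s (tscalar s a)) m"

locale sym_bimodule = abelian_group M
  for s :: "'k::field \<Rightarrow> 'v::ab_group_add \<Rightarrow> 'v"
    and M :: "(('v, 'k) symm, 'm, 'z) bimodule_scheme" (structure) +
  assumes lact_closed:
      "\<lbrakk>a \<in> carrier (sym_algebra s); m \<in> carrier M\<rbrakk> \<Longrightarrow> lact M a m \<in> carrier M"
    and ract_closed:
      "\<lbrakk>a \<in> carrier (sym_algebra s); m \<in> carrier M\<rbrakk> \<Longrightarrow> ract M m a \<in> carrier M"
    and lact_add_left:
      "\<lbrakk>a \<in> carrier (sym_algebra s); b \<in> carrier (sym_algebra s); m \<in> carrier M\<rbrakk>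
       \<Longrightarrow> lact M (a \<oplus>\<^bsub>sym_algebra s\<^esub> b) m = lact M a m \<oplus> lact M b m"
    and lact_add_right:
      "\<lbrakk>a \<in> carrier (sym_algebra s); m \<in> carrier M; m' \<in> carrier M\<rbrakk>
       \<Longrightarrow> lact M a (m \<oplus> m') = lact M a m \<oplus> lact M a m'"
    and ract_add_left:
      "\<lbrakk>a \<in> carrier (sym_algebra s); m \<in> carrier M; m' \<in> carrier M\<rbrakk>
       \<Longrightarrow> ract M (m \<oplus> m') a = ract M m a \<oplus> ract M m' a"
    and ract_add_right:
      "\<lbrakk>a \<in> carrier (sym_algebra s); b \<in> carrier (sym_algebra s); m \<in> carrier M\<rbrakk>
       \<Longrightarrow> ract M m (a \<oplus>\<^bsub>sym_algebra s\<^esub> b) = ract M m a \<oplus> ract M m b"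
    and lact_mult:
      "\<lbrakk>a \<in> carrier (sym_algebra s); b \<in> carrier (sym_algebra s); m \<in> carrier M\<rbrakk>
       \<Longrightarrow> lact M (a \<otimes>\<^bsub>sym_algebra s\<^esub> b) m = lact M a (lact M b m)"
    and ract_mult:
      "\<lbrakk>a \<in> carrier (sym_algebra s); b \<in> carrier (sym_algebra s); m \<in> carrier M\<rbrakk>
       \<Longrightarrow> ract M m (a \<otimes>\<^bsub>sym_algebra s\<^esub> b) = ract M (ract M m a) b"
    and lact_one: "m \<in> carrier M \<Longrightarrow> lact M \<one>\<^bsub>sym_algebra s\<^esub> m = m"
    and ract_one: "m \<in> carrier M \<Longrightarrow> ract M m \<one>\<^bsub>sym_algebra s\<^esub> = m"
    and lact_ract:
      "\<lbrakk>a \<in> carrier (sym_algebra s); b \<in> carrier (sym_algebra s); m \<in> carrier M\<rbrakk>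
       \<Longrightarrow> ract M (lact M a m) b = lact M a (ract M m b)"
    and central:
      "m \<in> carrier M \<Longrightarrow>
       lact M (sclass s (tscalar s c)) m = ract M m (sclass s (tscalar s c))"

definition self_bimodule ::
  "('k::field \<Rightarrow> 'v::ab_group_add \<Rightarrow> 'v) \<Rightarrow> (('v, 'k) symm, ('v, 'k) symm) bimodule" where
  "self_bimodule s =
    \<lparr>carrier = carrier (sym_algebra s), monoid.mult = monoid.mult (sym_algebra s), one = one (sym_algebra s),
     ring.zero = ring.zero (sym_algebra s), add = add (sym_algebra s),
     lact = monoid.mult (sym_algebra s), ract = monoid.mult (sym_algebra s)\<rparr>"

subsection \<open>Tensor products \<open>M \<otimes> U\<close>\<close>

text \<open>
  \<open>M \<otimes> U\<close>, for a subspace \<open>U\<close> of the tensor algebra, is the free vector space on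
  \<open>carrier M \<times> U\<close> modulo the bilinearity relations.
\<close>

definition free_space :: "'x set \<Rightarrow> ('x \<Rightarrow>\<^sub>0 'k::field) ring" where
  "free_space S =
    \<lparr>carrier = {f. Poly_Mapping.keys f \<subseteq> S}, monoid.mult = undefined, one = undefined,
     ring.zero = 0, add = (+)\<rparr>"

definition bilinearity_relations ::
  "('k::field \<Rightarrow> 'v::ab_group_add \<Rightarrow> 'v) \<Rightarrow> (('v, 'k) symm, 'm, 'z) bimodule_scheme
    \<Rightarrow> ('v, 'k) tens set \<Rightarrow> ('m \<times> ('v, 'k) tens \<Rightarrow>\<^sub>0 'k) set" where
  "bilinearity_relations s M U =
     {Poly_Mapping.single (m \<oplus>\<^bsub>M\<^esub> m', t) a - Poly_Mapping.single (m, t) a - Poly_Mapping.single (m', t) a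
      | m m' t a. m \<in> carrier M \<and> m' \<in> carrier M \<and> t \<in> U}
   \<union> {Poly_Mapping.single (m, t \<oplus>\<^bsub>tensor_algebra s\<^esub> t') a - Poly_Mapping.single (m, t) a - Poly_Mapping.single (m, t') a
      | m t t' a. m \<in> carrier M \<and> t \<in> U \<and> t' \<in> U}
   \<union> {Poly_Mapping.single (mscale s M c m, t) a - Poly_Mapping.single (m, t) (a * c)
      | m t a c. m \<in> carrier M \<and> t \<in> U}
   \<union> {Poly_Mapping.single (m, tscalar s c \<otimes>\<^bsub>tensor_algebra s\<^esub> t) a - Poly_Mapping.single (m, t) (a * c)
      | m t a c. m \<in> carrier M \<and> t \<in> U}"

definition bilinearity_subspace ::
  "('k::field \<Rightarrow> 'v::ab_group_add \<Rightarrow> 'v) \<Rightarrow> (('v, 'k) symm, 'm, 'z) bimodule_scheme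
    \<Rightarrow> ('v, 'k) tens set \<Rightarrow> ('m \<times> ('v, 'k) tens \<Rightarrow>\<^sub>0 'k) set" where
  "bilinearity_subspace s M U =
     generate (add_monoid (free_space (carrier M \<times> U))) (bilinearity_relations s M U)"

definition tensor ::
  "('k::field \<Rightarrow> 'v::ab_group_add \<Rightarrow> 'v) \<Rightarrow> (('v, 'k) symm, 'm, 'z) bimodule_scheme
    \<Rightarrow> ('v, 'k) tens set \<Rightarrow> ('k, ('m \<times> ('v, 'k) tens \<Rightarrow>\<^sub>0 'k) set) module" where
  "tensor s M U =
    \<lparr>carrier = a_rcosets\<^bsub>free_space (carrier M \<times> U)\<^esub> (bilinearity_subspace s M U),
     monoid.mult = undefined, one = undefined,
     ring.zero = bilinearity_subspace s M U,
     add = set_add (free_space (carrier M \<times> U)),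
     module.smult = (\<lambda>a C. \<Union>f\<in>C. bilinearity_subspace s M U
                +>\<^bsub>free_space (carrier M \<times> U)\<^esub> Poly_Mapping.map ((*) a) f)\<rparr>"

definition pure_tensor ::
  "('k::field \<Rightarrow> 'v::ab_group_add \<Rightarrow> 'v) \<Rightarrow> (('v, 'k) symm, 'm, 'z) bimodule_scheme
    \<Rightarrow> ('v, 'k) tens set \<Rightarrow> 'm \<Rightarrow> ('v, 'k) tens \<Rightarrow> ('m \<times> ('v, 'k) tens \<Rightarrow>\<^sub>0 'k) set" where
  "pure_tensor s M U m t =
     bilinearity_subspace s M U +>\<^bsub>free_space (carrier M \<times> U)\<^esub> Poly_Mapping.single (m, t) 1"

subsection \<open>Koszul cochains and chains\<close>

text \<open>Linear maps are extensional, i.e. \<open>undefined\<close> outside \<open>W\<^sub>p\<close>.\<close>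

definition cochains ::
  "('k::field \<Rightarrow> 'v::ab_group_add \<Rightarrow> 'v) \<Rightarrow> (('v, 'k) symm, 'm, 'z) bimodule_scheme
    \<Rightarrow> nat \<Rightarrow> ('k, ('v, 'k) tens \<Rightarrow> 'm) module" where
  "cochains s M p =
    \<lparr>carrier = {f \<in> W s p \<rightarrow>\<^sub>E carrier M.
        (\<forall>t\<in>W s p. \<forall>u\<in>W s p. f (t \<oplus>\<^bsub>tensor_algebra s\<^esub> u) = f t \<oplus>\<^bsub>M\<^esub> f u)
      \<and> (\<forall>a. \<forall>t\<in>W s p. f (tscalar s a \<otimes>\<^bsub>tensor_algebra s\<^esub> t) = mscale s M a (f t))},
     monoid.mult = undefined, one = undefined,
     ring.zero = (\<lambda>t\<in>W s p. \<zero>\<^bsub>M\<^esub>),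
     add = (\<lambda>f g. \<lambda>t\<in>W s p. f t \<oplus>\<^bsub>M\<^esub> g t),
     module.smult = (\<lambda>a f. \<lambda>t\<in>W s p. mscale s M a (f t))\<rparr>"

text \<open>Chain degrees are integers, with \<open>W\<^sub>q = 0\<close> for \<open>q < 0\<close>.\<close>

definition W_int ::
  "('k::field \<Rightarrow> 'v::ab_group_add \<Rightarrow> 'v) \<Rightarrow> int \<Rightarrow> ('v, 'k) tens set" where
  "W_int s q = (if q < 0 then {\<zero>\<^bsub>tensor_algebra s\<^esub>} else W s (nat q))"

definition chains ::
  "('k::field \<Rightarrow> 'v::ab_group_add \<Rightarrow> 'v) \<Rightarrow> (('v, 'k) symm, 'm, 'z) bimodule_scheme
    \<Rightarrow> int \<Rightarrow> ('k, ('m \<times> ('v, 'k) tens \<Rightarrow>\<^sub>0 'k) set) module" where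
  "chains s M q = tensor s M (W_int s q)"

definition pure_chain ::
  "('k::field \<Rightarrow> 'v::ab_group_add \<Rightarrow> 'v) \<Rightarrow> (('v, 'k) symm, 'm, 'z) bimodule_scheme
    \<Rightarrow> int \<Rightarrow> 'm \<Rightarrow> ('v, 'k) tens \<Rightarrow> ('m \<times> ('v, 'k) tens \<Rightarrow>\<^sub>0 'k) set" where
  "pure_chain s M q m t = pure_tensor s M (W_int s q) m t"

text \<open>
  \<open>sum_ext G H P r b\<close> is the additive map with \<open>r i \<mapsto> b i\<close> for \<open>i \<in> P\<close>: an element written
  as a finite sum of \<open>r i\<close>'s is sent to the sum of the corresponding \<open>b i\<close>'s. It is applied only
  where the result does not depend on the way the element is written.
  This renders the convention that an element \<open>y\<^sub>1 \<dots> y\<^sub>p\<^sub>+\<^sub>q\<close> of \<open>W\<^sub>p\<^sub>+\<^sub>q\<close> stands for a sum of products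
  of elements \<open>y\<^sub>1 \<dots> y\<^sub>p\<close> of \<open>W\<^sub>p\<close> and \<open>y\<^sub>p\<^sub>+\<^sub>1 \<dots> y\<^sub>p\<^sub>+\<^sub>q\<close> of \<open>W\<^sub>q\<close> (\<open>split_ext\<close>), and that a chain
  is a sum of pure tensors (\<open>chain_ext\<close>).
\<close>

definition sum_ext ::
  "('g, 'y) ring_scheme \<Rightarrow> ('h, 'z) ring_scheme \<Rightarrow> 'i set \<Rightarrow> ('i \<Rightarrow> 'g) \<Rightarrow> ('i \<Rightarrow> 'h) \<Rightarrow> 'g \<Rightarrow> 'h" where
  "sum_ext G H P r b t = (THE h. \<exists>ps. set ps \<subseteq> P
      \<and> t = (\<Oplus>\<^bsub>G\<^esub>i\<in>{..<length ps}. r (ps ! i))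
      \<and> h = (\<Oplus>\<^bsub>H\<^esub>i\<in>{..<length ps}. b (ps ! i)))"

definition split_ext ::
  "('k::field \<Rightarrow> 'v::ab_group_add \<Rightarrow> 'v) \<Rightarrow> ('h, 'z) ring_scheme \<Rightarrow> nat \<Rightarrow> nat
    \<Rightarrow> (('v, 'k) tens \<Rightarrow> ('v, 'k) tens \<Rightarrow> 'h) \<Rightarrow> ('v, 'k) tens \<Rightarrow> 'h" where
  "split_ext s H p q b = sum_ext (tensor_algebra s) H (W s p \<times> W s q)
     (\<lambda>(t, u). t \<otimes>\<^bsub>tensor_algebra s\<^esub> u) (\<lambda>(t, u). b t u)"

definition chain_ext ::
  "('k::field \<Rightarrow> 'v::ab_group_add \<Rightarrow> 'v) \<Rightarrow> (('v, 'k) symm, 'm, 'y) bimodule_scheme \<Rightarrow> int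
    \<Rightarrow> ('h, 'z) ring_scheme \<Rightarrow> ('m \<Rightarrow> ('v, 'k) tens \<Rightarrow> 'h)
    \<Rightarrow> ('m \<times> ('v, 'k) tens \<Rightarrow>\<^sub>0 'k) set \<Rightarrow> 'h" where
  "chain_ext s M q H b = sum_ext (chains s M q) H (carrier M \<times> W_int s q)
     (\<lambda>(m, t). pure_chain s M q m t) (\<lambda>(m, t). b m t)"

definition neg_pow :: "('h, 'z) ring_scheme \<Rightarrow> nat \<Rightarrow> 'h \<Rightarrow> 'h" where
  "neg_pow H k h = (if even k then h else \<ominus>\<^bsub>H\<^esub> h)"

definition cochain_diff ::
  "('k::field \<Rightarrow> 'v::ab_group_add \<Rightarrow> 'v) \<Rightarrow> (('v, 'k) symm, 'm, 'z) bimodule_scheme \<Rightarrow> nat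
    \<Rightarrow> (('v, 'k) tens \<Rightarrow> 'm) \<Rightarrow> ('v, 'k) tens \<Rightarrow> 'm" where
  "cochain_diff s M p f = (\<lambda>w\<in>W s (Suc p).
      split_ext s M p 1 (\<lambda>t y. ract M (f t) (sclass s y)) w
      \<ominus>\<^bsub>M\<^esub> neg_pow M p (split_ext s M 1 p (\<lambda>y t. lact M (sclass s y) (f t)) w))"

definition chain_diff ::
  "('k::field \<Rightarrow> 'v::ab_group_add \<Rightarrow> 'v) \<Rightarrow> (('v, 'k) symm, 'm, 'z) bimodule_scheme \<Rightarrow> int
    \<Rightarrow> ('m \<times> ('v, 'k) tens \<Rightarrow>\<^sub>0 'k) set \<Rightarrow> ('m \<times> ('v, 'k) tens \<Rightarrow>\<^sub>0 'k) set" where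
  "chain_diff s M q z =
    (let H = chains s M (q - 1) in
     if q \<le> 0 then \<zero>\<^bsub>H\<^esub>
     else chain_ext s M q H
       (\<lambda>m w.
          split_ext s H 1 (nat q - 1) (\<lambda>y t. pure_chain s M (q - 1) (ract M m (sclass s y)) t) w
          \<oplus>\<^bsub>H\<^esub> neg_pow H (nat q)
            (split_ext s H (nat q - 1) 1 (\<lambda>t y. pure_chain s M (q - 1) (lact M (sclass s y) m) t) w)) z)"

subsection \<open>Cup and cap products\<close>

text \<open>
  The parameter \<open>mu\<close> multiplies coefficients, in the order in which they occur in
  the product; it is a left or right action of the symmetric algebra on \<open>M\<close>, depending on which
  factor has coefficients in the algebra. In the cap products the cochain has degree
  \<open>p\<close>, the chain has degree \<open>q\<close> and coefficients in \<open>N\<close>, and the result has coefficients in \<open>M\<close>.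
\<close>

definition cup ::
  "('k::field \<Rightarrow> 'v::ab_group_add \<Rightarrow> 'v) \<Rightarrow> (('v, 'k) symm, 'm, 'z) bimodule_scheme
    \<Rightarrow> ('a \<Rightarrow> 'b \<Rightarrow> 'm) \<Rightarrow> nat \<Rightarrow> nat
    \<Rightarrow> (('v, 'k) tens \<Rightarrow> 'a) \<Rightarrow> (('v, 'k) tens \<Rightarrow> 'b) \<Rightarrow> ('v, 'k) tens \<Rightarrow> 'm" where
  "cup s M mu p q f g = (\<lambda>w\<in>W s (p + q).
      neg_pow M (p * q) (split_ext s M p q (\<lambda>t u. mu (f t) (g u)) w))"

definition cap_left ::
  "('k::field \<Rightarrow> 'v::ab_group_add \<Rightarrow> 'v) \<Rightarrow> (('v, 'k) symm, 'n, 'y) bimodule_scheme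
    \<Rightarrow> (('v, 'k) symm, 'm, 'z) bimodule_scheme \<Rightarrow> ('a \<Rightarrow> 'n \<Rightarrow> 'm) \<Rightarrow> nat \<Rightarrow> int
    \<Rightarrow> (('v, 'k) tens \<Rightarrow> 'a) \<Rightarrow> ('n \<times> ('v, 'k) tens \<Rightarrow>\<^sub>0 'k) set
    \<Rightarrow> ('m \<times> ('v, 'k) tens \<Rightarrow>\<^sub>0 'k) set" where
  "cap_left s N M mu p q f z =
    (let H = chains s M (q - int p) in
     if int p > q then \<zero>\<^bsub>H\<^esub>
     else neg_pow H ((nat q - p) * p)
       (chain_ext s N q H
         (\<lambda>m w. split_ext s H (nat q - p) p
            (\<lambda>t u. pure_chain s M (q - int p) (mu (f u) m) t) w) z))"

definition cap_right ::
  "('k::field \<Rightarrow> 'v::ab_group_add \<Rightarrow> 'v) \<Rightarrow> (('v, 'k) symm, 'n, 'y) bimodule_scheme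
    \<Rightarrow> (('v, 'k) symm, 'm, 'z) bimodule_scheme \<Rightarrow> ('n \<Rightarrow> 'a \<Rightarrow> 'm) \<Rightarrow> int \<Rightarrow> nat
    \<Rightarrow> ('n \<times> ('v, 'k) tens \<Rightarrow>\<^sub>0 'k) set \<Rightarrow> (('v, 'k) tens \<Rightarrow> 'a)
    \<Rightarrow> ('m \<times> ('v, 'k) tens \<Rightarrow>\<^sub>0 'k) set" where
  "cap_right s N M mu q p z f =
    (let H = chains s M (q - int p) in
     if int p > q then \<zero>\<^bsub>H\<^esub>
     else neg_pow H (p * nat q)
       (chain_ext s N q H
         (\<lambda>m w. split_ext s H p (nat q - p)
            (\<lambda>t u. pure_chain s M (q - int p) (mu m (f t)) u) w) z))"

subsection \<open>Isomorphisms of dg bimodules and the map \<open>\<theta>\<^sub>M\<close>\<close>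

text \<open>
  A map homogeneous of degree \<open>-n\<close> from the cochains to the chains is given by its components
  \<open>\<theta> p\<close>, from \<open>p\<close>-cochains to \<open>(n - p)\<close>-chains.
\<close>

definition dg_bimodule_iso ::
  "('k::field \<Rightarrow> 'v::ab_group_add \<Rightarrow> 'v) \<Rightarrow> (('v, 'k) symm, 'm, 'z) bimodule_scheme \<Rightarrow> nat
    \<Rightarrow> (nat \<Rightarrow> (('v, 'k) tens \<Rightarrow> 'm) \<Rightarrow> ('m \<times> ('v, 'k) tens \<Rightarrow>\<^sub>0 'k) set) \<Rightarrow> bool" where
  "dg_bimodule_iso s M n \<theta> \<longleftrightarrow>
    (\<forall>p. bij_betw (\<theta> p) (carrier (cochains s M p)) (carrier (chains s M (int n - int p))))
  \<and> (\<forall>p. \<forall>f\<in>carrier (cochains s M p). \<forall>g\<in>carrier (cochains s M p).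
        \<theta> p (f \<oplus>\<^bsub>cochains s M p\<^esub> g) = \<theta> p f \<oplus>\<^bsub>chains s M (int n - int p)\<^esub> \<theta> p g)
  \<and> (\<forall>p a. \<forall>f\<in>carrier (cochains s M p).
        \<theta> p (a \<odot>\<^bsub>cochains s M p\<^esub> f) = a \<odot>\<^bsub>chains s M (int n - int p)\<^esub> \<theta> p f)
  \<and> (\<forall>p q. \<forall>f\<in>carrier (cochains s M p). \<forall>g\<in>carrier (cochains s (self_bimodule s) q).
        \<theta> (p + q) (cup s M (ract M) p q f g)
          = cap_right s M M (ract M) (int n - int p) q (\<theta> p f) g)
  \<and> (\<forall>p q. \<forall>f\<in>carrier (cochains s M p). \<forall>g\<in>carrier (cochains s (self_bimodule s) q).
        \<theta> (q + p) (cup s M (lact M) q p g f)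
          = neg_pow (chains s M (int n - int (q + p))) (n * q)
              (cap_left s M M (lact M) q (int n - int p) g (\<theta> p f)))
  \<and> (\<forall>p. \<forall>f\<in>carrier (cochains s M p).
        \<theta> (Suc p) (cochain_diff s M p f)
          = neg_pow (chains s M (int n - int (Suc p))) n
              (chain_diff s M (int n - int p) (\<theta> p f)))"

definition fundamental_chain ::
  "('k::field \<Rightarrow> 'v::ab_group_add \<Rightarrow> 'v) \<Rightarrow> nat \<Rightarrow> (nat \<Rightarrow> 'v)
    \<Rightarrow> (('v, 'k) symm \<times> ('v, 'k) tens \<Rightarrow>\<^sub>0 'k) set" where
  "fundamental_chain s n x =
     pure_chain s (self_bimodule s) (int n) \<one>\<^bsub>sym_algebra s\<^esub> (wedge s n x)"

definition theta ::
  "('k::field \<Rightarrow> 'v::ab_group_add \<Rightarrow> 'v) \<Rightarrow> (('v, 'k) symm, 'm, 'z) bimodule_scheme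
    \<Rightarrow> nat \<Rightarrow> (nat \<Rightarrow> 'v) \<Rightarrow> nat \<Rightarrow> (('v, 'k) tens \<Rightarrow> 'm) \<Rightarrow> ('m \<times> ('v, 'k) tens \<Rightarrow>\<^sub>0 'k) set" where
  "theta s M n x p f =
     cap_right s (self_bimodule s) M (lact M) (int n) p (fundamental_chain s n x) f"

end

theory Submission
  imports Defs
begin

text \<open>
  In the coordinates given by the basis, an element of the tensor algebra is a finitely supported
  function on the words in \<open>1, \<dots>, n\<close>, and \<open>W\<^sub>p\<close> consists of the functions on words of length \<open>p\<close>
  that change sign when two adjacent letters are swapped and vanish when two adjacent letters are
  equal; the second condition takes care of characteristic 2. Such a function is determined
  by its values on the strictly increasing words, which therefore index a basis of \<open>W\<^sub>p\<close>, and every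
  element of \<open>W\<^sub>p\<^sub>+\<^sub>q\<close> has an explicit decomposition in \<open>W\<^sub>p \<otimes> W\<^sub>q\<close>. In the decomposition of
  \<open>x\<^sub>1 \<and> \<dots> \<and> x\<^sub>n\<close> each increasing word is paired with its complement, with coefficient \<open>1\<close> or \<open>-1\<close>,
  so \<open>\<theta>\<^sub>M\<close> permutes coordinates up to sign and is bijective.

  Compatibility with the right action of cochains is coassociativity of the decomposition;
  for the left action one also rotates the letters of \<open>x\<^sub>1 \<and> \<dots> \<and> x\<^sub>n\<close> cyclically. If \<open>e\<close> denotes the
  inclusion of \<open>W\<^sub>1 = V\<close> in \<open>A\<close>, then \<open>b\<^sub>K(f) = (-1)\<^sup>p f \<smile> e - e \<smile> f\<close> and
  \<open>b\<^sup>K(z) = (-1)\<^sup>q z \<frown> e - e \<frown> z\<close>, so compatibility with the differentials follows from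
  compatibility with the two actions.
\<close>

subsection \<open>Vector spaces and linear maps as records\<close>

text \<open>The cup and cap products and both differentials are given by \<open>sum_ext\<close>, a
  definite description over all ways of writing an element as a sum. Before anything can be
  computed, each of them needs an additive map on the whole ambient group with the prescribed values
  on the generators, together with one way of writing the argument. For elements of
  \<open>W\<^sub>p\<^sub>+\<^sub>q\<close> the additive map is \<open>splitsum\<close>, given by
  coordinates; for chains it comes from the universal property of the tensor product. Every identity
  then becomes one between sums over increasing words, with \<open>trisum\<close> as the normal
  form: a cup product followed by \<open>theta\<close> splits \<open>omega\<close> as
  \<open>(p + q) + r\<close>, while \<open>theta\<close> followed by a cap product splits it as
  \<open>p + (q + r)\<close>. Signs are compared as parities of exponents after substituting
  \<open>n = p + q + r\<close>. Degrees in which the target has negative chain degree are treated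
  apart, because everything vanishes there.\<close>

definition additive :: "('g, 'y) ring_scheme \<Rightarrow> ('h, 'z) ring_scheme \<Rightarrow> ('g \<Rightarrow> 'h) \<Rightarrow> bool" where
  "additive G H \<phi> \<longleftrightarrow> \<phi> \<in> carrier G \<rightarrow> carrier H
    \<and> (\<forall>x\<in>carrier G. \<forall>y\<in>carrier G. \<phi> (x \<oplus>\<^bsub>G\<^esub> y) = \<phi> x \<oplus>\<^bsub>H\<^esub> \<phi> y)"

lemma additive_closed: "additive G H \<phi> \<Longrightarrow> x \<in> carrier G \<Longrightarrow> \<phi> x \<in> carrier H"
  and additive_add: "additive G H \<phi> \<Longrightarrow> x \<in> carrier G \<Longrightarrow> y \<in> carrier G \<Longrightarrow> \<phi> (x \<oplus>\<^bsub>G\<^esub> y) = \<phi> x \<oplus>\<^bsub>H\<^esub> \<phi> y"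
  by (auto simp: additive_def)

lemma additive_hom:
  assumes "abelian_group G" "abelian_group H" "additive G H \<phi>"
  shows "abelian_group_hom G H \<phi>"
  using assms
  by (auto simp: additive_def abelian_group_hom_def abelian_group_hom_axioms_def group_hom_def
      group_hom_axioms_def hom_def abelian_group.a_group)

lemma additive_zero:
  assumes "abelian_group G" "abelian_group H" "additive G H \<phi>"
  shows "\<phi> \<zero>\<^bsub>G\<^esub> = \<zero>\<^bsub>H\<^esub>"
  using abelian_group_hom.hom_zero[OF additive_hom[OF assms]] .

lemma additive_neg:
  assumes "abelian_group G" "abelian_group H" "additive G H \<phi>" "x \<in> carrier G"
  shows "\<phi> (\<ominus>\<^bsub>G\<^esub> x) = \<ominus>\<^bsub>H\<^esub> \<phi> x"
  using abelian_group_hom.hom_a_inv[OF additive_hom[OF assms(1-3)] assms(4)] .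

lemma additive_finsum:
  assumes G: "abelian_group G" and H: "abelian_group H" and a: "additive G H \<phi>"
    and f: "\<And>i. i \<in> A \<Longrightarrow> f i \<in> carrier G"
  shows "\<phi> (\<Oplus>\<^bsub>G\<^esub>i\<in>A. f i) = (\<Oplus>\<^bsub>H\<^esub>i\<in>A. \<phi> (f i))"
proof -
  interpret G: abelian_group G by fact
  interpret H: abelian_group H by fact
  show ?thesis using f
  proof (induction A rule: infinite_finite_induct)
    case (insert x A)
    have "\<phi> (\<Oplus>\<^bsub>G\<^esub>i\<in>insert x A. f i) = \<phi> (f x \<oplus>\<^bsub>G\<^esub> (\<Oplus>\<^bsub>G\<^esub>i\<in>A. f i))"
      using insert by (subst G.finsum_insert) auto
    also have "\<dots> = \<phi> (f x) \<oplus>\<^bsub>H\<^esub> \<phi> (\<Oplus>\<^bsub>G\<^esub>i\<in>A. f i)"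
      using insert by (intro additive_add[OF a] G.finsum_closed) auto
    also have "\<dots> = (\<Oplus>\<^bsub>H\<^esub>i\<in>insert x A. \<phi> (f i))"
      using insert additive_closed[OF a] by (subst H.finsum_insert) auto
    finally show ?case .
  qed (auto simp: additive_zero[OF G H a])
qed

lemma (in abelian_monoid) finsum_swap:
  assumes "finite A" "finite B" "\<And>a b. a \<in> A \<Longrightarrow> b \<in> B \<Longrightarrow> f a b \<in> carrier G"
  shows "(\<Oplus>a\<in>A. \<Oplus>b\<in>B. f a b) = (\<Oplus>b\<in>B. \<Oplus>a\<in>A. f a b)"
  using assms(1,3)
proof (induction A rule: finite_induct)
  case empty
  then show ?case by (simp add: finsum_zero)
next
  case (insert x A)
  have "(\<Oplus>a\<in>insert x A. \<Oplus>b\<in>B. f a b) = (\<Oplus>b\<in>B. f x b) \<oplus> (\<Oplus>b\<in>B. \<Oplus>a\<in>A. f a b)"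
    using insert by (subst finsum_insert) (auto intro!: finsum_closed)
  also have "\<dots> = (\<Oplus>b\<in>B. f x b \<oplus> (\<Oplus>a\<in>A. f a b))"
    using insert by (subst finsum_addf) (auto intro!: finsum_closed)
  also have "\<dots> = (\<Oplus>b\<in>B. \<Oplus>a\<in>insert x A. f a b)"
    using insert by (intro finsum_cong') (auto intro!: finsum_closed)
  finally show ?case .
qed

lemma (in abelian_monoid) finsum_eq_single:
  assumes "finite A" "i \<in> A" "f i \<in> carrier G" "\<And>j. j \<in> A \<Longrightarrow> j \<noteq> i \<Longrightarrow> f j = \<zero>"
  shows "(\<Oplus>j\<in>A. f j) = f i"
proof -
  have "(\<Oplus>j\<in>A. f j) = (\<Oplus>j\<in>{i}. f j)"
    using assms by (intro add.finprod_mono_neutral_cong_right) (auto, metis zero_closed)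
  then show ?thesis using assms by (simp add: finsum_insert)
qed

text \<open>\<open>sum_ext\<close> quantifies over lists, whereas the decompositions constructed
  below are sums over finite index sets.\<close>

lemma (in abelian_monoid) finsum_as_list:
  assumes "finite A" "\<And>a. a \<in> A \<Longrightarrow> f a \<in> carrier G"
  obtains xs where "set xs = A"
    and "(\<Oplus>a\<in>A. f a) = (\<Oplus>i\<in>{..<length xs}. f (xs ! i))"
proof -
  obtain xs where xs: "set xs = A" "distinct xs"
    using finite_distinct_list[OF assms(1)] by blast
  have "bij_betw ((!) xs) {..<length xs} A"
    using bij_betw_nth[OF xs(2) refl] xs by blast
  then have "(\<Oplus>a\<in>A. f a) = (\<Oplus>i\<in>{..<length xs}. f (xs ! i))"
    using finsum_reindex[of f "(!) xs" "{..<length xs}"] assms(2)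
    by (auto simp: bij_betw_def)
  with xs(1) that show ?thesis by blast
qed

text \<open>An additive map with the right values on generators gives the same result for every way
  of writing \<open>t\<close>, so the description is unique; the sum over \<open>A\<close> shows
  that there is at least one way. All evaluations of \<open>split_ext\<close> and
  \<open>chain_ext\<close> go through this lemma.\<close>

lemma sum_ext_eq:
  assumes G: "abelian_group G" and H: "abelian_group H" and \<phi>: "additive G H \<phi>"
    and r: "\<And>i. i \<in> P \<Longrightarrow> r i \<in> carrier G"
    and b: "\<And>i. i \<in> P \<Longrightarrow> \<phi> (r i) = b i"
    and fin: "finite A" "\<And>a. a \<in> A \<Longrightarrow> g a \<in> P" and t: "t = (\<Oplus>\<^bsub>G\<^esub>a\<in>A. r (g a))"
  shows "sum_ext G H P r b t = \<phi> t"
  unfolding sum_ext_def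
proof (rule the_equality)
  interpret G: abelian_group G by fact
  interpret H: abelian_group H by fact
  have sum: "\<phi> (\<Oplus>\<^bsub>G\<^esub>i\<in>{..<length ps}. r (ps ! i)) = (\<Oplus>\<^bsub>H\<^esub>i\<in>{..<length ps}. b (ps ! i))"
    if "set ps \<subseteq> P" for ps
  proof -
    have *: "ps ! i \<in> P" if "i < length ps" for i using that \<open>set ps \<subseteq> P\<close> nth_mem by blast
    then have "\<phi> (\<Oplus>\<^bsub>G\<^esub>i\<in>{..<length ps}. r (ps ! i)) = (\<Oplus>\<^bsub>H\<^esub>i\<in>{..<length ps}. \<phi> (r (ps ! i)))"
      using r by (intro additive_finsum[OF G H \<phi>]) auto
    also have "\<dots> = (\<Oplus>\<^bsub>H\<^esub>i\<in>{..<length ps}. b (ps ! i))"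
      using * r b additive_closed[OF \<phi>] by (intro H.finsum_cong') (auto, metis)
    finally show ?thesis .
  qed
  obtain xs where xs: "set xs = A" "t = (\<Oplus>\<^bsub>G\<^esub>i\<in>{..<length xs}. r (g (xs ! i)))"
    using G.finsum_as_list[OF fin(1), of "\<lambda>a. r (g a)"] fin(2) r t by metis
  have "set (map g xs) \<subseteq> P" using xs(1) fin(2) by auto
  moreover have t': "t = (\<Oplus>\<^bsub>G\<^esub>i\<in>{..<length (map g xs)}. r (map g xs ! i))"
    unfolding xs(2) using xs(1) fin(2) r by (intro G.finsum_cong') auto
  ultimately show "\<exists>ps. set ps \<subseteq> P \<and> t = (\<Oplus>\<^bsub>G\<^esub>i\<in>{..<length ps}. r (ps ! i))
      \<and> \<phi> t = (\<Oplus>\<^bsub>H\<^esub>i\<in>{..<length ps}. b (ps ! i))"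
    using sum by blast
  show "h = \<phi> t" if "\<exists>ps. set ps \<subseteq> P \<and> t = (\<Oplus>\<^bsub>G\<^esub>i\<in>{..<length ps}. r (ps ! i))
      \<and> h = (\<Oplus>\<^bsub>H\<^esub>i\<in>{..<length ps}. b (ps ! i))" for h
    using that sum by auto
qed

lemma (in abelian_group) neg_pow_closed: "x \<in> carrier G \<Longrightarrow> neg_pow G k x \<in> carrier G"
  and neg_pow_neg_pow: "x \<in> carrier G \<Longrightarrow> neg_pow G j (neg_pow G k x) = neg_pow G (j + k) x"
  and neg_pow_zero: "neg_pow G k \<zero> = \<zero>"
  by (auto simp: neg_pow_def minus_add)

text \<open>The base field is a type, so the library's modules over a ring record do not apply.\<close>

locale kspace = abelian_group E for E :: "('k::field, 'x, 'z) module_scheme" (structure) +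
  assumes smult_closed: "x \<in> carrier E \<Longrightarrow> a \<odot> x \<in> carrier E"
    and smult_l_distr: "x \<in> carrier E \<Longrightarrow> (a + b) \<odot> x = a \<odot> x \<oplus> b \<odot> x"
    and smult_r_distr: "x \<in> carrier E \<Longrightarrow> y \<in> carrier E \<Longrightarrow> a \<odot> (x \<oplus> y) = a \<odot> x \<oplus> a \<odot> y"
    and smult_assoc: "x \<in> carrier E \<Longrightarrow> (a * b) \<odot> x = a \<odot> (b \<odot> x)"
    and smult_one: "x \<in> carrier E \<Longrightarrow> 1 \<odot> x = x"
begin

lemma smult_zero: assumes "x \<in> carrier E" shows "0 \<odot> x = \<zero>"
proof -
  have "0 \<odot> x \<oplus> 0 \<odot> x = 0 \<odot> x" using smult_l_distr[OF assms, of 0 0] by simp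
  then show ?thesis using smult_closed[OF assms, of 0] by (metis add.r_cancel_one')
qed

lemma additive_smult: "additive E E (\<lambda>x. a \<odot> x)"
  by (simp add: additive_def smult_closed smult_r_distr)

lemma smult_neg_one: assumes "x \<in> carrier E" shows "(- 1) \<odot> x = \<ominus> x"
proof -
  have "(- 1) \<odot> x \<oplus> x = \<zero>"
    using smult_l_distr[OF assms, of "-1" 1] assms by (simp add: smult_one smult_zero)
  then show ?thesis using assms smult_closed by (metis minus_equality)
qed

lemma neg_pow_smult: "x \<in> carrier E \<Longrightarrow> neg_pow E k x = (- 1) ^ k \<odot> x"
  by (simp add: neg_pow_def smult_one smult_neg_one)

lemma smult_finsum:
  "(\<And>i. i \<in> A \<Longrightarrow> f i \<in> carrier E) \<Longrightarrow> a \<odot> (\<Oplus>i\<in>A. f i) = (\<Oplus>i\<in>A. a \<odot> f i)"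
  by (rule additive_finsum[OF abelian_group_axioms abelian_group_axioms additive_smult])

lemma finsum_smult:
  assumes x: "x \<in> carrier E"
  shows "(\<Oplus>i\<in>A. a i \<odot> x) = (\<Sum>i\<in>A. a i) \<odot> x"
  by (induction A rule: infinite_finite_induct)
    (auto simp: smult_zero[OF x] smult_l_distr[OF x] finsum_insert smult_closed[OF x])

end

definition klin :: "('k::field, 'x, 'z) module_scheme \<Rightarrow> ('k, 'y, 'w) module_scheme \<Rightarrow> ('x \<Rightarrow> 'y) \<Rightarrow> bool" where
  "klin E Y f \<longleftrightarrow> additive E Y f \<and> (\<forall>a. \<forall>x\<in>carrier E. f (a \<odot>\<^bsub>E\<^esub> x) = a \<odot>\<^bsub>Y\<^esub> f x)"

lemma klin_additive: "klin E Y f \<Longrightarrow> additive E Y f"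
  and klin_closed: "klin E Y f \<Longrightarrow> x \<in> carrier E \<Longrightarrow> f x \<in> carrier Y"
  and klin_add: "klin E Y f \<Longrightarrow> x \<in> carrier E \<Longrightarrow> y \<in> carrier E \<Longrightarrow> f (x \<oplus>\<^bsub>E\<^esub> y) = f x \<oplus>\<^bsub>Y\<^esub> f y"
  and klin_smult: "klin E Y f \<Longrightarrow> x \<in> carrier E \<Longrightarrow> f (a \<odot>\<^bsub>E\<^esub> x) = a \<odot>\<^bsub>Y\<^esub> f x"
  by (auto simp: klin_def additive_def)

lemma klinI:
  assumes "\<And>x. x \<in> carrier E \<Longrightarrow> f x \<in> carrier Y"
    and "\<And>x y. x \<in> carrier E \<Longrightarrow> y \<in> carrier E \<Longrightarrow> f (x \<oplus>\<^bsub>E\<^esub> y) = f x \<oplus>\<^bsub>Y\<^esub> f y"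
    and "\<And>a x. x \<in> carrier E \<Longrightarrow> f (a \<odot>\<^bsub>E\<^esub> x) = a \<odot>\<^bsub>Y\<^esub> f x"
  shows "klin E Y f"
  using assms by (auto simp: klin_def additive_def)

lemma klin_compose: "klin E Y f \<Longrightarrow> klin Y Z g \<Longrightarrow> klin E Z (\<lambda>x. g (f x))"
  unfolding klin_def additive_def by (auto simp: Pi_iff)

lemma (in abelian_group) add_add_commute:
  assumes "a \<in> carrier G" "b \<in> carrier G" "c \<in> carrier G" "d \<in> carrier G"
  shows "(a \<oplus> b) \<oplus> (c \<oplus> d) = (a \<oplus> c) \<oplus> (b \<oplus> d)"
  using assms by (simp add: a_ac)

lemma klin_smult_map:
  assumes Y: "kspace Y" and f: "klin E Y f" shows "klin E Y (\<lambda>x. a \<odot>\<^bsub>Y\<^esub> f x)"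
proof -
  interpret Y: kspace Y by fact
  show ?thesis
    using f by (auto intro!: klinI simp: klin_add klin_smult klin_closed Y.smult_closed Y.smult_r_distr
        Y.smult_assoc[symmetric] mult.commute)
qed

lemma klin_add_map:
  assumes Y: "kspace Y" and f: "klin E Y f" and g: "klin E Y g" shows "klin E Y (\<lambda>x. f x \<oplus>\<^bsub>Y\<^esub> g x)"
proof -
  interpret Y: kspace Y by fact
  show ?thesis
    using f g by (auto intro!: klinI simp: klin_add klin_smult klin_closed Y.smult_r_distr Y.add_add_commute)
qed

lemma klin_finsum_map:
  assumes Y: "kspace Y" and f: "\<And>i. i \<in> A \<Longrightarrow> klin E Y (f i)"
  shows "klin E Y (\<lambda>x. \<Oplus>\<^bsub>Y\<^esub>i\<in>A. f i x)"
proof -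
  interpret Y: kspace Y by fact
  show ?thesis
  proof (rule klinI)
    fix x y assume x: "x \<in> carrier E" and y: "y \<in> carrier E"
    have "(\<Oplus>\<^bsub>Y\<^esub>i\<in>A. f i (x \<oplus>\<^bsub>E\<^esub> y)) = (\<Oplus>\<^bsub>Y\<^esub>i\<in>A. f i x \<oplus>\<^bsub>Y\<^esub> f i y)"
      using f x y by (intro Y.finsum_cong') (auto intro: klin_add klin_closed)
    then show "(\<Oplus>\<^bsub>Y\<^esub>i\<in>A. f i (x \<oplus>\<^bsub>E\<^esub> y)) = (\<Oplus>\<^bsub>Y\<^esub>i\<in>A. f i x) \<oplus>\<^bsub>Y\<^esub> (\<Oplus>\<^bsub>Y\<^esub>i\<in>A. f i y)"
      using f x y by (subst Y.finsum_addf[symmetric]) (auto intro: klin_closed)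
  next
    fix a x assume x: "x \<in> carrier E"
    have "(\<Oplus>\<^bsub>Y\<^esub>i\<in>A. f i (a \<odot>\<^bsub>E\<^esub> x)) = (\<Oplus>\<^bsub>Y\<^esub>i\<in>A. a \<odot>\<^bsub>Y\<^esub> f i x)"
      using f x by (intro Y.finsum_cong') (auto intro: klin_smult klin_closed Y.smult_closed)
    then show "(\<Oplus>\<^bsub>Y\<^esub>i\<in>A. f i (a \<odot>\<^bsub>E\<^esub> x)) = a \<odot>\<^bsub>Y\<^esub> (\<Oplus>\<^bsub>Y\<^esub>i\<in>A. f i x)"
      using f x by (subst Y.smult_finsum) (auto intro: klin_closed)
  qed (use f in \<open>auto intro!: Y.finsum_closed intro: klin_closed\<close>)
qed

definition kbil :: "('k::field, 'x, 'z) module_scheme \<Rightarrow> ('k, 'y, 'w) module_scheme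
    \<Rightarrow> ('k, 'h, 'v) module_scheme \<Rightarrow> ('x \<Rightarrow> 'y \<Rightarrow> 'h) \<Rightarrow> bool" where
  "kbil E Y H b \<longleftrightarrow> (\<forall>x\<in>carrier E. klin Y H (b x)) \<and> (\<forall>y\<in>carrier Y. klin E H (\<lambda>x. b x y))"

lemma kbil_right: "kbil E Y H b \<Longrightarrow> x \<in> carrier E \<Longrightarrow> klin Y H (b x)"
  and kbil_left: "kbil E Y H b \<Longrightarrow> y \<in> carrier Y \<Longrightarrow> klin E H (\<lambda>x. b x y)"
  and kbil_closed: "kbil E Y H b \<Longrightarrow> x \<in> carrier E \<Longrightarrow> y \<in> carrier Y \<Longrightarrow> b x y \<in> carrier H"
  by (auto simp: kbil_def klin_def additive_def)

lemma kbilI: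
  "(\<And>x. x \<in> carrier E \<Longrightarrow> klin Y H (b x)) \<Longrightarrow> (\<And>y. y \<in> carrier Y \<Longrightarrow> klin E H (\<lambda>x. b x y)) \<Longrightarrow> kbil E Y H b"
  by (auto simp: kbil_def)

subsection \<open>Coordinates on the tensor algebra\<close>

text \<open>Otherwise the simplifier turns \<open>{1..n}\<close> into \<open>{Suc 0..n}\<close>.\<close>

declare One_nat_def [simp del]

lemma (in ring_1) ring_ring_of_type_algebra: "ring (ring_of_type_algebra :: 'a ring)"
proof -
  have "\<exists>y. x + y = 0" for x :: 'a
    using add.right_inverse by blast
  then show ?thesis
    unfolding ring_of_type_algebra_def using add.right_inverse
    by unfold_locales (auto simp: algebra_simps Units_def)
qed

lemma (in ring_1) ring_of_type_algebra_simps [simp]: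
  "carrier (ring_of_type_algebra :: 'a ring) = UNIV"
  "a \<otimes>\<^bsub>ring_of_type_algebra\<^esub> b = a * b"
  "a \<oplus>\<^bsub>ring_of_type_algebra\<^esub> b = a + b"
  "\<one>\<^bsub>ring_of_type_algebra\<^esub> = 1"
  "\<zero>\<^bsub>ring_of_type_algebra\<^esub> = 0"
  by (auto simp: ring_of_type_algebra_def)

lemma (in ring_1) ring_of_type_algebra_minus [simp]:
  "\<ominus>\<^bsub>ring_of_type_algebra\<^esub> a = - a" "a \<ominus>\<^bsub>ring_of_type_algebra\<^esub> b = a - b"
proof -
  interpret R: ring "ring_of_type_algebra :: 'a ring" by (rule ring_ring_of_type_algebra)
  show *: "\<ominus>\<^bsub>ring_of_type_algebra\<^esub> a = - a" for a
    using R.minus_equality[of "- a" a] by simp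
  show "a \<ominus>\<^bsub>ring_of_type_algebra\<^esub> b = a - b"
    by (simp add: a_minus_def *)
qed

abbreviation "single \<equiv> Poly_Mapping.single"
abbreviation "keys \<equiv> Poly_Mapping.keys"
abbreviation "lookup \<equiv> Poly_Mapping.lookup"

lemma poly_mapping_sum_single:
  "f = (\<Sum>k\<in>keys f. single k (lookup f k))"
  by (rule poly_mapping_eqI)
    (auto simp: lookup_sum lookup_single when_def in_keys_iff sum.delta)

lemma plus_list_append [simp]: "(l :: 'a list) + m = l @ m"
  by (simp add: plus_list_def)

locale koszul = vector_space s
  for s :: "'k::field \<Rightarrow> 'v::ab_group_add \<Rightarrow> 'v" +
  fixes n :: nat and x :: "nat \<Rightarrow> 'v"
  assumes inj: "inj_on x {1..n}"
    and indep: "independent (x ` {1..n})"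
    and span: "span (x ` {1..n}) = UNIV"
begin

abbreviation "T \<equiv> tensor_algebra s"

text \<open>Zero outside \<open>{1..n}\<close>, so that a word with any other letter automatically
  has coefficient zero.\<close>

definition coord :: "nat \<Rightarrow> 'v \<Rightarrow> 'k" where
  "coord i v = (if i \<in> {1..n} then representation (x ` {1..n}) v (x i) else 0)"

lemma coord_add: "coord i (u + v) = coord i u + coord i v"
  and coord_scale: "coord i (s a v) = a * coord i v"
  by (simp_all add: coord_def span representation_add[OF indep] representation_scale[OF indep])

lemma coord_basis:
  assumes "j \<in> {1..n}"
  shows "coord i (x j) = of_bool (i = j)"
proof -
  have "representation (x ` {1..n}) (x j) = (\<lambda>v. if v = x j then 1 else 0)"
    by (rule representation_basis[OF indep]) (use assms in blast)
  moreover have "x i = x j \<longleftrightarrow> i = j" if "i \<in> {1..n}"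
    using inj_on_eq_iff[OF inj that assms] .
  moreover have "i \<noteq> j" if "i \<notin> {1..n}" using that assms by blast
  ultimately show ?thesis
    by (cases "i \<in> {1..n}") (simp_all add: coord_def del: atLeastAtMost_iff)
qed

lemma coord_expansion: "v = (\<Sum>i\<in>{1..n}. s (coord i v) (x i))"
proof -
  have "v \<in> span (x ` {1..n})" by (simp only: span UNIV_I)
  then have "(\<Sum>b\<in>x ` {1..n}. s (representation (x ` {1..n}) v b) b) = v"
    by (intro sum_representation_eq[OF indep]) simp_all
  then have "v = (\<Sum>i\<in>{1..n}. s (representation (x ` {1..n}) v (x i)) (x i))"
    by (simp only: sum.reindex[OF inj] o_def)
  also have "\<dots> = (\<Sum>i\<in>{1..n}. s (coord i v) (x i))"
    by (intro sum.cong refl) (simp add: coord_def)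
  finally show ?thesis .
qed

text \<open>The coefficient of the basis word indexed by \<open>K\<close> in the tensor product of
  the vectors in \<open>l\<close>; it is defined on the free monoid, before the linearity relations
  are imposed.\<close>

primrec wcoef :: "'v list \<Rightarrow> nat list \<Rightarrow> 'k" where
  "wcoef [] K = of_bool (K = [])"
| "wcoef (v # l) K = (case K of [] \<Rightarrow> 0 | k # K' \<Rightarrow> coord k v * wcoef l K')"

definition words :: "nat \<Rightarrow> nat list set" where
  "words p = {K. length K = p \<and> set K \<subseteq> {1..n}}"

lemma finite_words: "finite (words p)"
  using finite_lists_length_eq[of "{1..n}" p] by (auto simp: words_def conj_commute)

lemma words_Suc: "words (Suc p) = (\<lambda>(i, K). i # K) ` ({1..n} \<times> words p)"
  by (auto simp: words_def length_Suc_conv image_iff)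

lemma wcoef_eq_0: "K \<notin> words (length l) \<Longrightarrow> wcoef l K = 0"
proof (induction l arbitrary: K)
  case (Cons v l)
  show ?case
  proof (cases K)
    case (Cons k K')
    then have "k \<notin> {1..n} \<or> K' \<notin> words (length l)" using Cons.prems by (auto simp: words_def)
    then show ?thesis using Cons Cons.IH[of K'] by (auto simp: coord_def)
  qed simp
qed (auto simp: words_def)

lemma wcoef_append:
  "wcoef (l @ m) K = wcoef l (take (length l) K) * wcoef m (drop (length l) K)"
  by (induction l arbitrary: K) (auto split: list.splits)

lemma wcoef_basis: "set J \<subseteq> {1..n} \<Longrightarrow> wcoef (map x J) K = of_bool (J = K)"
  by (induction J arbitrary: K) (auto simp: coord_basis split: list.splits)

definition pcf :: "nat list \<Rightarrow> ('v list \<Rightarrow>\<^sub>0 'k) \<Rightarrow> 'k" where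
  "pcf K f = (\<Sum>l\<in>keys f. lookup f l * wcoef l K)"

lemma pcf_superset:
  assumes "finite A" "keys f \<subseteq> A"
  shows "pcf K f = (\<Sum>l\<in>A. lookup f l * wcoef l K)"
  unfolding pcf_def using assms by (intro sum.mono_neutral_left) (auto simp: in_keys_iff)

lemma pcf_add: "pcf K (f + g) = pcf K f + pcf K g"
proof -
  let ?A = "keys f \<union> keys g"
  have "finite ?A" by simp
  then show ?thesis
    using keys_add[of f g]
    by (simp add: pcf_superset[of ?A] lookup_add algebra_simps sum.distrib)
qed

lemma pcf_zero: "pcf K 0 = 0"
  by (simp add: pcf_def)

lemma pcf_uminus: "pcf K (- f) = - pcf K f"
  using pcf_add[of K f "- f"] minus_unique[of "pcf K f" "pcf K (- f)"] by (simp add: pcf_zero)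

lemma pcf_minus: "pcf K (f - g) = pcf K f - pcf K g"
  using pcf_add[of K f "- g"] by (simp add: pcf_uminus)

lemma pcf_sum: "pcf K (\<Sum>i\<in>A. f i) = (\<Sum>i\<in>A. pcf K (f i))"
  by (induction A rule: infinite_finite_induct) (auto simp: pcf_zero pcf_add)

lemma pcf_single: "pcf K (single l a) = a * wcoef l K"
  by (cases "a = 0") (auto simp: pcf_def)

text \<open>Only the cut at \<open>length l\<close> contributes. Summing over all cuts removes
  \<open>length l\<close> from the formula, so that it extends bilinearly to
  \<open>pcf_mult\<close>.\<close>

lemma wcoef_append_sum:
  "wcoef (l @ m) K = (\<Sum>i\<le>length K. wcoef l (take i K) * wcoef m (drop i K))"
proof -
  have z: "wcoef l (take i K) = 0" if "i \<le> length K" "i \<noteq> length l" for i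
    using that by (intro wcoef_eq_0) (auto simp: words_def)
  show ?thesis
  proof (cases "length l \<le> length K")
    case True
    have "(\<Sum>i\<le>length K. wcoef l (take i K) * wcoef m (drop i K))
        = (\<Sum>i\<in>{length l}. wcoef l (take i K) * wcoef m (drop i K))"
      using True z by (intro sum.mono_neutral_right) auto
    then show ?thesis by (simp add: wcoef_append)
  next
    case False
    then have "wcoef l K = 0" by (intro wcoef_eq_0) (auto simp: words_def)
    moreover have "(\<Sum>i\<le>length K. wcoef l (take i K) * wcoef m (drop i K)) = 0"
      using False z by (intro sum.neutral) auto
    ultimately show ?thesis using False by (simp add: wcoef_append)
  qed
qed

lemma pcf_mult:
  "pcf K (f * g) = (\<Sum>i\<le>length K. pcf (take i K) f * pcf (drop i K) g)"
proof -
  let ?f = "lookup f" and ?g = "lookup g"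
  let ?F = "keys f" and ?G = "keys g"
  have "f * g = (\<Sum>l\<in>?F. \<Sum>m\<in>?G. single (l @ m) (?f l * ?g m))"
    by (subst poly_mapping_sum_single[of f], subst poly_mapping_sum_single[of g])
      (simp add: sum_product mult_single)
  then have "pcf K (f * g) = (\<Sum>l\<in>?F. \<Sum>m\<in>?G. ?f l * ?g m * wcoef (l @ m) K)"
    by (simp only: pcf_sum pcf_single)
  also have "\<dots> = (\<Sum>l\<in>?F. \<Sum>m\<in>?G. \<Sum>i\<le>length K.
      (?f l * wcoef l (take i K)) * (?g m * wcoef m (drop i K)))"
    by (simp add: wcoef_append_sum sum_distrib_left mult_ac)
  also have "\<dots> = (\<Sum>l\<in>?F. \<Sum>i\<le>length K. \<Sum>m\<in>?G.
      (?f l * wcoef l (take i K)) * (?g m * wcoef m (drop i K)))"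
    by (intro sum.cong refl sum.swap)
  also have "\<dots> = (\<Sum>i\<le>length K. \<Sum>l\<in>?F. \<Sum>m\<in>?G.
      (?f l * wcoef l (take i K)) * (?g m * wcoef m (drop i K)))"
    by (rule sum.swap)
  also have "\<dots> = (\<Sum>i\<le>length K. pcf (take i K) f * pcf (drop i K) g)"
    by (simp add: pcf_def sum_product)
  finally show ?thesis .
qed

sublocale R: ring "ring_of_type_algebra :: ('v list \<Rightarrow>\<^sub>0 'k) ring"
  by (rule ring_ring_of_type_algebra)

lemma ideal_linearity: "ideal (linearity_ideal s) ring_of_type_algebra"
  unfolding linearity_ideal_def by (rule R.genideal_ideal) simp

sublocale L: ideal "linearity_ideal s" "ring_of_type_algebra :: ('v list \<Rightarrow>\<^sub>0 'k) ring"
  by (rule ideal_linearity)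

text \<open>By \<open>pcf_mult\<close> the common kernel of the coefficients at all words is a
  two-sided ideal, although the kernel at a single word need not be. It therefore suffices to check
  the generating relations.\<close>

lemma pcf_linearity_ideal:
  assumes "f \<in> linearity_ideal s"
  shows "pcf K f = 0"
proof -
  have "ideal {f. \<forall>K. pcf K f = 0} (ring_of_type_algebra :: ('v list \<Rightarrow>\<^sub>0 'k) ring)"
  proof (rule idealI[OF R.ring_axioms])
    show "subgroup {f. \<forall>K. pcf K f = 0} (add_monoid (ring_of_type_algebra :: ('v list \<Rightarrow>\<^sub>0 'k) ring))"
      by (rule R.add.subgroupI) (auto simp: pcf_add pcf_uminus a_inv_def[symmetric] intro: exI[of _ 0] pcf_zero)
  qed (auto simp: pcf_mult)
  moreover have "linearity_relations s \<subseteq> {f. \<forall>K. pcf K f = 0}"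
    by (auto simp: linearity_relations_def pcf_minus pcf_single coord_add coord_scale distrib_right
        split: list.splits)
  ultimately have "linearity_ideal s \<subseteq> {f. \<forall>K. pcf K f = 0}"
    unfolding linearity_ideal_def by (rule R.genideal_minimal)
  then show ?thesis using assms by auto
qed

sublocale T: ring T
  unfolding tensor_algebra_def by (rule L.quotient_is_ring)

lemma carrier_T: "carrier T = range (tclass s)"
  by (simp add: tensor_algebra_def tclass_def FactRing_def A_RCOSETS_def' del: UN_singleton) blast

lemma tclass_in [simp]: "tclass s f \<in> carrier T"
  by (auto simp: carrier_T)

lemma tclass_add: "tclass s (f + g) = tclass s f \<oplus>\<^bsub>T\<^esub> tclass s g"
  using L.a_rcos_sum[of f g] by (simp add: tensor_algebra_def tclass_def FactRing_simps)

lemma tclass_zero: "tclass s 0 = \<zero>\<^bsub>T\<^esub>"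
  using tclass_add[of 0 0] T.add.r_cancel_one'[of "tclass s 0" "tclass s 0"] by simp

lemma tclass_mult: "tclass s (f * g) = tclass s f \<otimes>\<^bsub>T\<^esub> tclass s g"
  using L.rcoset_mult_add[of f g] by (simp add: tensor_algebra_def tclass_def FactRing_simps)

lemma tclass_eqI: "f - g \<in> linearity_ideal s \<Longrightarrow> tclass s f = tclass s g"
  unfolding tclass_def
  using R.quotient_eq_iff_same_a_r_cos[OF ideal_linearity, of f g] by (simp)

lemma tclass_sum_cong:
  "(\<And>i. i \<in> A \<Longrightarrow> tclass s (f i) = tclass s (g i)) \<Longrightarrow> tclass s (\<Sum>i\<in>A. f i) = tclass s (\<Sum>i\<in>A. g i)"
  by (induction A rule: infinite_finite_induct) (auto simp: tclass_add)

text \<open>The coefficient of a basis word; a tensor is a coset, of which any representative will do.\<close>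

definition cf :: "nat list \<Rightarrow> ('v, 'k) tens \<Rightarrow> 'k" where
  "cf K t = pcf K (SOME f. f \<in> t)"

lemma cf_tclass: "cf K (tclass s f) = pcf K f"
proof -
  have "f \<in> tclass s f"
    unfolding tclass_def using L.a_rcos_self[of f] by simp
  then have "(SOME f'. f' \<in> tclass s f) \<in> tclass s f" by (rule someI)
  then obtain h where h: "h \<in> linearity_ideal s" "(SOME f'. f' \<in> tclass s f) = h + f"
    by (auto simp: tclass_def a_r_coset_def r_coset_def)
  then show ?thesis by (simp add: cf_def pcf_add pcf_linearity_ideal)
qed

lemma cf_add: "t \<in> carrier T \<Longrightarrow> u \<in> carrier T \<Longrightarrow> cf K (t \<oplus>\<^bsub>T\<^esub> u) = cf K t + cf K u"
  by (auto simp: carrier_T tclass_add[symmetric] cf_tclass pcf_add)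

lemma cf_mult: "t \<in> carrier T \<Longrightarrow> u \<in> carrier T
    \<Longrightarrow> cf K (t \<otimes>\<^bsub>T\<^esub> u) = (\<Sum>i\<le>length K. cf (take i K) t * cf (drop i K) u)"
  by (auto simp: carrier_T tclass_mult[symmetric] cf_tclass pcf_mult)

lemma cf_zero: "cf K \<zero>\<^bsub>T\<^esub> = 0"
proof -
  have "cf K \<zero>\<^bsub>T\<^esub> = cf K \<zero>\<^bsub>T\<^esub> + cf K \<zero>\<^bsub>T\<^esub>"
    using cf_add[of "\<zero>\<^bsub>T\<^esub>" "\<zero>\<^bsub>T\<^esub>" K] by (simp only: T.zero_closed T.l_zero)
  then show ?thesis by (simp only: add_cancel_right_right)
qed

lemma cf_neg: "t \<in> carrier T \<Longrightarrow> cf K (\<ominus>\<^bsub>T\<^esub> t) = - cf K t"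
  using cf_add[of t "\<ominus>\<^bsub>T\<^esub> t" K] minus_unique[of "cf K t" "cf K (\<ominus>\<^bsub>T\<^esub> t)"]
  by (simp add: cf_zero T.r_neg)

lemma cf_minus: "t \<in> carrier T \<Longrightarrow> u \<in> carrier T \<Longrightarrow> cf K (t \<ominus>\<^bsub>T\<^esub> u) = cf K t - cf K u"
  by (simp add: a_minus_def cf_add cf_neg)

lemma cf_finsum:
  "(\<And>i. i \<in> A \<Longrightarrow> t i \<in> carrier T) \<Longrightarrow> cf K (\<Oplus>\<^bsub>T\<^esub>i\<in>A. t i) = (\<Sum>i\<in>A. cf K (t i))"
  by (induction A rule: infinite_finite_induct)
    (auto simp: cf_zero cf_add T.finsum_insert Pi_iff)

lemma cf_mult_homogeneous:
  assumes t: "t \<in> carrier T" and u: "u \<in> carrier T" and hom: "\<And>J. length J \<noteq> p \<Longrightarrow> cf J t = 0"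
  shows "cf K (t \<otimes>\<^bsub>T\<^esub> u) = cf (take p K) t * cf (drop p K) u"
proof (cases "p \<le> length K")
  case True
  have "cf K (t \<otimes>\<^bsub>T\<^esub> u) = (\<Sum>i\<in>{p}. cf (take i K) t * cf (drop i K) u)"
    unfolding cf_mult[OF t u] using True hom by (intro sum.mono_neutral_right) auto
  then show ?thesis by simp
next
  case False
  then have "cf K (t \<otimes>\<^bsub>T\<^esub> u) = 0"
    unfolding cf_mult[OF t u] using hom by (intro sum.neutral) auto
  then show ?thesis using False hom by simp
qed

lemma tscalar_in [simp]: "tscalar s a \<in> carrier T"
  and tvec_in [simp]: "tvec s v \<in> carrier T"
  by (auto simp: tscalar_def tvec_def)

lemma cf_tscalar: "cf K (tscalar s a) = (if K = [] then a else 0)"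
  by (simp add: tscalar_def cf_tclass pcf_single)

lemma cf_tvec: "cf K (tvec s v) = (case K of [k] \<Rightarrow> coord k v | _ \<Rightarrow> 0)"
  by (auto simp: tvec_def cf_tclass pcf_single split: list.splits)

lemma cf_smult: "t \<in> carrier T \<Longrightarrow> cf K (tscalar s a \<otimes>\<^bsub>T\<^esub> t) = a * cf K t"
  by (subst cf_mult_homogeneous[of _ _ 0]) (auto simp: cf_tscalar)

lemma tclass_vec_expansion:
  "tclass s (single [v] 1) = tclass s (\<Sum>i\<in>{1..n}. single [x i] (coord i v))"
proof -
  have rel: "f - g \<in> linearity_relations s \<Longrightarrow> tclass s f = tclass s g" for f g
    using R.genideal_self[of "linearity_relations s"]
    by (intro tclass_eqI) (auto simp: linearity_ideal_def)
  have add: "tclass s (single [u + w] 1)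
      = tclass s (single [u] 1 + single [w] 1)" for u w
    by (intro rel) (auto simp: linearity_relations_def diff_diff_eq)
  have scale: "tclass s (single [s a w] 1) = tclass s (single [w] a)" for a w
    by (intro rel) (auto simp: linearity_relations_def)
  have zero: "tclass s (single [0] 1) = tclass s 0"
    using scale[of 0 0] by simp
  have "tclass s (single [\<Sum>i\<in>A. f i] 1) = tclass s (\<Sum>i\<in>A. single [f i] 1)"
    for A and f :: "nat \<Rightarrow> 'v"
    by (induction A rule: infinite_finite_induct) (auto simp: zero add tclass_add)
  note sum = this
  have "tclass s (single [v] 1)
      = tclass s (single [\<Sum>i\<in>{1..n}. s (coord i v) (x i)] 1)"
    by (simp only: coord_expansion[of v, symmetric])
  also have "\<dots> = tclass s (\<Sum>i\<in>{1..n}. single [s (coord i v) (x i)] 1)"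
    by (rule sum)
  also have "\<dots> = tclass s (\<Sum>i\<in>{1..n}. single [x i] (coord i v))"
    by (intro tclass_sum_cong scale)
  finally show ?thesis .
qed

lemma tclass_single_expansion:
  "tclass s (single l a)
    = tclass s (\<Sum>K\<in>words (length l). single (map x K) (a * wcoef l K))"
proof (induction l)
  case Nil
  have "words 0 = {[]}" by (auto simp: words_def)
  then show ?case by simp
next
  case (Cons v l)
  have "tclass s (single (v # l) a)
      = tclass s (single [v] 1) \<otimes>\<^bsub>T\<^esub> tclass s (single l a)"
    by (simp add: tclass_mult[symmetric] mult_single)
  also have "\<dots> = tclass s ((\<Sum>i\<in>{1..n}. single [x i] (coord i v))
      * (\<Sum>K\<in>words (length l). single (map x K) (a * wcoef l K)))"
    by (simp only: tclass_mult tclass_vec_expansion Cons.IH)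
  also have "(\<Sum>i\<in>{1..n}. single [x i] (coord i v))
      * (\<Sum>K\<in>words (length l). single (map x K) (a * wcoef l K))
    = (\<Sum>(i, K)\<in>{1..n} \<times> words (length l). single (map x (i # K)) (a * wcoef (v # l) (i # K)))"
    by (simp add: sum_product mult_single mult_ac sum.cartesian_product)
  also have "\<dots> = (\<Sum>K\<in>words (length (v # l)). single (map x K) (a * wcoef (v # l) K))"
    unfolding length_Cons words_Suc by (subst sum.reindex) (auto simp: inj_on_def split_def)
  finally show ?case .
qed

text \<open>The words of the finitely many lengths occurring in \<open>f\<close> suffice, since
  \<open>wcoef l\<close> vanishes at words of any other length than that of
  \<open>l\<close>.\<close>

lemma tclass_expansion:
  obtains A where "finite A"
    and "tclass s f = tclass s (\<Sum>K\<in>A. single (map x K) (pcf K f))"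
proof -
  let ?k = "keys f"
  define A where "A = (\<Union>l\<in>?k. words (length l))"
  have fin: "finite A" by (auto simp: A_def finite_words)
  have "tclass s f = tclass s (\<Sum>l\<in>?k. single l (lookup f l))"
    using poly_mapping_sum_single by metis
  also have "\<dots> = tclass s (\<Sum>l\<in>?k. \<Sum>K\<in>words (length l).
      single (map x K) (lookup f l * wcoef l K))"
    by (intro tclass_sum_cong tclass_single_expansion)
  also have "(\<Sum>l\<in>?k. \<Sum>K\<in>words (length l).
      single (map x K) (lookup f l * wcoef l K))
    = (\<Sum>l\<in>?k. \<Sum>K\<in>A. single (map x K) (lookup f l * wcoef l K))"
    using fin by (intro sum.cong refl sum.mono_neutral_left) (auto simp: A_def wcoef_eq_0)
  also have "\<dots> = (\<Sum>K\<in>A. single (map x K) (pcf K f))"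
  proof (subst sum.swap, intro sum.cong refl)
    fix K
    have "(\<Sum>l\<in>B. single (map x K) (g l)) = single (map x K) (\<Sum>l\<in>B. g l)"
      for B and g :: "'v list \<Rightarrow> 'k"
      by (induction B rule: infinite_finite_induct) (auto simp: single_add)
    then show "(\<Sum>l\<in>?k. single (map x K) (lookup f l * wcoef l K))
        = single (map x K) (pcf K f)"
      by (simp add: pcf_def)
  qed
  finally show ?thesis using that fin by blast
qed

text \<open>The basis words span, by \<open>tclass_expansion\<close>, so a difference with zero
  coefficients has zero class. Equalities in the tensor algebra are proved below by comparing
  coefficients.\<close>

lemma cf_ext:
  assumes "t \<in> carrier T" "u \<in> carrier T" "\<And>K. cf K t = cf K u"
  shows "t = u"
proof -
  obtain f where f: "t \<ominus>\<^bsub>T\<^esub> u = tclass s f"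
    using assms T.minus_closed[of t u] by (auto simp: carrier_T)
  obtain A where "tclass s f = tclass s (\<Sum>K\<in>A. single (map x K) (pcf K f))"
    using tclass_expansion by blast
  moreover have "pcf K f = 0" for K
    using cf_minus[of t u K] assms by (simp add: f cf_tclass)
  ultimately have "t \<ominus>\<^bsub>T\<^esub> u = tclass s 0" by (simp add: f)
  also have "\<dots> = \<zero>\<^bsub>T\<^esub>"
    by (rule tclass_zero)
  finally show ?thesis using assms by (simp add: T.r_right_minus_eq)
qed

text \<open>The inverse, in degree \<open>p\<close>, of taking coefficients; see
  \<open>cf_telt\<close>.\<close>

definition telt :: "nat \<Rightarrow> (nat list \<Rightarrow> 'k) \<Rightarrow> ('v, 'k) tens" where
  "telt p F = tclass s (\<Sum>K\<in>words p. single (map x K) (F K))"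

lemma telt_in [simp]: "telt p F \<in> carrier T"
  by (simp add: telt_def)

lemma cf_telt: "cf J (telt p F) = (if J \<in> words p then F J else 0)"
proof -
  have "cf J (telt p F) = (\<Sum>K\<in>words p. F K * of_bool (K = J))"
    unfolding telt_def cf_tclass pcf_sum pcf_single
    by (intro sum.cong refl) (auto simp: words_def wcoef_basis)
  also have "\<dots> = (\<Sum>K\<in>words p. if K = J then F K else 0)"
    by (intro sum.cong) auto
  finally show ?thesis using finite_words by (simp add: sum.delta')
qed

text \<open>Scalars act through \<open>tscalar\<close>. Subspaces are obtained by replacing the
  carrier, as in \<open>Wm\<close> and \<open>Um\<close>.\<close>

definition tmod :: "('k, ('v, 'k) tens) module" where
  "tmod = \<lparr>carrier = carrier T, monoid.mult = monoid.mult T, one = one T, ring.zero = ring.zero T,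
     add = add T, module.smult = (\<lambda>a t. tscalar s a \<otimes>\<^bsub>T\<^esub> t)\<rparr>"

abbreviation smul :: "'k \<Rightarrow> ('v, 'k) tens \<Rightarrow> ('v, 'k) tens" (infixr \<open>\<cdot>\<close> 72) where
  "a \<cdot> t \<equiv> tscalar s a \<otimes>\<^bsub>T\<^esub> t"

lemma smul_one: "t \<in> carrier T \<Longrightarrow> 1 \<cdot> t = t"
  and smul_neg_one: "t \<in> carrier T \<Longrightarrow> (- 1) \<cdot> t = \<ominus>\<^bsub>T\<^esub> t"
  and smul_add: "t \<in> carrier T \<Longrightarrow> (a + b) \<cdot> t = a \<cdot> t \<oplus>\<^bsub>T\<^esub> b \<cdot> t"
  and smul_smul: "t \<in> carrier T \<Longrightarrow> (a * b) \<cdot> t = a \<cdot> b \<cdot> t"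
  by (rule cf_ext; simp add: cf_smult cf_neg cf_zero cf_add algebra_simps)+

end

subsection \<open>Alternating functions on words\<close>

text \<open>The sign of the permutation that sorts a word, and \<open>0\<close> if a letter is repeated.\<close>

primrec eps :: "nat list \<Rightarrow> int" where
  "eps [] = 1"
| "eps (a # K) = (\<Prod>b\<leftarrow>K. sgn (int b - int a)) * eps K"

lemma eps_swap: "eps (I @ a # b # J) = - eps (I @ b # a # J)"
  by (induction I) (auto simp: sgn_if)

lemma eps_repeat: "eps (I @ a # a # J) = 0"
  by (induction I) auto

lemma eps_increasing: "sorted_wrt (<) K \<Longrightarrow> eps K = 1"
proof (induction K)
  case (Cons a K)
  then have "map (\<lambda>b. sgn (int b - int a)) K = map (\<lambda>b. 1) K" by simp
  then have "(\<Prod>b\<leftarrow>K. sgn (int b - int a)) = 1"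
    by (simp add: map_replicate_const)
  then show ?case using Cons by simp
qed simp

lemma eps_square: "distinct K \<Longrightarrow> eps K * eps K = 1"
proof (induction K)
  case (Cons a K)
  have "(\<Prod>b\<leftarrow>L. sgn (int b - int a)) * (\<Prod>b\<leftarrow>L. sgn (int b - int a)) = 1" if "a \<notin> set L" for L
    using that by (induction L) (auto simp: sgn_if)
  then show ?case using Cons by (simp add: mult_ac)
qed simp

text \<open>By transitivity strict growth need only be tested on adjacent letters. A failure is
  either a repetition or a descent, the two cases that alternation governs.\<close>

lemma not_increasing:
  "\<not> sorted_wrt (<) (K :: nat list) \<Longrightarrow> \<exists>I a b J. K = I @ a # b # J \<and> b \<le> a"
proof (induction K)
  case (Cons a K)
  show ?case
  proof (cases "sorted_wrt (<) K")
    case True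
    then obtain b J where K: "K = b # J" using Cons.prems by (cases K) auto
    have "b \<le> a"
    proof (rule ccontr)
      assume "\<not> b \<le> a"
      then have "sorted_wrt (<) (a # K)" using True K by (auto intro: order.strict_trans)
      then show False using Cons.prems by blast
    qed
    then show ?thesis using K by (metis append_Nil)
  next
    case False
    then obtain I b c J where "K = I @ b # c # J" "c \<le> b" using Cons.IH by blast
    then have "a # K = (a # I) @ b # c # J \<and> c \<le> b" by simp
    then show ?thesis by blast
  qed
qed simp

lemma increasing_mset_unique:
  assumes "mset I = mset K" "sorted_wrt (<) I" "sorted_wrt (<) (K :: nat list)"
  shows "I = K"
  using properties_for_sort[of I K] sorted_sort_id[of K] assms by (simp add: strict_sorted_iff)

text \<open>Alternation at one position only, because each member of the intersection defining
  \<open>W\<^sub>p\<close> imposes the condition at one position; see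
  \<open>relation_space_eq\<close>.\<close>

definition alt_at :: "nat \<Rightarrow> (nat list \<Rightarrow> 'k::field) \<Rightarrow> bool" where
  "alt_at i F \<longleftrightarrow> (\<forall>I a b J. length I = i
     \<longrightarrow> F (I @ a # a # J) = 0 \<and> F (I @ a # b # J) = - F (I @ b # a # J))"

lemma alt_atI:
  assumes "\<And>I a J. length I = i \<Longrightarrow> F (I @ a # a # J) = 0"
    and "\<And>I a b J. length I = i \<Longrightarrow> F (I @ a # b # J) = - F (I @ b # a # J)"
  shows "alt_at i F"
  unfolding alt_at_def using assms by blast

lemma alt_at_repeat: "alt_at i F \<Longrightarrow> length I = i \<Longrightarrow> F (I @ a # a # J) = 0"
  and alt_at_swap: "alt_at i F \<Longrightarrow> length I = i \<Longrightarrow> F (I @ a # b # J) = - F (I @ b # a # J)"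
  unfolding alt_at_def by blast+

lemma alt_at_diff: "alt_at i F \<Longrightarrow> alt_at i G \<Longrightarrow> alt_at i (\<lambda>K. F K - G K)"
proof (rule alt_atI)
  fix I :: "nat list" and a b J
  assume F: "alt_at i F" and G: "alt_at i G" and I: "length I = i"
  show "F (I @ a # a # J) - G (I @ a # a # J) = 0"
    by (simp add: alt_at_repeat[OF F I] alt_at_repeat[OF G I])
  show "F (I @ a # b # J) - G (I @ a # b # J) = - (F (I @ b # a # J) - G (I @ b # a # J))"
    by (simp only: alt_at_swap[OF F I, of a b] alt_at_swap[OF G I, of a b]) simp
qed

lemma alt_at_sum:
  assumes F: "\<And>j. j \<in> A \<Longrightarrow> alt_at i (F j)"
  shows "alt_at i (\<lambda>K. \<Sum>j\<in>A. c j * F j K)"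
proof (rule alt_atI)
  fix I :: "nat list" and a b J
  assume I: "length I = i"
  show "(\<Sum>j\<in>A. c j * F j (I @ a # a # J)) = 0"
    using alt_at_repeat[OF F I] by (intro sum.neutral) auto
  have "c j * F j (I @ a # b # J) = - (c j * F j (I @ b # a # J))" if "j \<in> A" for j
    by (simp only: alt_at_swap[OF F[OF that] I, of a b]) simp
  then show "(\<Sum>j\<in>A. c j * F j (I @ a # b # J)) = - (\<Sum>j\<in>A. c j * F j (I @ b # a # J))"
    by (simp add: sum_negf[symmetric])
qed

context koszul
begin

definition Inc :: "nat \<Rightarrow> nat list set" where
  "Inc p = {K \<in> words p. sorted_wrt (<) K}"

lemma finite_Inc [simp]: "finite (Inc p)"
  using finite_words by (simp add: Inc_def)

definition supp :: "nat \<Rightarrow> (nat list \<Rightarrow> 'k) \<Rightarrow> bool" where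
  "supp p F \<longleftrightarrow> (\<forall>K. K \<notin> words p \<longrightarrow> F K = 0)"

definition alt :: "nat \<Rightarrow> (nat list \<Rightarrow> 'k) \<Rightarrow> bool" where
  "alt p F \<longleftrightarrow> supp p F \<and> (\<forall>i. i + 2 \<le> p \<longrightarrow> alt_at i F)"

text \<open>At such a position the words in question have length at least \<open>i + 2 > p\<close>
  and lie outside the support, so \<open>alt\<close> yields alternation at every position.\<close>

lemma alt_at_beyond:
  assumes F: "supp p F" and i: "\<not> i + 2 \<le> p"
  shows "alt_at i F"
proof -
  have "F (I @ a # b # J) = 0" if "length I = i" for I a b J
    using F i that by (simp add: supp_def words_def)
  then show ?thesis by (intro alt_atI) simp_all
qed

lemma alt_alt_at: "alt p F \<Longrightarrow> alt_at i F"
  by (cases "i + 2 \<le> p") (auto simp: alt_def alt_at_beyond)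

lemma alt_repeat: "alt p F \<Longrightarrow> F (I @ a # a # J) = 0"
  and alt_swap: "alt p F \<Longrightarrow> F (I @ a # b # J) = - F (I @ b # a # J)"
  using alt_at_repeat[OF alt_alt_at refl] alt_at_swap[OF alt_alt_at refl] by blast+

text \<open>Bubble sort: swapping a descending pair of letters makes a word lexicographically smaller.\<close>

lemma alt_eq_0:
  assumes F: "alt p F" and 0: "\<And>I. I \<in> Inc p \<Longrightarrow> F I = 0"
  shows "F K = 0"
proof (induction K rule: wf_induct_rule[OF wf_lex[OF wf_less_than]])
  case (1 K)
  show ?case
  proof (cases "sorted_wrt (<) K")
    case True
    then show ?thesis using F 0[of K] by (auto simp: Inc_def alt_def supp_def)
  next
    case False
    then obtain I a b J where K: "K = I @ a # b # J" "b \<le> a"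
      using not_increasing by blast
    show ?thesis
    proof (cases "a = b")
      case True
      then show ?thesis using alt_repeat[OF F] K by simp
    next
      case False
      then have "(b # a # J, a # b # J) \<in> lex less_than" using K by simp
      then have "(I @ b # a # J, K) \<in> lex less_than"
        unfolding K(1) by (rule lex_append_leftI)
      then show ?thesis using 1 alt_swap[OF F, of I a b J] K(1) by simp
    qed
  qed
qed

text \<open>The basis element of \<open>W\<^sub>p\<close> indexed by an increasing word of length \<open>p\<close>.\<close>

definition wb :: "nat list \<Rightarrow> ('v, 'k) tens" where
  "wb I = telt (length I) (\<lambda>K. if mset K = mset I then of_int (eps K) else 0)"

lemma wb_in [simp]: "wb I \<in> carrier T"
  by (simp add: wb_def)

lemma cf_wb: "I \<in> words p \<Longrightarrow> cf K (wb I) = (if mset K = mset I then of_int (eps K) else 0)"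
  using mset_eq_setD[of K I] mset_eq_length[of K I] by (auto simp: wb_def cf_telt words_def)

text \<open>Evaluation at increasing words is dual to \<open>wb\<close>, since an increasing word is
  determined by its letters.\<close>

lemma cf_wb_Inc: "I \<in> Inc p \<Longrightarrow> K \<in> Inc q \<Longrightarrow> cf K (wb I) = of_bool (K = I)"
  using increasing_mset_unique[of K I] by (auto simp: cf_wb Inc_def eps_increasing)

lemma alt_wb:
  assumes "I \<in> Inc p"
  shows "alt p (\<lambda>K. cf K (wb I))"
proof -
  have I: "I \<in> words p" using assms by (simp add: Inc_def)
  have m: "mset (L @ a # b # J) = mset (L @ b # a # J)" for L :: "nat list" and a b J by simp
  show ?thesis
    unfolding alt_def
  proof (intro conjI allI impI)
    show "supp p (\<lambda>K. cf K (wb I))"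
      unfolding supp_def
    proof (intro allI impI)
      fix K assume "K \<notin> words p"
      moreover have "K \<in> words p" if "mset K = mset I"
        using I mset_eq_length[OF that] mset_eq_setD[OF that] by (simp add: words_def)
      ultimately show "cf K (wb I) = 0" by (auto simp: cf_wb[OF I])
    qed
    show "alt_at i (\<lambda>K. cf K (wb I))" for i
    proof (rule alt_atI)
      show "cf (L @ a # a # J) (wb I) = 0" for L a J
        by (simp add: cf_wb[OF I] eps_repeat)
      show "cf (L @ a # b # J) (wb I) = - cf (L @ b # a # J) (wb I)" for L a b J
        unfolding cf_wb[OF I] m[of L a b J] eps_swap[of L a b J] by simp
    qed
  qed
qed

lemma altI:
  assumes "\<And>K. K \<notin> words p \<Longrightarrow> F K = 0" and "\<And>I a J. F (I @ a # a # J) = 0"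
    and "\<And>I a b J. F (I @ a # b # J) = - F (I @ b # a # J)"
  shows "alt p F"
proof -
  have "alt_at i F" for i
    by (rule alt_atI, rule assms(2), rule assms(3))
  with assms(1) show ?thesis by (simp add: alt_def supp_def)
qed

lemma alt_supp: "alt p F \<Longrightarrow> K \<notin> words p \<Longrightarrow> F K = 0"
  by (auto simp: alt_def supp_def)

lemma alt_sum:
  assumes F: "\<And>j. j \<in> A \<Longrightarrow> alt p (F j)"
  shows "alt p (\<lambda>K. \<Sum>j\<in>A. c j * F j K)"
proof -
  have "alt_at i (\<lambda>K. \<Sum>j\<in>A. c j * F j K)" for i
    by (rule alt_at_sum) (rule alt_alt_at[OF F])
  moreover have "(\<Sum>j\<in>A. c j * F j K) = 0" if "K \<notin> words p" for K
    using alt_supp[OF F that] by (intro sum.neutral) simp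
  ultimately show ?thesis by (simp add: alt_def supp_def)
qed

lemma alt_diff:
  assumes F: "alt p F" and G: "alt p G"
  shows "alt p (\<lambda>K. F K - G K)"
  using alt_at_diff[OF alt_alt_at[OF F] alt_alt_at[OF G]] alt_supp[OF F] alt_supp[OF G]
  by (simp add: alt_def supp_def)

text \<open>The difference of the two sides is alternating and vanishes at increasing words, so
  \<open>alt_eq_0\<close> applies.\<close>

lemma alt_expansion:
  assumes F: "alt p F"
  shows "F K = (\<Sum>I\<in>Inc p. F I * cf K (wb I))"
proof -
  let ?D = "\<lambda>K. F K - (\<Sum>I\<in>Inc p. F I * cf K (wb I))"
  have "alt p ?D" by (intro alt_diff F alt_sum alt_wb)
  moreover have "?D K = 0" if "K \<in> Inc p" for K
  proof -
    have "(\<Sum>I\<in>Inc p. F I * cf K (wb I)) = (\<Sum>I\<in>Inc p. if K = I then F I else 0)"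
      by (intro sum.cong refl) (simp add: cf_wb_Inc[OF _ that])
    also have "\<dots> = F K" using that by (simp add: sum.delta)
    finally show ?thesis by simp
  qed
  ultimately have "?D K = 0" by (rule alt_eq_0)
  then show ?thesis by simp
qed

lemma alt_left:
  assumes F: "alt (p + q) F" and "length K2 = q"
  shows "alt p (\<lambda>K1. F (K1 @ K2))"
proof (rule altI)
  show "F (K @ K2) = 0" if "K \<notin> words p" for K
    using that assms by (intro alt_supp[OF F]) (auto simp: words_def)
  show "F ((I @ a # a # J) @ K2) = 0" for I a J
    using alt_repeat[OF F, of I a "J @ K2"] by simp
  show "F ((I @ a # b # J) @ K2) = - F ((I @ b # a # J) @ K2)" for I a b J
    using alt_swap[OF F, of I a b "J @ K2"] by simp
qed

lemma alt_right:
  assumes F: "alt (p + q) F" and "length K1 = p"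
  shows "alt q (\<lambda>K2. F (K1 @ K2))"
proof (rule altI)
  show "F (K1 @ K) = 0" if "K \<notin> words q" for K
    using that assms by (intro alt_supp[OF F]) (auto simp: words_def)
  show "F (K1 @ I @ a # a # J) = 0" for I a J
    using alt_repeat[OF F, of "K1 @ I" a J] by simp
  show "F (K1 @ I @ a # b # J) = - F (K1 @ I @ b # a # J)" for I a b J
    using alt_swap[OF F, of "K1 @ I" a b J] by simp
qed

text \<open>With the end of the word fixed, the function of its beginning is again alternating. This
  expansion and its mirror image below yield both the decomposition of
  \<open>W\<^sub>p\<^sub>+\<^sub>q\<close> and its coassociativity.\<close>

lemma alt_expansion_left:
  assumes "alt (p + q) F" "length K2 = q"
  shows "F (K1 @ K2) = (\<Sum>I\<in>Inc p. F (I @ K2) * cf K1 (wb I))"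
  using alt_expansion[OF alt_left[OF assms]] .

lemma alt_expansion_right:
  assumes "alt (p + q) F" "length K1 = p"
  shows "F (K1 @ K2) = (\<Sum>J\<in>Inc q. F (K1 @ J) * cf K2 (wb J))"
  using alt_expansion[OF alt_right[OF assms]] .

lemma alt_move: "alt p F \<Longrightarrow> F (P @ a # J @ Q) = (- 1) ^ length J * F (P @ J @ a # Q)"
proof (induction J arbitrary: P)
  case (Cons b J)
  have "F (P @ a # (b # J) @ Q) = - F ((P @ [b]) @ a # J @ Q)"
    using alt_swap[OF Cons.prems, of P a b "J @ Q"] by simp
  also have "\<dots> = - ((- 1) ^ length J * F ((P @ [b]) @ J @ a # Q))"
    by (simp only: Cons.IH[OF Cons.prems, of "P @ [b]"])
  finally show ?case by simp
qed simp

text \<open>Each letter of \<open>I\<close> passes each letter of \<open>J\<close>. In the induction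
  the first letter \<open>a\<close> is moved to the very end, and then \<open>I\<close> is moved
  past \<open>J @ [a]\<close>.\<close>

lemma alt_rotate: "alt p F \<Longrightarrow> F (I @ J) = (- 1) ^ (length I * length J) * F (J @ I)"
proof (induction I arbitrary: J)
  case (Cons a I)
  have "F ((a # I) @ J) = F ([] @ a # (I @ J) @ [])" by simp
  also have "\<dots> = (- 1) ^ length (I @ J) * F ([] @ (I @ J) @ a # [])"
    by (rule alt_move[OF Cons.prems])
  also have "F ([] @ (I @ J) @ a # []) = (- 1) ^ (length I * length (J @ [a])) * F ((J @ [a]) @ I)"
    using Cons.IH[OF Cons.prems, of "J @ [a]"] by simp
  finally have "F ((a # I) @ J) = (- 1) ^ (length (I @ J) + length I * length (J @ [a])) * F ((J @ [a]) @ I)"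
    by (simp add: power_add)
  \<comment> \<open>The letter \<open>a\<close> has crossed \<open>I\<close> twice; these
    \<open>2 * length I\<close> swaps do not affect the sign.\<close>
  also have "(- 1 :: 'k) ^ (length (I @ J) + length I * length (J @ [a])) = (- 1) ^ (length (a # I) * length J)"
    unfolding minus_one_power_iff by (rule if_cong) auto
  finally show ?case by simp
qed simp

end

subsection \<open>The spaces \<open>W\<^sub>p\<close>\<close>

context koszul
begin

definition subsp :: "('v, 'k) tens set \<Rightarrow> bool" where
  "subsp P \<longleftrightarrow> P \<subseteq> carrier T \<and> \<zero>\<^bsub>T\<^esub> \<in> P \<and> (\<forall>t\<in>P. \<forall>u\<in>P. t \<oplus>\<^bsub>T\<^esub> u \<in> P) \<and> (\<forall>a. \<forall>t\<in>P. a \<cdot> t \<in> P)"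

lemma kspan_least:
  assumes P: "subsp P" and U: "U \<subseteq> P"
  shows "kspan s U \<subseteq> P"
proof
  fix t assume "t \<in> kspan s U"
  then show "t \<in> P"
    unfolding kspan_def
  proof (induction rule: generate.induct)
    case (inv h)
    then obtain a t where h: "h = a \<cdot> t" "t \<in> U" by blast
    have t: "t \<in> carrier T" and "(- 1) \<cdot> a \<cdot> t \<in> P"
      using P U h(2) by (auto simp: subsp_def)
    moreover have "(- 1) \<cdot> a \<cdot> t = \<ominus>\<^bsub>T\<^esub> (a \<cdot> t)"
      by (rule smul_neg_one) (simp add: t)
    ultimately show ?case by (simp add: h a_inv_def)
  qed (use P U in \<open>auto simp: subsp_def\<close>)
qed

lemma kspan_zero: "\<zero>\<^bsub>T\<^esub> \<in> kspan s U"
  and kspan_smul: "t \<in> U \<Longrightarrow> a \<cdot> t \<in> kspan s U"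
  and kspan_add: "t \<in> kspan s U \<Longrightarrow> u \<in> kspan s U \<Longrightarrow> t \<oplus>\<^bsub>T\<^esub> u \<in> kspan s U"
  unfolding kspan_def
  using generate.one[of "add_monoid T"] generate.eng[of _ "add_monoid T"]
  by (auto intro: generate.incl)

lemma kspan_finsum:
  assumes U: "U \<subseteq> carrier T" and t: "\<And>i. i \<in> A \<Longrightarrow> t i \<in> U"
  shows "(\<Oplus>\<^bsub>T\<^esub>i\<in>A. a i \<cdot> t i) \<in> kspan s U"
proof -
  have "a i \<cdot> t i \<in> carrier T" if "i \<in> A" for i
    by (intro T.m_closed tscalar_in subsetD[OF U] t that)
  then show ?thesis using t
    by (induction A rule: infinite_finite_induct)
      (auto simp: kspan_zero T.finsum_insert Pi_iff intro!: kspan_add kspan_smul)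
qed

lemma kspan_finsum':
  assumes U: "U \<subseteq> carrier T" and t: "\<And>i. i \<in> A \<Longrightarrow> t i \<in> U"
  shows "(\<Oplus>\<^bsub>T\<^esub>i\<in>A. t i) \<in> kspan s U"
proof -
  have "(\<Oplus>\<^bsub>T\<^esub>i\<in>A. 1 \<cdot> t i) = (\<Oplus>\<^bsub>T\<^esub>i\<in>A. t i)"
    by (intro T.finsum_cong' refl) (simp_all add: smul_one subsetD[OF U t])
  then show ?thesis
    using kspan_finsum[of U A t "\<lambda>_. 1"] assms by simp
qed

text \<open>The tensor power of degree \<open>p\<close> in coordinates; see
  \<open>tpower_eq\<close>.\<close>

definition hom_part :: "nat \<Rightarrow> ('v, 'k) tens set" where
  "hom_part p = {t \<in> carrier T. supp p (\<lambda>K. cf K t)}"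

lemma hom_partD: "t \<in> hom_part p \<Longrightarrow> t \<in> carrier T" "t \<in> hom_part p \<Longrightarrow> K \<notin> words p \<Longrightarrow> cf K t = 0"
  by (auto simp: hom_part_def supp_def)

lemma subsp_hom_part: "subsp (hom_part p)"
  by (auto simp: subsp_def hom_part_def supp_def cf_zero cf_add cf_smult)

lemma cf_hom_mult:
  assumes "t \<in> hom_part p" "u \<in> carrier T"
  shows "cf K (t \<otimes>\<^bsub>T\<^esub> u) = cf (take p K) t * cf (drop p K) u"
  using assms by (intro cf_mult_homogeneous) (auto simp: hom_part_def supp_def words_def)

lemma words_take_drop:
  assumes "take p K \<in> words p" "drop p K \<in> words q"
  shows "K \<in> words (p + q)"
proof -
  have l: "length (take p K) = p" "length (drop p K) = q" "set (take p K) \<union> set (drop p K) \<subseteq> {1..n}"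
    using assms unfolding words_def by blast+
  then have "length (take p K @ drop p K) = p + q" "set (take p K @ drop p K) \<subseteq> {1..n}"
    by (simp_all only: length_append set_append)
  then show ?thesis by (simp add: words_def)
qed

lemma hom_part_mult:
  assumes "t \<in> hom_part p" "u \<in> hom_part q"
  shows "t \<otimes>\<^bsub>T\<^esub> u \<in> hom_part (p + q)"
proof -
  have "cf K (t \<otimes>\<^bsub>T\<^esub> u) = 0" if K: "K \<notin> words (p + q)" for K
  proof -
    have "take p K \<notin> words p \<or> drop p K \<notin> words q"
      using words_take_drop K by blast
    then show ?thesis using assms by (auto simp: cf_hom_mult hom_partD)
  qed
  then show ?thesis using assms by (auto simp: hom_part_def supp_def)
qed

lemma telt_hom_part: "telt p F \<in> hom_part p"
  by (auto simp: hom_part_def supp_def cf_telt)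

lemma tvec_hom_part: "tvec s v \<in> hom_part 1"
  by (auto simp: hom_part_def supp_def cf_tvec words_def coord_def split: list.splits)

lemma tprod_hom_part:
  assumes "U \<subseteq> hom_part p" "U' \<subseteq> hom_part q"
  shows "tprod s U U' \<subseteq> hom_part (p + q)"
  unfolding tprod_def using assms
  by (intro kspan_least[OF subsp_hom_part]) (auto intro!: hom_part_mult)

lemma tpower_eq: "tpower s p = hom_part p"
proof (induction p)
  case 0
  have "words 0 = {[]}" by (auto simp: words_def)
  moreover have "t \<in> range (tscalar s)" if "t \<in> carrier T" "\<forall>K. K \<noteq> [] \<longrightarrow> cf K t = 0" for t
  proof -
    have "t = tscalar s (cf [] t)" using that by (intro cf_ext) (auto simp: cf_tscalar)
    then show ?thesis by blast
  qed
  ultimately show ?case by (auto simp: hom_part_def supp_def cf_tscalar)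
next
  case (Suc p)
  show ?case
  proof
    have "tprod s (hom_part p) (range (tvec s)) \<subseteq> hom_part (p + 1)"
      by (rule tprod_hom_part) (auto intro: tvec_hom_part)
    then show "tpower s (Suc p) \<subseteq> hom_part (Suc p)" by (simp only: Suc.IH tpower.simps Suc_eq_plus1[of p, symmetric])
    show "hom_part (Suc p) \<subseteq> tpower s (Suc p)"
    proof
      fix t assume t: "t \<in> hom_part (Suc p)"
      \<comment> \<open>Collect the terms of \<open>t\<close> by their last letter
        \<open>i\<close>.\<close>
      let ?u = "\<lambda>i. telt p (\<lambda>K. cf (K @ [i]) t) \<otimes>\<^bsub>T\<^esub> tvec s (x i)"
      have "cf K t = cf K (\<Oplus>\<^bsub>T\<^esub>i\<in>{1..n}. ?u i)" for K
      proof -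
        have eq: "cf K (\<Oplus>\<^bsub>T\<^esub>i\<in>{1..n}. ?u i)
            = (\<Sum>i\<in>{1..n}. cf (take p K) (telt p (\<lambda>K. cf (K @ [i]) t)) * cf (drop p K) (tvec s (x i)))"
          by (subst cf_finsum) (auto simp: cf_hom_mult[OF telt_hom_part])
        show ?thesis
        proof (cases "K \<in> words (Suc p)")
          case True
          then obtain L i where K: "K = L @ [i]" "length L = p" "set L \<subseteq> {1..n}" "i \<in> {1..n}"
            by (cases K rule: rev_cases) (auto simp: words_def)
          have "cf K (\<Oplus>\<^bsub>T\<^esub>i\<in>{1..n}. ?u i) = (\<Sum>j\<in>{1..n}. if j = i then cf (L @ [j]) t else 0)"
            unfolding eq using K
            by (intro sum.cong) (auto simp: cf_telt words_def cf_tvec coord_basis)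
          then show ?thesis using K by (simp add: sum.delta)
        next
          case False
          have "cf (take p K) (telt p (\<lambda>K. cf (K @ [i]) t)) * cf (drop p K) (tvec s (x i)) = 0" for i
          proof (rule ccontr)
            assume "\<not> ?thesis"
            then have ne: "cf (take p K) (telt p (\<lambda>K. cf (K @ [i]) t)) \<noteq> 0" "cf (drop p K) (tvec s (x i)) \<noteq> 0"
              by (metis mult_zero_left, metis mult_zero_right)
            have "take p K \<in> words p"
              by (rule ccontr) (use ne(1) hom_partD(2)[OF telt_hom_part] in blast)
            moreover have "drop p K \<in> words 1"
              by (rule ccontr) (use ne(2) hom_partD(2)[OF tvec_hom_part] in blast)
            ultimately have "K \<in> words (p + 1)" by (rule words_take_drop)
            then show False using False unfolding Suc_eq_plus1 by blast
          qed
          then show ?thesis unfolding eq hom_partD(2)[OF t False] by (simp only: sum.neutral_const)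
        qed
      qed
      moreover have "(\<Oplus>\<^bsub>T\<^esub>i\<in>{1..n}. ?u i) \<in> carrier T"
        by (rule T.finsum_closed) simp
      ultimately have eq: "t = (\<Oplus>\<^bsub>T\<^esub>i\<in>{1..n}. ?u i)"
        by (intro cf_ext hom_partD(1)[OF t])
      have "(\<Oplus>\<^bsub>T\<^esub>i\<in>{1..n}. ?u i) \<in> kspan s {t \<otimes>\<^bsub>T\<^esub> u |t u. t \<in> hom_part p \<and> u \<in> range (tvec s)}"
        by (rule kspan_finsum') (auto intro: telt_hom_part hom_partD)
      then show "t \<in> tpower s (Suc p)"
        using eq by (simp add: Suc tprod_def)
    qed
  qed
qed

text \<open>For \<open>i + 2 + j = p\<close> this is
  \<open>V\<^sup>i \<otimes> R \<otimes> V\<^sup>j\<close> in coordinates, by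
  \<open>relation_space_eq\<close>; here powers of \<open>V\<close> are tensor powers.\<close>

definition alt_part :: "nat \<Rightarrow> nat \<Rightarrow> ('v, 'k) tens set" where
  "alt_part p i = {t \<in> hom_part p. alt_at i (\<lambda>K. cf K t)}"

lemma subsp_alt_part: "subsp (alt_part p i)"
proof -
  have 1: "alt_at i (\<lambda>K. cf K (t \<oplus>\<^bsub>T\<^esub> u))"
    if "t \<in> carrier T" "u \<in> carrier T" "alt_at i (\<lambda>K. cf K t)" "alt_at i (\<lambda>K. cf K u)" for t u
    \<comment> \<open>A sum of two tensors is treated as a sum over a two-element index set.\<close>
    using alt_at_sum[of "{True, False}" i "\<lambda>b K. cf K (if b then t else u)" "\<lambda>_. 1"] that
    by (simp add: cf_add)
  have 2: "alt_at i (\<lambda>K. cf K (a \<cdot> t))" if "t \<in> carrier T" "alt_at i (\<lambda>K. cf K t)" for a t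
    using alt_at_sum[of "{True}" i "\<lambda>b K. cf K t" "\<lambda>_. a"] that by (simp add: cf_smult)
  have 3: "alt_at i (\<lambda>K. cf K \<zero>\<^bsub>T\<^esub>)" by (simp add: cf_zero alt_at_def)
  show ?thesis
    using subsp_hom_part[of p] unfolding subsp_def alt_part_def
    by (auto intro: 1 2 3 dest: hom_partD(1))
qed

lemma alt_part_pairI:
  assumes t: "t \<in> hom_part 2" and rep: "\<And>a. cf [a, a] t = 0"
    and swap: "\<And>a b. cf [a, b] t = - cf [b, a] t"
  shows "t \<in> alt_part 2 0"
proof -
  have "alt_at 0 (\<lambda>K. cf K t)"
  proof (rule alt_atI)
    fix I :: "nat list" and a b J assume I: "length I = 0"
    have J: "cf (a # b # J) t = 0" if "J \<noteq> []" for a b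
      using that by (intro hom_partD(2)[OF t]) (auto simp: words_def)
    show "cf (I @ a # a # J) t = 0" using rep[of a] J[of a a] I by (cases "J = []") simp_all
    show "cf (I @ a # b # J) t = - cf (I @ b # a # J) t"
      using swap[of a b] J[of a b] J[of b a] I by (cases "J = []") simp_all
  qed
  then show "t \<in> alt_part 2 0" using t by (simp add: alt_part_def)
qed

lemma alt_part_pairD:
  assumes "t \<in> alt_part 2 0"
  shows "cf [a, a] t = 0" and "cf [a, b] t = - cf [b, a] t"
proof -
  have "alt_at 0 (\<lambda>K. cf K t)" using assms by (simp add: alt_part_def)
  from alt_at_repeat[OF this, of "[]" a "[]"] alt_at_swap[OF this, of "[]" a b "[]"]
  show "cf [a, a] t = 0" "cf [a, b] t = - cf [b, a] t" by simp_all
qed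

lemma cf_pair:
  "cf K (tvec s u \<otimes>\<^bsub>T\<^esub> tvec s v) = (case K of [a, b] \<Rightarrow> coord a u * coord b v | _ \<Rightarrow> 0)"
proof -
  have "cf K (tvec s u \<otimes>\<^bsub>T\<^esub> tvec s v) = cf (take 1 K) (tvec s u) * cf (drop 1 K) (tvec s v)"
    by (rule cf_hom_mult[OF tvec_hom_part tvec_in])
  then show ?thesis
    by (auto simp: cf_tvec One_nat_def split: list.splits)
qed

text \<open>An alternating function on two-letter words is determined by its values at
  \<open>[a, b]\<close> with \<open>a < b\<close>, and these are its coefficients with respect to
  the commutators of basis vectors. A commutator also has coefficient zero at \<open>[a, a]\<close>,
  which antisymmetry alone would not give in characteristic 2.\<close>

lemma comm_relations_eq: "comm_relations s = alt_part 2 0"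
proof
  let ?c = "\<lambda>u v. (tvec s u \<otimes>\<^bsub>T\<^esub> tvec s v) \<ominus>\<^bsub>T\<^esub> (tvec s v \<otimes>\<^bsub>T\<^esub> tvec s u)"
  let ?U = "{?c u v |u v. True}"
  have c_in: "?c u v \<in> carrier T" for u v by simp
  have cf_c: "cf K (?c u v) = (case K of [a, b] \<Rightarrow> coord a u * coord b v - coord a v * coord b u | _ \<Rightarrow> 0)" for K u v
    by (simp add: cf_minus cf_pair split: list.splits)
  have "?c u v \<in> alt_part 2 0" for u v
  proof -
    have "cf K (?c u v) = 0" if "K \<notin> words 2" for K
      using that unfolding cf_c by (auto simp: words_def coord_def split: list.splits)
    then have "?c u v \<in> hom_part 2" using c_in by (simp add: hom_part_def supp_def)
    then show ?thesis by (rule alt_part_pairI) (simp_all add: cf_c)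
  qed
  then show "comm_relations s \<subseteq> alt_part 2 0"
    unfolding comm_relations_def by (intro kspan_least subsp_alt_part) auto
  show "alt_part 2 0 \<subseteq> comm_relations s"
  proof
    fix t assume t: "t \<in> alt_part 2 0"
    then have rep: "cf [a, a] t = 0" and swap: "cf [a, b] t = - cf [b, a] t" for a b
      by (rule alt_part_pairD)+
    \<comment> \<open>Each unordered pair of distinct basis vectors is used once; the values at the
      remaining words are forced by \<open>rep\<close> and \<open>swap\<close>.\<close>
    let ?A = "{(a, b). a \<in> {1..n} \<and> b \<in> {1..n} \<and> a < b}"
    have fin: "finite ?A" by (rule finite_subset[of _ "{1..n} \<times> {1..n}"]) auto
    let ?r = "\<lambda>p. ?c (x (fst p)) (x (snd p))"
    let ?u = "\<Oplus>\<^bsub>T\<^esub>p\<in>?A. cf [fst p, snd p] t \<cdot> ?r p"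
    have cfu: "cf K ?u = (\<Sum>p\<in>?A. cf [fst p, snd p] t * cf K (?r p))" for K
      by (subst cf_finsum) (auto simp: cf_smult)
    have "cf K t = cf K ?u" for K
    proof (cases "K \<in> words 2")
      case True
      then obtain c d where K: "K = [c, d]" "c \<in> {1..n}" "d \<in> {1..n}"
        by (auto simp: words_def length_Suc_conv numeral_2_eq_2)
      have r: "cf K (?r p) = of_bool (p = (c, d)) - of_bool (p = (d, c))" if "p \<in> ?A" for p
      proof -
        obtain a b where p: "p = (a, b)" "a \<in> {1..n}" "b \<in> {1..n}" using \<open>p \<in> ?A\<close> by blast
        show ?thesis
          unfolding p(1) K(1) cf_c fst_conv snd_conv list.case coord_basis[OF p(2)] coord_basis[OF p(3)] prod.inject
          by (cases "c = a"; cases "d = b"; cases "c = b"; cases "d = a") simp_all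
      qed
      have "cf K ?u = (\<Sum>p\<in>?A. (if p = (c, d) then cf [c, d] t else 0) - (if p = (d, c) then cf [d, c] t else 0))"
        unfolding cfu
      proof (intro sum.cong refl)
        fix p assume "p \<in> ?A"
        show "cf [fst p, snd p] t * cf K (?r p)
            = (if p = (c, d) then cf [c, d] t else 0) - (if p = (d, c) then cf [d, c] t else 0)"
          unfolding r[OF \<open>p \<in> ?A\<close>]
        proof (cases "c = d")
          case False
          then have "(c, d) \<noteq> (d, c)" by blast
          then show "cf [fst p, snd p] t * (of_bool (p = (c, d)) - of_bool (p = (d, c)))
            = (if p = (c, d) then cf [c, d] t else 0) - (if p = (d, c) then cf [d, c] t else 0)"
            by (cases "p = (c, d)"; cases "p = (d, c)") simp_all
        qed simp
      qed
      also have "\<dots> = (if c < d then cf [c, d] t else 0) - (if d < c then cf [d, c] t else 0)"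
        using fin K by (simp add: sum_subtractf sum.delta)
      also have "\<dots> = cf [c, d] t"
        using rep[of c] swap[of c d] by (cases c d rule: linorder_cases) auto
      finally show ?thesis using K by simp
    next
      case False
      have "cf K (?r p) = 0" for p
        using False unfolding cf_c by (auto simp: words_def coord_def split: list.splits)
      moreover have "cf K t = 0"
        using t False by (auto simp: alt_part_def dest: hom_partD)
      ultimately show ?thesis unfolding cfu by (simp only: mult_zero_right sum.neutral_const)
    qed
    moreover have "?u \<in> carrier T"
      by (rule T.finsum_closed) simp
    moreover have "t \<in> carrier T" using t hom_partD(1)[of t 2] by (simp add: alt_part_def)
    ultimately have "t = ?u" by (intro cf_ext)
    moreover have "?u \<in> comm_relations s"
      unfolding comm_relations_def by (intro kspan_finsum) auto
    ultimately show "t \<in> comm_relations s" by metis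
  qed
qed

lemma alt_part_hom_part: "alt_part p i \<subseteq> hom_part p"
  by (auto simp: alt_part_def)

text \<open>Multiplying a relation by tensors on both sides affects only the letters before and
  after its pair, which gives one inclusion. For the other, the pair at position \<open>i\<close> is
  read as a relation for each choice of the surrounding letters.\<close>

lemma relation_space_eq:
  "tprod s (tprod s (tpower s i) (comm_relations s)) (tpower s j) = alt_part (i + 2 + j) i"
proof
  have step: "u \<otimes>\<^bsub>T\<^esub> r \<in> alt_part (i + 2) i" if u: "u \<in> hom_part i" and r: "r \<in> alt_part 2 0" for u r
  proof -
    have rc: "r \<in> hom_part 2" "r \<in> carrier T" "alt_at 0 (\<lambda>K. cf K r)"
      using r alt_part_hom_part hom_partD(1) by (auto simp: alt_part_def)
    have "alt_at i (\<lambda>K. cf K (u \<otimes>\<^bsub>T\<^esub> r))"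
    proof (rule alt_atI)
      fix I :: "nat list" and a b J assume I: "length I = i"
      show "cf (I @ a # a # J) (u \<otimes>\<^bsub>T\<^esub> r) = 0"
        using alt_at_repeat[OF rc(3), of "[]" a J] by (simp add: cf_hom_mult[OF u rc(2)] I)
      show "cf (I @ a # b # J) (u \<otimes>\<^bsub>T\<^esub> r) = - cf (I @ b # a # J) (u \<otimes>\<^bsub>T\<^esub> r)"
        using alt_at_swap[OF rc(3), of "[]" a b J] by (simp add: cf_hom_mult[OF u rc(2)] I)
    qed
    then show ?thesis using hom_part_mult[OF u rc(1)] by (simp add: alt_part_def)
  qed
  have left: "tprod s (hom_part i) (alt_part 2 0) \<subseteq> alt_part (i + 2) i"
    unfolding tprod_def by (intro kspan_least subsp_alt_part) (use step in blast)
  have step': "u \<otimes>\<^bsub>T\<^esub> r \<in> alt_part (i + 2 + j) i" if u: "u \<in> alt_part (i + 2) i" and r: "r \<in> hom_part j" for u r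
  proof -
    have uc: "u \<in> hom_part (i + 2)" "alt_at i (\<lambda>K. cf K u)"
      using u by (auto simp: alt_part_def)
    have "alt_at i (\<lambda>K. cf K (u \<otimes>\<^bsub>T\<^esub> r))"
    proof (rule alt_atI)
      fix I :: "nat list" and a b J assume I: "length I = i"
      show "cf (I @ a # a # J) (u \<otimes>\<^bsub>T\<^esub> r) = 0"
        using alt_at_repeat[OF uc(2) I, of a "[]"]
        by (simp add: cf_hom_mult[OF uc(1) hom_partD(1)[OF r]] I numeral_2_eq_2)
      show "cf (I @ a # b # J) (u \<otimes>\<^bsub>T\<^esub> r) = - cf (I @ b # a # J) (u \<otimes>\<^bsub>T\<^esub> r)"
        using alt_at_swap[OF uc(2) I, of a b "[]"]
        by (simp add: cf_hom_mult[OF uc(1) hom_partD(1)[OF r]] I numeral_2_eq_2)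
    qed
    then show ?thesis using hom_part_mult[OF uc(1) r] by (simp add: alt_part_def)
  qed
  show "tprod s (tprod s (tpower s i) (comm_relations s)) (tpower s j) \<subseteq> alt_part (i + 2 + j) i"
    unfolding tpower_eq comm_relations_eq
    unfolding tprod_def[of s "tprod s (hom_part i) (alt_part 2 0)"]
    using left by (intro kspan_least subsp_alt_part) (use step' in blast)
  show "alt_part (i + 2 + j) i \<subseteq> tprod s (tprod s (tpower s i) (comm_relations s)) (tpower s j)"
  proof
    fix t assume t: "t \<in> alt_part (i + 2 + j) i"
    \<comment> \<open>For a fixed prefix \<open>I\<close> and suffix \<open>J\<close>, the
      coefficients of \<open>t\<close> at the words \<open>I @ K @ J\<close> form the relation
      \<open>?r I J\<close>; \<open>?e\<close> supplies the basis words placed around it.\<close>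
    let ?e = "\<lambda>p I. telt p (\<lambda>K. of_bool (K = I))"
    let ?r = "\<lambda>I J. telt 2 (\<lambda>K. cf (I @ K @ J) t)"
    let ?u = "\<lambda>p. (?e i (fst p) \<otimes>\<^bsub>T\<^esub> ?r (fst p) (snd p)) \<otimes>\<^bsub>T\<^esub> ?e j (snd p)"
    have tc: "t \<in> hom_part (i + 2 + j)" "alt_at i (\<lambda>K. cf K t)"
      using t by (auto simp: alt_part_def)
    have r: "?r I J \<in> alt_part 2 0" if "length I = i" for I J
    proof -
      have "cf [a, a] (?r I J) = 0" for a
        using alt_at_repeat[OF tc(2) that, of a J] by (simp add: cf_telt)
      moreover have "cf [a, b] (?r I J) = - cf [b, a] (?r I J)" for a b
      proof -
        have "[a, b] \<in> words 2 \<longleftrightarrow> [b, a] \<in> words 2" by (auto simp: words_def)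
        then show ?thesis using alt_at_swap[OF tc(2) that, of a b J] by (simp add: cf_telt)
      qed
      ultimately show ?thesis by (intro alt_part_pairI telt_hom_part)
    qed
    have u_in: "?u p \<in> hom_part (i + 2 + j)" for p
      by (intro hom_part_mult telt_hom_part)
    have cfu: "cf K (?u p) = of_bool (take i K = fst p \<and> take i K \<in> words i) * (cf (drop i (take (i + 2) K)) (?r (fst p) (snd p))
        * of_bool (drop (i + 2) K = snd p \<and> drop (i + 2) K \<in> words j))" for K p
      by (simp add: cf_hom_mult[OF hom_part_mult[OF telt_hom_part telt_hom_part] telt_in]
          cf_hom_mult[OF telt_hom_part telt_in] cf_telt min_def mult.assoc)
    have "cf K t = cf K (\<Oplus>\<^bsub>T\<^esub>p\<in>words i \<times> words j. ?u p)" for K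
    proof (cases "K \<in> words (i + 2 + j)")
      case True
      define I M J where IMJ: "I = take i K" "M = drop i (take (i + 2) K)" "J = drop (i + 2) K"
      have sub: "set I \<subseteq> set K" "set M \<subseteq> set K" "set J \<subseteq> set K"
        unfolding IMJ using set_take_subset set_drop_subset by (metis subset_trans)+
      then have w: "I \<in> words i" "M \<in> words 2" "J \<in> words j"
        using True by (auto simp: IMJ words_def)
      have K: "K = I @ M @ J"
        unfolding IMJ by (metis append.assoc append_take_drop_id take_take min.absorb1 le_add1)
      have "cf K (\<Oplus>\<^bsub>T\<^esub>p\<in>words i \<times> words j. ?u p) = (\<Sum>p\<in>words i \<times> words j. cf K (?u p))"
        by (intro cf_finsum) simp
      \<comment> \<open>Cutting \<open>K\<close> after \<open>i\<close> and after
        \<open>i + 2\<close> letters leaves a single pair that contributes.\<close>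
      also have "\<dots> = (\<Sum>p\<in>words i \<times> words j. if p = (I, J) then cf K t else 0)"
      proof (intro sum.cong refl)
        fix p
        show "cf K (?u p) = (if p = (I, J) then cf K t else 0)"
          using w unfolding cfu IMJ(1)[symmetric] IMJ(2)[symmetric] IMJ(3)[symmetric]
          by (cases p) (auto simp: cf_telt K)
      qed
      also have "\<dots> = cf K t"
        using w finite_words by (subst sum.delta) auto
      finally show ?thesis by simp
    next
      case False
      then have "cf K (?u p) = 0" for p using u_in hom_partD(2) by blast
      moreover have "cf K (\<Oplus>\<^bsub>T\<^esub>p\<in>words i \<times> words j. ?u p) = (\<Sum>p\<in>words i \<times> words j. cf K (?u p))"
        by (intro cf_finsum) simp
      ultimately show ?thesis using hom_partD(2)[OF tc(1) False] by simp
    qed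
    moreover have "(\<Oplus>\<^bsub>T\<^esub>p\<in>words i \<times> words j. ?u p) \<in> carrier T"
      by (rule T.finsum_closed) simp
    ultimately have eq: "t = (\<Oplus>\<^bsub>T\<^esub>p\<in>words i \<times> words j. ?u p)"
      by (intro cf_ext hom_partD(1)[OF tc(1)])
    have lc: "tprod s (hom_part i) (alt_part 2 0) \<subseteq> carrier T"
      using left alt_part_hom_part hom_partD(1) by blast
    have "?e i I \<otimes>\<^bsub>T\<^esub> ?r I J \<in> tprod s (hom_part i) (alt_part 2 0)" if "I \<in> words i" for I J
    proof -
      have "1 \<cdot> (?e i I \<otimes>\<^bsub>T\<^esub> ?r I J) \<in> tprod s (hom_part i) (alt_part 2 0)"
        unfolding tprod_def using r[of I J] that
        by (intro kspan_smul CollectI exI[of _ "?e i I"] exI[of _ "?r I J"] conjI refl telt_hom_part)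
          (simp add: words_def)
      then show ?thesis by (simp add: smul_one)
    qed
    then have "?u p \<in> {t \<otimes>\<^bsub>T\<^esub> u |t u. t \<in> tprod s (hom_part i) (alt_part 2 0) \<and> u \<in> hom_part j}"
      if "p \<in> words i \<times> words j" for p
      using that telt_hom_part by fastforce
    then have "(\<Oplus>\<^bsub>T\<^esub>p\<in>words i \<times> words j. ?u p) \<in> tprod s (tprod s (hom_part i) (alt_part 2 0)) (hom_part j)"
      unfolding tprod_def[of s "tprod s (hom_part i) (alt_part 2 0)"]
      by (intro kspan_finsum') (use lc hom_partD(1) in auto)
    then show "t \<in> tprod s (tprod s (tpower s i) (comm_relations s)) (tpower s j)"
      unfolding tpower_eq comm_relations_eq using eq by metis
  qed
qed

text \<open>By \<open>relation_space_eq\<close> the members of the intersection are the alternation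
  conditions at the single positions. For \<open>p < 2\<close> there is no position and only
  homogeneity remains, in accordance with the separate cases of \<open>W\<close>.\<close>

lemma W_iff: "t \<in> W s p \<longleftrightarrow> t \<in> carrier T \<and> alt p (\<lambda>K. cf K t)"
proof -
  have 1: "t \<in> carrier T \<and> alt p (\<lambda>K. cf K t) \<longleftrightarrow> t \<in> hom_part p \<and> (\<forall>i. i + 2 \<le> p \<longrightarrow> t \<in> alt_part p i)"
    by (auto simp: alt_def alt_part_def hom_part_def)
  have "(\<Inter> {tprod s (tprod s (tpower s i) (comm_relations s)) (tpower s j) |i j. i + 2 + j = p})
      = \<Inter> {alt_part p i |i. i + 2 \<le> p}"
  proof -
    have "{tprod s (tprod s (tpower s i) (comm_relations s)) (tpower s j) |i j. i + 2 + j = p}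
        = {alt_part p i |i. i + 2 \<le> p}"
      unfolding relation_space_eq by (auto simp: le_iff_add)
    then show ?thesis by simp
  qed
  moreover have "t \<in> \<Inter> {alt_part p i |i. i + 2 \<le> p}
      \<longleftrightarrow> t \<in> hom_part p \<and> (\<forall>i. i + 2 \<le> p \<longrightarrow> t \<in> alt_part p i)" if "p \<ge> 2"
  proof
    assume t: "t \<in> \<Inter> {alt_part p i |i. i + 2 \<le> p}"
    then have "t \<in> alt_part p i" if "i + 2 \<le> p" for i using that by blast
    moreover from this[of 0] have "t \<in> hom_part p" using that alt_part_hom_part by auto
    ultimately show "t \<in> hom_part p \<and> (\<forall>i. i + 2 \<le> p \<longrightarrow> t \<in> alt_part p i)" by blast
  qed blast
  moreover have "comm_relations s = \<Inter> {alt_part 2 i |i. i + 2 \<le> 2}"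
    unfolding comm_relations_eq by auto
  ultimately show ?thesis
    unfolding 1 W_def tpower_eq
    by (cases "p = 0"; cases "p = 1"; cases "p = 2") (simp_all add: comm_relations_eq)
qed

section \<open>The top element and complementary increasing words\<close>

abbreviation omega :: "('v, 'k) tens" where
  "omega \<equiv> wedge s n x"

lemma cf_omega:
  "cf K omega = (\<Sum>\<sigma> | \<sigma> permutes {1..n}. of_int (sign \<sigma>) * of_bool (map \<sigma> [1..<Suc n] = K))"
proof -
  have "cf K omega = (\<Sum>\<sigma> | \<sigma> permutes {1..n}.
      of_int (sign \<sigma>) * wcoef (map (\<lambda>i. x (inv_into UNIV \<sigma> i)) [1..<Suc n]) K)"
    by (simp only: wedge_def cf_tclass pcf_sum pcf_single)
  also have "\<dots> = (\<Sum>\<sigma> | \<sigma> permutes {1..n}. of_int (sign (inv_into UNIV \<sigma>)) * of_bool (map (inv_into UNIV \<sigma>) [1..<Suc n] = K))"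
  proof (intro sum.cong refl)
    fix \<sigma> assume "\<sigma> \<in> {\<sigma>. \<sigma> permutes {1..n}}"
    then have \<sigma>: "\<sigma> permutes {1..n}" by simp
    have "inv_into UNIV \<sigma> ` {1..n} = {1..n}" by (rule permutes_image[OF permutes_inv[OF \<sigma>]])
    then have "set (map (inv_into UNIV \<sigma>) [1..<Suc n]) \<subseteq> {1..n}"
      by (simp only: set_map set_upt atLeastLessThanSuc_atLeastAtMost)
    then have "wcoef (map x (map (inv_into UNIV \<sigma>) [1..<Suc n])) K = of_bool (map (inv_into UNIV \<sigma>) [1..<Suc n] = K)"
      by (rule wcoef_basis)
    moreover have "sign (inv_into UNIV \<sigma>) = sign \<sigma>"
      using sign_inverse permutes_imp_permutation[OF _ \<sigma>] by blast
    ultimately show "of_int (sign \<sigma>) * wcoef (map (\<lambda>i. x (inv_into UNIV \<sigma> i)) [1..<Suc n]) K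
        = of_int (sign (inv_into UNIV \<sigma>)) * of_bool (map (inv_into UNIV \<sigma>) [1..<Suc n] = K)"
      by (simp only: map_map o_def)
  qed
  also have "\<dots> = (\<Sum>\<sigma> | \<sigma> permutes {1..n}. of_int (sign \<sigma>) * of_bool (map \<sigma> [1..<Suc n] = K))"
    by (rule sum_permutations_inverse[symmetric])
  finally show ?thesis .
qed

lemma omega_in [simp]: "omega \<in> carrier T"
  by (simp add: wedge_def)

lemma cf_omega_top: "cf [1..<Suc n] omega = 1"
proof -
  have "map \<sigma> [1..<Suc n] = [1..<Suc n] \<longleftrightarrow> \<sigma> = id" if "\<sigma> permutes {1..n}" for \<sigma>
  proof
    assume "map \<sigma> [1..<Suc n] = [1..<Suc n]"
    then have "map \<sigma> [1..<Suc n] = map id [1..<Suc n]" by simp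
    then have "\<sigma> i = id i" if "i \<in> {1..n}" for i
      using that unfolding map_eq_conv set_upt atLeastLessThanSuc_atLeastAtMost by blast
    moreover have "\<sigma> i = id i" if "i \<notin> {1..n}" for i
      using permutes_not_in[OF \<open>\<sigma> permutes {1..n}\<close> that] by simp
    ultimately show "\<sigma> = id" by blast
  qed simp
  then have "cf [1..<Suc n] omega = (\<Sum>\<sigma> | \<sigma> permutes {1..n}. if \<sigma> = id then 1 else 0)"
    unfolding cf_omega by (intro sum.cong) auto
  also have "\<dots> = 1"
    using permutes_id[of "{1..n}"] finite_permutations[of "{1..n}"] by (simp add: sum.delta)
  finally show ?thesis .
qed

lemma alt_omega: "alt n (\<lambda>K. cf K omega)"
proof (rule altI)
  fix K assume K: "K \<notin> words n"
  have "map \<sigma> [1..<Suc n] \<noteq> K" if "\<sigma> permutes {1..n}" for \<sigma>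
  proof
    assume "map \<sigma> [1..<Suc n] = K"
    then have "length K = n" "set K = \<sigma> ` {1..n}"
      by (auto simp: atLeastLessThanSuc_atLeastAtMost simp del: upt_Suc)
    then show False using K permutes_image[OF that] by (simp add: words_def)
  qed
  then show "cf K omega = 0" unfolding cf_omega by (intro sum.neutral) auto
next
  fix I a J
  have "map \<sigma> [1..<Suc n] \<noteq> I @ a # a # J" if "\<sigma> permutes {1..n}" for \<sigma>
  proof
    assume "map \<sigma> [1..<Suc n] = I @ a # a # J"
    moreover have "distinct (map \<sigma> [1..<Suc n])"
      using permutes_inj_on[OF that] by (simp add: distinct_map del: upt_Suc)
    ultimately show False by simp
  qed
  then show "cf (I @ a # a # J) omega = 0" unfolding cf_omega by (intro sum.neutral) auto
next
  fix I a b J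
  show "cf (I @ a # b # J) omega = - cf (I @ b # a # J) omega"
  proof (cases "length I + 2 + length J = n")
    case True
    \<comment> \<open>The letters \<open>a\<close> and \<open>b\<close> stand at the positions
      \<open>?i\<close> and \<open>Suc ?i\<close>, since positions are counted from 1. Composing a
      permutation on the right with the transposition of these positions exchanges the two letters
      and reverses the sign.\<close>
    let ?i = "Suc (length I)"
    let ?\<tau> = "transpose ?i (Suc ?i)"
    have \<tau>: "?\<tau> permutes {1..n}"
      using True by (intro permutes_swap_id) auto
    have L: "[1..<Suc n] = [1..<?i] @ ?i # Suc ?i # [Suc (Suc ?i)..<Suc n]"
    proof -
      have "[1..<Suc n] = [1..<?i] @ [?i..<Suc n]"
        using upt_add_eq_append[of 1 ?i "Suc n - ?i"] True by simp
      moreover have "[?i..<Suc n] = ?i # Suc ?i # [Suc (Suc ?i)..<Suc n]"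
        using True by (simp add: upt_conv_Cons del: upt_Suc)
      ultimately show ?thesis by simp
    qed
    have swap: "map (\<sigma> \<circ> ?\<tau>) [1..<Suc n] = I @ a # b # J \<longleftrightarrow> map \<sigma> [1..<Suc n] = I @ b # a # J" for \<sigma>
    proof -
      have e: "map (\<sigma> \<circ> ?\<tau>) [1..<?i] = map \<sigma> [1..<?i]"
        "map (\<sigma> \<circ> ?\<tau>) [Suc (Suc ?i)..<Suc n] = map \<sigma> [Suc (Suc ?i)..<Suc n]"
        by (auto simp: transpose_def simp del: upt_Suc)
      have "length (map \<sigma> [1..<?i]) = length I" by (simp only: length_map length_upt diff_Suc_1)
      then show ?thesis
        unfolding L map_append list.map e by (auto simp: append_eq_append_conv simp del: upt_Suc)
    qed
    have "cf (I @ a # b # J) omega = (\<Sum>\<sigma> | \<sigma> permutes {1..n}.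
        of_int (sign (\<sigma> \<circ> ?\<tau>)) * of_bool (map (\<sigma> \<circ> ?\<tau>) [1..<Suc n] = I @ a # b # J))"
      unfolding cf_omega by (rule sum_permutations_compose_right[OF \<tau>])
    also have "\<dots> = (\<Sum>\<sigma> | \<sigma> permutes {1..n}. - (of_int (sign \<sigma>) * of_bool (map \<sigma> [1..<Suc n] = I @ b # a # J)))"
    proof (intro sum.cong refl)
      fix \<sigma> assume "\<sigma> \<in> {\<sigma>. \<sigma> permutes {1..n}}"
      then have "permutation \<sigma>" "permutation ?\<tau>"
        using \<tau> permutes_imp_permutation by blast+
      then have "sign (\<sigma> \<circ> ?\<tau>) = - sign \<sigma>" by (simp add: sign_compose sign_swap_id)
      then show "of_int (sign (\<sigma> \<circ> ?\<tau>)) * of_bool (map (\<sigma> \<circ> ?\<tau>) [1..<Suc n] = I @ a # b # J)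
          = - (of_int (sign \<sigma>) * of_bool (map \<sigma> [1..<Suc n] = I @ b # a # J) :: 'k)"
        unfolding swap by simp
    qed
    also have "\<dots> = - cf (I @ b # a # J) omega"
      unfolding cf_omega by (rule sum_negf)
    finally show ?thesis .
  next
    case False
    have "cf (I @ c # d # J) omega = 0" for c d
    proof -
      have "map \<sigma> [1..<Suc n] \<noteq> I @ c # d # J" for \<sigma> :: "nat \<Rightarrow> nat"
      proof
        assume "map \<sigma> [1..<Suc n] = I @ c # d # J"
        from arg_cong[OF this, of length] show False using False by (simp del: upt_Suc)
      qed
      then show ?thesis unfolding cf_omega by simp
    qed
    then show ?thesis by simp
  qed
qed

lemma omega_W: "omega \<in> W s n"
  by (simp add: W_iff alt_omega)

lemma Inc_top: "Inc n = {[1..<Suc n]}"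
proof -
  have "K = [1..<Suc n]" if "K \<in> Inc n" for K
  proof (rule sorted_distinct_set_unique)
    have K: "length K = n" "set K \<subseteq> {1..n}" "sorted_wrt (<) K"
      using that by (auto simp: Inc_def words_def)
    then show "sorted K" "distinct K" by (simp_all add: strict_sorted_iff)
    then have "card (set K) = card {1..n}" using K(1) distinct_card by force
    then have "set K = {1..n}" using K(2) by (intro card_subset_eq) auto
    then show "set K = set [1..<Suc n]" by (simp add: atLeastLessThanSuc_atLeastAtMost del: upt_Suc)
  qed (simp_all del: upt_Suc)
  moreover have "[1..<Suc n] \<in> Inc n"
    by (simp add: Inc_def words_def atLeastLessThanSuc_atLeastAtMost del: upt_Suc)
  ultimately show ?thesis by blast
qed

text \<open>The only increasing word of length \<open>n\<close> is \<open>[1..<Suc n]\<close>, where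
  \<open>omega\<close> has coefficient 1. Alternation fixes all other coefficients, so signs of
  permutations need not be compared with \<open>eps\<close> directly.\<close>

lemma cf_omega_eps: "cf K omega = (if mset K = mset [1..<Suc n] then of_int (eps K) else 0)"
proof -
  have "[1..<Suc n] \<in> Inc n" by (simp only: Inc_top singleton_iff)
  then have "[1..<Suc n] \<in> words n" unfolding Inc_def by blast
  then show ?thesis
    using alt_expansion[OF alt_omega, of K] unfolding Inc_top
    by (simp add: cf_omega_top cf_wb del: upt_Suc)
qed

definition compl :: "nat list \<Rightarrow> nat list" where
  "compl I = sorted_list_of_set ({1..n} - set I)"

lemma compl_Inc:
  assumes "I \<in> Inc p" "p \<le> n"
  shows "compl I \<in> Inc (n - p)"
proof -
  have I: "length I = p" "set I \<subseteq> {1..n}" "distinct I"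
    using assms by (auto simp: Inc_def words_def strict_sorted_iff)
  have "card ({1..n} - set I) = n - p"
    using I distinct_card[OF I(3)] by (subst card_Diff_subset) auto
  then show ?thesis by (auto simp: compl_def Inc_def words_def strict_sorted_iff)
qed

lemma compl_compl: "I \<in> Inc p \<Longrightarrow> compl (compl I) = I"
proof -
  assume "I \<in> Inc p"
  then have I: "set I \<subseteq> {1..n}" "sorted_wrt (<) I" by (auto simp: Inc_def words_def)
  then have "{1..n} - ({1..n} - set I) = set I" by blast
  then show ?thesis using I(2) by (simp add: compl_def strict_sorted_iff sorted_list_of_set.idem_if_sorted_distinct)
qed

text \<open>A nonzero coefficient requires \<open>I @ J\<close> to be a rearrangement of the letters
  from 1 to \<open>n\<close>; as \<open>J\<close> increases, it is then the sorted list of the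
  letters missing from \<open>I\<close>.\<close>

lemma cf_omega_append:
  assumes I: "I \<in> Inc p" and J: "J \<in> Inc q"
  shows "cf (I @ J) omega = (if J = compl I then of_int (eps (I @ compl I)) else 0)"
proof -
  have I': "set I \<subseteq> {1..n}" "distinct I" and J': "sorted J" "distinct J"
    using I J by (auto simp: Inc_def words_def strict_sorted_iff)
  have "mset (I @ J) = mset [1..<Suc n] \<longleftrightarrow> J = compl I"
  proof
    assume m: "mset (I @ J) = mset [1..<Suc n]"
    then have "distinct (I @ J)" by (simp only: mset_eq_imp_distinct_iff distinct_upt)
    moreover have "set (I @ J) = {1..n}"
      using mset_eq_setD[OF m] by (simp only: set_upt atLeastLessThanSuc_atLeastAtMost)
    ultimately have "set J = {1..n} - set I" by auto
    then show "J = compl I"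
      using sorted_list_of_set.idem_if_sorted_distinct[OF J'] by (simp only: compl_def)
  next
    assume "J = compl I"
    then have "set J = {1..n} - set I" by (simp add: compl_def)
    then have "distinct (I @ J)" "set (I @ J) = set [1..<Suc n]"
      using I' J' by (auto simp: atLeastLessThanSuc_atLeastAtMost simp del: upt_Suc)
    then show "mset (I @ J) = mset [1..<Suc n]"
      by (subst set_eq_iff_mset_eq_distinct[symmetric]) simp_all
  qed
  then show ?thesis unfolding cf_omega_eps by auto
qed

lemma Inc_empty: "n < p \<Longrightarrow> Inc p = {}"
proof -
  assume "n < p"
  have False if "K \<in> Inc p" for K
  proof -
    have "length K = p" "set K \<subseteq> {1..n}" "distinct K"
      using that by (auto simp: Inc_def words_def strict_sorted_iff)
    then show False
      using card_mono[of "{1..n}" "set K"] distinct_card[of K] \<open>n < p\<close> by simp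
  qed
  then show ?thesis by blast
qed

end

subsection \<open>Tensor products and chains\<close>

text \<open>The bimodule as a vector space through the left action of scalars; by
  \<open>central\<close> the right action gives the same structure.\<close>

definition bmod :: "('k::field \<Rightarrow> 'v::ab_group_add \<Rightarrow> 'v) \<Rightarrow> (('v, 'k) symm, 'm, 'z) bimodule_scheme
    \<Rightarrow> ('k, 'm) module" where
  "bmod s M = \<lparr>carrier = carrier M, monoid.mult = undefined, one = undefined,
     ring.zero = ring.zero M, add = add M, module.smult = mscale s M\<rparr>"

lemma bmod_simps [simp]:
  "carrier (bmod s M) = carrier M" "add (bmod s M) = add M" "ring.zero (bmod s M) = ring.zero M"
  "module.smult (bmod s M) = mscale s M"
  by (simp_all add: bmod_def)

text \<open>\<open>M\<close> and \<open>bmod s M\<close> have the same additive structure but are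
  different records; the same happens with \<open>tensor\<close> and the factor group behind
  it.\<close>

lemma abelian_group_cong:
  assumes "abelian_group G" "carrier H = carrier G" "add H = add G" "ring.zero H = ring.zero G"
  shows "abelian_group H"
proof -
  interpret G: abelian_group G by fact
  show ?thesis
  proof (rule abelian_groupI)
    fix y assume "y \<in> carrier H"
    then have "y \<in> carrier G" by (simp only: assms(2))
    then have "\<ominus>\<^bsub>G\<^esub> y \<in> carrier H" "\<ominus>\<^bsub>G\<^esub> y \<oplus>\<^bsub>H\<^esub> y = \<zero>\<^bsub>H\<^esub>"
      by (simp_all only: assms(2-4) G.a_inv_closed G.l_neg)
    then show "\<exists>z\<in>carrier H. z \<oplus>\<^bsub>H\<^esub> y = \<zero>\<^bsub>H\<^esub>" by blast
  qed (simp_all only: assms(2-4) G.a_assoc G.add.m_closed G.zero_closed G.l_zero, rule G.a_comm)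
qed

context koszul
begin

lemma tmod_simps [simp]:
  "carrier (tmod\<lparr>carrier := U\<rparr>) = U" "add (tmod\<lparr>carrier := U\<rparr>) = add T"
  "ring.zero (tmod\<lparr>carrier := U\<rparr>) = ring.zero T"
  "module.smult tmod a t = a \<cdot> t"
  by (simp_all add: tmod_def)

lemma kspace_tmod:
  assumes U: "subsp U"
  shows "kspace (tmod\<lparr>carrier := U\<rparr>)"
proof -
  have in_T: "t \<in> carrier T" if "t \<in> U" for t using U that by (auto simp: subsp_def)
  have "abelian_group (tmod\<lparr>carrier := U\<rparr>)"
  proof (rule abelian_groupI)
    fix t assume "t \<in> carrier (tmod\<lparr>carrier := U\<rparr>)"
    then have t: "t \<in> U" by simp
    have "(- 1) \<cdot> t \<in> U" using U t by (auto simp: subsp_def)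
    then have "\<ominus>\<^bsub>T\<^esub> t \<in> U" using smul_neg_one[OF in_T[OF t]] by simp
    then show "\<exists>y\<in>carrier (tmod\<lparr>carrier := U\<rparr>). y \<oplus>\<^bsub>tmod\<lparr>carrier := U\<rparr>\<^esub> t = \<zero>\<^bsub>tmod\<lparr>carrier := U\<rparr>\<^esub>"
      using T.l_neg[OF in_T[OF t]] by (intro bexI[of _ "\<ominus>\<^bsub>T\<^esub> t"]) simp_all
  next
    fix t u assume "t \<in> carrier (tmod\<lparr>carrier := U\<rparr>)" "u \<in> carrier (tmod\<lparr>carrier := U\<rparr>)"
    then show "t \<oplus>\<^bsub>tmod\<lparr>carrier := U\<rparr>\<^esub> u = u \<oplus>\<^bsub>tmod\<lparr>carrier := U\<rparr>\<^esub> t"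
      using T.a_comm[OF in_T in_T, of t u] by simp
  qed (use U in \<open>simp_all add: subsp_def in_T T.a_assoc\<close>)
  then show ?thesis
  proof (intro kspace.intro kspace_axioms.intro)
    show "a \<odot>\<^bsub>tmod\<lparr>carrier := U\<rparr>\<^esub> t \<in> carrier (tmod\<lparr>carrier := U\<rparr>)"
      if "t \<in> carrier (tmod\<lparr>carrier := U\<rparr>)" for a t
      using U that by (simp add: subsp_def)
  qed (simp_all add: in_T smul_add smul_smul smul_one T.r_distr)
qed

lemma subsp_W: "subsp (W s p)"
proof -
  have "alt p (\<lambda>K. cf K (t \<oplus>\<^bsub>T\<^esub> u))" if "t \<in> W s p" "u \<in> W s p" for t u
    using alt_sum[of "{True, False}" p "\<lambda>b K. cf K (if b then t else u)" "\<lambda>_. 1"] that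
    by (simp add: cf_add W_iff)
  moreover have "alt p (\<lambda>K. cf K (a \<cdot> t))" if "t \<in> W s p" for a t
    using alt_sum[of "{True}" p "\<lambda>b K. cf K t" "\<lambda>_. a"] that by (simp add: cf_smult W_iff)
  moreover have "alt p (\<lambda>K. cf K \<zero>\<^bsub>T\<^esub>)" by (rule altI) (simp_all add: cf_zero)
  ultimately show ?thesis
    unfolding subsp_def by (auto simp: W_iff)
qed

lemma W_in_T: "t \<in> W s p \<Longrightarrow> t \<in> carrier T"
  by (simp add: W_iff)

lemma wb_W: "I \<in> Inc p \<Longrightarrow> wb I \<in> W s p"
  by (simp add: W_iff alt_wb)

lemma W_expansion:
  assumes t: "t \<in> W s p"
  shows "t = (\<Oplus>\<^bsub>T\<^esub>I\<in>Inc p. cf I t \<cdot> wb I)"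
proof (rule cf_ext)
  show "cf K t = cf K (\<Oplus>\<^bsub>T\<^esub>I\<in>Inc p. cf I t \<cdot> wb I)" for K
    using alt_expansion[of p "\<lambda>K. cf K t" K] t
    by (subst cf_finsum) (simp_all add: W_iff cf_smult)
qed (use t in \<open>auto intro!: T.finsum_closed simp: W_iff\<close>)

abbreviation Wm :: "nat \<Rightarrow> ('k, ('v, 'k) tens) module" where
  "Wm p \<equiv> tmod\<lparr>carrier := W s p\<rparr>"

lemma klin_cf: "U \<subseteq> carrier T \<Longrightarrow> kspace Y \<Longrightarrow> y \<in> carrier Y
    \<Longrightarrow> klin (tmod\<lparr>carrier := U\<rparr>) Y (\<lambda>t. cf K t \<odot>\<^bsub>Y\<^esub> y)"
  by (rule klinI)
    (auto simp: subset_iff kspace.smult_closed cf_add kspace.smult_l_distr cf_smult kspace.smult_assoc)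

lemma tmod_finsum:
  assumes U: "subsp U" and f: "\<And>i. i \<in> A \<Longrightarrow> f i \<in> U"
  shows "(\<Oplus>\<^bsub>tmod\<lparr>carrier := U\<rparr>\<^esub>i\<in>A. f i) = (\<Oplus>\<^bsub>T\<^esub>i\<in>A. f i)"
proof -
  interpret U: kspace "tmod\<lparr>carrier := U\<rparr>" by (rule kspace_tmod[OF U])
  have "additive (tmod\<lparr>carrier := U\<rparr>) T (\<lambda>t. t)"
    using U by (auto simp: additive_def subsp_def)
  from additive_finsum[OF U.abelian_group_axioms T.abelian_group_axioms this, of A f] f
  show ?thesis by simp
qed

lemma klin_W_expansion:
  fixes Y :: "('k, 'h, 'y) module_scheme" (structure)
  assumes Y: "kspace Y" and f: "klin (Wm p) Y f" and t: "t \<in> W s p"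
  shows "f t = (\<Oplus>I\<in>Inc p. cf I t \<odot> f (wb I))"
proof -
  interpret Y: kspace Y by fact
  interpret W: kspace "Wm p" by (rule kspace_tmod[OF subsp_W])
  have in_W: "cf I t \<cdot> wb I \<in> W s p" if "I \<in> Inc p" for I
    using subsp_W[of p] wb_W[OF that] by (auto simp: subsp_def)
  have "t = (\<Oplus>\<^bsub>Wm p\<^esub>I\<in>Inc p. cf I t \<cdot> wb I)"
    using W_expansion[OF t] tmod_finsum[OF subsp_W in_W, of "Inc p"] by simp
  then have "f t = f (\<Oplus>\<^bsub>Wm p\<^esub>I\<in>Inc p. cf I t \<cdot> wb I)" by simp
  also have "\<dots> = (\<Oplus>I\<in>Inc p. f (cf I t \<cdot> wb I))"
    using in_W by (intro additive_finsum W.abelian_group_axioms Y.abelian_group_axioms klin_additive[OF f]) simp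
  also have "\<dots> = (\<Oplus>I\<in>Inc p. cf I t \<odot> f (wb I))"
  proof (rule Y.finsum_cong'[OF refl])
    fix I assume "I \<in> Inc p"
    then have "wb I \<in> carrier (Wm p)" by (simp add: wb_W)
    from klin_smult[OF f this] show "f (cf I t \<cdot> wb I) = cf I t \<odot> f (wb I)" by simp
  qed (use wb_W klin_closed[OF f] in \<open>auto intro!: Y.smult_closed\<close>)
  finally show ?thesis .
qed

section \<open>The symmetric algebra as a bimodule over itself\<close>

abbreviation "A \<equiv> sym_algebra s"

lemma ideal_comm: "ideal (comm_ideal s) T"
  unfolding comm_ideal_def comm_relations_eq
  using alt_part_hom_part hom_partD(1) by (intro T.genideal_ideal) blast

sublocale C: ideal "comm_ideal s" T
  by (rule ideal_comm)

sublocale A: ring A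
  unfolding sym_algebra_def by (rule C.quotient_is_ring)

lemma sclass_hom: "sclass s \<in> ring_hom T A"
  using C.rcos_ring_hom unfolding sclass_def sym_algebra_def by simp

lemma sclass_in [simp]: "t \<in> carrier T \<Longrightarrow> sclass s t \<in> carrier A"
  using ring_hom_closed[OF sclass_hom] .

lemma carrier_A: "carrier A = sclass s ` carrier T"
  by (simp add: sym_algebra_def sclass_def FactRing_def A_RCOSETS_def' del: UN_singleton) blast

lemma tscalar_one: "tscalar s 1 = \<one>\<^bsub>T\<^esub>"
proof -
  have "\<one>\<^bsub>T\<^esub> = tclass s 1" by (simp add: tensor_algebra_def FactRing_def tclass_def)
  also have "(1 :: 'v list \<Rightarrow>\<^sub>0 'k) = single [] 1"
    using single_one[where ?'a = "'v list" and ?'b = 'k] by (simp add: zero_list_def)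
  finally show ?thesis by (simp add: tscalar_def)
qed

lemma tscalar_add: "tscalar s (a + b) = tscalar s a \<oplus>\<^bsub>T\<^esub> tscalar s b"
  and tscalar_mult: "tscalar s (a * b) = tscalar s a \<otimes>\<^bsub>T\<^esub> tscalar s b"
  by (rule cf_ext; simp add: cf_add cf_tscalar cf_smult)+

text \<open>A scalar on the right leaves only the cut at the end of the word. This is the source of
  \<open>central\<close> for \<open>self_bimodule s\<close>.\<close>

lemma tscalar_commute:
  assumes "t \<in> carrier T"
  shows "t \<otimes>\<^bsub>T\<^esub> tscalar s a = a \<cdot> t"
proof (rule cf_ext)
  fix K
  have "cf K (t \<otimes>\<^bsub>T\<^esub> tscalar s a) = (\<Sum>i\<in>{length K}. cf (take i K) t * cf (drop i K) (tscalar s a))"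
    unfolding cf_mult[OF assms tscalar_in] by (intro sum.mono_neutral_right) (auto simp: cf_tscalar)
  then show "cf K (t \<otimes>\<^bsub>T\<^esub> tscalar s a) = cf K (a \<cdot> t)"
    using assms by (simp add: cf_tscalar cf_smult mult.commute)
qed (use assms in simp_all)

lemma sym_bimodule_self: "sym_bimodule s (self_bimodule s)"
proof -
  have [simp]: "carrier (self_bimodule s) = carrier A" "add (self_bimodule s) = add A"
    "ring.zero (self_bimodule s) = ring.zero A"
    "lact (self_bimodule s) = monoid.mult A" "ract (self_bimodule s) = monoid.mult A"
    by (simp_all add: self_bimodule_def)
  have central: "sclass s (tscalar s c) \<otimes>\<^bsub>A\<^esub> m = m \<otimes>\<^bsub>A\<^esub> sclass s (tscalar s c)" if m: "m \<in> carrier A" for c m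
  proof -
    obtain t where t: "m = sclass s t" "t \<in> carrier T" using m unfolding carrier_A by blast
    show ?thesis
      using t tscalar_commute[OF t(2), of c]
      by (simp add: ring_hom_mult[OF sclass_hom, symmetric])
  qed
  have "abelian_group (self_bimodule s)"
    by (rule abelian_group_cong[OF A.abelian_group_axioms]) simp_all
  then show ?thesis
    by (intro sym_bimodule.intro sym_bimodule_axioms.intro)
      (simp_all add: A.l_distr A.r_distr A.m_assoc central)
qed

end

locale koszul_bimodule = koszul s n x + sym_bimodule s M
  for s :: "'k::field \<Rightarrow> 'v::ab_group_add \<Rightarrow> 'v" and n x
    and M :: "(('v, 'k) symm, 'm) bimodule" (structure)
begin

abbreviation "Mm \<equiv> bmod s M"
abbreviation "Ch r \<equiv> chains s M (int r)"
abbreviation "Pc r \<equiv> pure_chain s M (int r)"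
abbreviation "Co p \<equiv> cochains s M p"
abbreviation "Theta \<equiv> theta s M n x"

lemma mscale_closed: "m \<in> carrier M \<Longrightarrow> mscale s M a m \<in> carrier M"
  by (simp add: mscale_def lact_closed)

sublocale Mm: kspace Mm
proof (intro kspace.intro kspace_axioms.intro)
  show "abelian_group Mm" by (rule abelian_group_cong[OF abelian_group_axioms]) simp_all
qed (simp_all add: mscale_def lact_closed lact_add_right tscalar_add tscalar_mult tscalar_one lact_one
    ring_hom_add[OF sclass_hom] ring_hom_mult[OF sclass_hom] ring_hom_one[OF sclass_hom]
    lact_add_left lact_mult)

abbreviation "Am \<equiv> bmod s (self_bimodule s)"

lemma self_simps [simp]:
  "carrier (self_bimodule s) = carrier A" "add (self_bimodule s) = add A"
  "ring.zero (self_bimodule s) = ring.zero A"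
  "lact (self_bimodule s) = monoid.mult A" "ract (self_bimodule s) = monoid.mult A"
  by (simp_all add: self_bimodule_def)

lemma mscale_self: "mscale s (self_bimodule s) a u = sclass s (tscalar s a) \<otimes>\<^bsub>A\<^esub> u"
  by (simp add: mscale_def)

lemma klin_ract: "u \<in> carrier A \<Longrightarrow> klin Mm Mm (\<lambda>m. ract M m u)"
  by (rule klinI) (simp_all add: ract_closed ract_add_left mscale_def lact_ract)

lemma klin_ract': "m \<in> carrier M \<Longrightarrow> klin Am Mm (\<lambda>u. ract M m u)"
proof (rule klinI)
  fix a u assume m: "m \<in> carrier M" and "u \<in> carrier Am"
  then have u: "u \<in> carrier A" by simp
  \<comment> \<open>Here \<open>central\<close> carries the scalar from the right action to the left
    one, through which \<open>mscale\<close> is defined.\<close>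
  have "ract M m (sclass s (tscalar s a) \<otimes>\<^bsub>A\<^esub> u) = ract M (lact M (sclass s (tscalar s a)) m) u"
    using m u by (simp add: ract_mult central)
  then show "ract M m (a \<odot>\<^bsub>Am\<^esub> u) = a \<odot>\<^bsub>Mm\<^esub> ract M m u"
    using m u by (simp add: mscale_self mscale_def lact_ract)
qed (simp_all add: ract_closed ract_add_right)

lemma klin_lact': "m \<in> carrier M \<Longrightarrow> klin Am Mm (\<lambda>u. lact M u m)"
  by (rule klinI) (simp_all add: lact_closed lact_add_left mscale_self mscale_def lact_mult)

lemma klin_lact: "u \<in> carrier A \<Longrightarrow> klin Mm Mm (\<lambda>m. lact M u m)"
proof (rule klinI)
  fix a m assume u: "u \<in> carrier A" and "m \<in> carrier Mm"
  then have m: "m \<in> carrier M" by simp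
  have "sclass s (tscalar s a) \<otimes>\<^bsub>A\<^esub> u = u \<otimes>\<^bsub>A\<^esub> sclass s (tscalar s a)"
    using sym_bimodule.central[OF sym_bimodule_self, of u a] u by simp
  then show "lact M u (a \<odot>\<^bsub>Mm\<^esub> m) = a \<odot>\<^bsub>Mm\<^esub> lact M u m"
    using m u by (simp add: mscale_def lact_mult[symmetric])
qed (simp_all add: lact_closed lact_add_right)

section \<open>The universal property of the tensor product\<close>

definition lift :: "('k, 'h, 'y) module_scheme \<Rightarrow> ('m \<Rightarrow> ('v, 'k) tens \<Rightarrow> 'h)
    \<Rightarrow> ('m \<times> ('v, 'k) tens \<Rightarrow>\<^sub>0 'k) \<Rightarrow> 'h" where
  "lift Y b f = (\<Oplus>\<^bsub>Y\<^esub>k\<in>keys f. lookup f k \<odot>\<^bsub>Y\<^esub> b (fst k) (snd k))"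

text \<open>An element of the tensor product is a coset. For a bilinear \<open>b\<close> the choice
  of a representative does not matter, by \<open>tlift_tc\<close>.\<close>

definition tlift :: "('k, 'h, 'y) module_scheme \<Rightarrow> ('m \<Rightarrow> ('v, 'k) tens \<Rightarrow> 'h)
    \<Rightarrow> ('m \<times> ('v, 'k) tens \<Rightarrow>\<^sub>0 'k) set \<Rightarrow> 'h" where
  "tlift Y b z = lift Y b (SOME f. f \<in> z)"

context
  fixes U :: "('v, 'k) tens set"
  assumes U: "subsp U"
begin

abbreviation "Um \<equiv> tmod\<lparr>carrier := U\<rparr>"
abbreviation "F \<equiv> free_space (carrier M \<times> U) :: ('m \<times> ('v, 'k) tens \<Rightarrow>\<^sub>0 'k) ring"
abbreviation "B \<equiv> bilinearity_subspace s M U"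

interpretation Um: kspace Um by (rule kspace_tmod[OF U])

lemma F_simps [simp]:
  "f \<in> carrier F \<longleftrightarrow> keys f \<subseteq> carrier M \<times> U" "f \<oplus>\<^bsub>F\<^esub> g = f + g" "\<zero>\<^bsub>F\<^esub> = 0"
  by (simp_all add: free_space_def)

lemma abelian_group_F: "abelian_group F"
proof (rule abelian_groupI)
  fix f g assume f: "f \<in> carrier F" and g: "g \<in> carrier F"
  then show "f \<oplus>\<^bsub>F\<^esub> g \<in> carrier F" using keys_add[of f g] by auto
  show "f \<oplus>\<^bsub>F\<^esub> g = g \<oplus>\<^bsub>F\<^esub> f" by (simp add: add.commute)
  have "keys (- f) = keys f" by (auto simp: in_keys_iff)
  then show "\<exists>g\<in>carrier F. g \<oplus>\<^bsub>F\<^esub> f = \<zero>\<^bsub>F\<^esub>"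
    using f by (intro bexI[of _ "- f"]) simp_all
qed (simp_all add: add.assoc)

interpretation F: abelian_group F by (rule abelian_group_F)

lemma F_neg: "f \<in> carrier F \<Longrightarrow> \<ominus>\<^bsub>F\<^esub> f = - f"
proof -
  assume f: "f \<in> carrier F"
  have "keys (- f) = keys f" by (auto simp: in_keys_iff)
  then have "- f \<in> carrier F" using f by simp
  with f show ?thesis by (intro F.minus_equality) simp_all
qed

lemma F_diff: "f \<in> carrier F \<Longrightarrow> g \<in> carrier F \<Longrightarrow> f - g \<in> carrier F"
  using F.minus_closed[of f g] F_neg[of g] by (simp add: a_minus_def)

lemma F_single: "m \<in> carrier M \<Longrightarrow> t \<in> U \<Longrightarrow> single (m, t) a \<in> carrier F"
  by simp

lemma U_closed: "t \<in> U \<Longrightarrow> u \<in> U \<Longrightarrow> t \<oplus>\<^bsub>T\<^esub> u \<in> U" "t \<in> U \<Longrightarrow> a \<cdot> t \<in> U" "t \<in> U \<Longrightarrow> t \<in> carrier T"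
  using U by (auto simp: subsp_def)

lemma relations_in_F: "bilinearity_relations s M U \<subseteq> carrier F"
  unfolding bilinearity_relations_def
proof (intro Un_least subsetI; elim CollectE exE conjE; hypsubst)
  fix m m' t a assume *: "m \<in> carrier M" "m' \<in> carrier M" "t \<in> U"
  show "single (m \<oplus> m', t) a - single (m, t) a - single (m', t) a \<in> carrier F"
    by (intro F_diff F_single a_closed *)
next
  fix m t t' a assume *: "m \<in> carrier M" "t \<in> U" "t' \<in> U"
  show "single (m, t \<oplus>\<^bsub>T\<^esub> t') a - single (m, t) a - single (m, t') a \<in> carrier F"
    by (intro F_diff F_single U_closed(1) *)
next
  fix m t a c assume *: "m \<in> carrier M" "t \<in> U"
  show "single (mscale s M c m, t) a - single (m, t) (a * c) \<in> carrier F"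
    by (intro F_diff F_single mscale_closed *)
next
  fix m t a c assume *: "m \<in> carrier M" "t \<in> U"
  show "single (m, c \<cdot> t) a - single (m, t) (a * c) \<in> carrier F"
    by (intro F_diff F_single U_closed(2) *)
qed

lemma subgroup_B: "subgroup B (add_monoid F)"
  unfolding bilinearity_subspace_def
  using F.add.generate_is_subgroup[of "bilinearity_relations s M U"] relations_in_F by simp

interpretation B: abelian_subgroup B F
  by (rule abelian_subgroupI2[OF F.a_comm_group subgroup_B])

abbreviation "TU \<equiv> tensor s M U"
abbreviation "PT \<equiv> pure_tensor s M U"

lemma tensor_simps [simp]:
  "carrier TU = a_rcosets\<^bsub>F\<^esub> B" "add TU = set_add F" "ring.zero TU = B"
  by (simp_all add: tensor_def)

lemma abelian_group_tensor: "abelian_group TU"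
proof (rule abelian_group_cong)
  let ?G = "\<lparr>carrier = a_rcosets\<^bsub>F\<^esub> B, monoid.mult = undefined, one = undefined, ring.zero = B, add = set_add F\<rparr>"
  show "abelian_group ?G"
    by (rule comm_group_abelian_groupI)
      (simp add: B.a_factorgroup_is_comm_group[unfolded A_FactGroup_def'])
qed simp_all

definition tc :: "('m \<times> ('v, 'k) tens \<Rightarrow>\<^sub>0 'k) \<Rightarrow> ('m \<times> ('v, 'k) tens \<Rightarrow>\<^sub>0 'k) set" where
  "tc f = B +>\<^bsub>F\<^esub> f"

lemma carrier_tensor: "carrier TU = tc ` carrier F"
  unfolding tensor_simps tc_def A_RCOSETS_def' by blast

lemma tc_add: "f \<in> carrier F \<Longrightarrow> g \<in> carrier F \<Longrightarrow> tc (f + g) = tc f \<oplus>\<^bsub>TU\<^esub> tc g"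
  using B.a_rcos_sum[of f g] by (simp add: tc_def)

lemma tc_eqI:
  assumes "f \<in> carrier F" "g \<in> carrier F" "f - g \<in> B"
  shows "tc f = tc g"
proof -
  have "f \<oplus>\<^bsub>F\<^esub> \<ominus>\<^bsub>F\<^esub> g \<in> B" using assms by (simp add: F_neg)
  then have "f \<in> B +>\<^bsub>F\<^esub> g" using assms by (intro B.a_rcos_module_rev)
  then show ?thesis using assms(2) unfolding tc_def by (intro B.a_repr_independence'[symmetric])
qed

lemma mem_tc: "f \<in> carrier F \<Longrightarrow> f \<in> tc f"
  unfolding tc_def by (rule B.a_rcos_self)

lemma mem_tcD:
  assumes "g \<in> tc f" "f \<in> carrier F"
  obtains h where "h \<in> B" "g = h + f" "g \<in> carrier F"
proof -
  obtain h where "h \<in> B" "g = h + f"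
    using assms by (auto simp: tc_def a_r_coset_def r_coset_def)
  moreover have "g \<in> carrier F"
    by (rule B.a_elemrcos_carrier[OF assms(2) assms(1)[unfolded tc_def]])
  ultimately show ?thesis using that by blast
qed

abbreviation pscale :: "'k \<Rightarrow> ('m \<times> ('v, 'k) tens \<Rightarrow>\<^sub>0 'k) \<Rightarrow> ('m \<times> ('v, 'k) tens \<Rightarrow>\<^sub>0 'k)" where
  "pscale a \<equiv> Poly_Mapping.map ((*) a)"

lemma lookup_pscale: "lookup (pscale a f) k = a * lookup f k"
  by (auto simp: map.rep_eq when_def)

lemma pscale_add: "pscale a (f + g) = pscale a f + pscale a g"
  and pscale_diff: "pscale a (f - g) = pscale a f - pscale a g"
  and pscale_minus: "pscale a (- f) = - pscale a f"
  and pscale_zero: "pscale a 0 = 0"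
  and pscale_left: "pscale (a + b) f = pscale a f + pscale b f"
  and pscale_pscale: "pscale a (pscale b f) = pscale (a * b) f"
  and pscale_one: "pscale 1 f = f"
  by (rule poly_mapping_eqI; simp add: lookup_pscale lookup_add lookup_minus algebra_simps)+

lemma pscale_single: "pscale a (single k c) = single k (a * c)"
  by simp

lemma pscale_F: "f \<in> carrier F \<Longrightarrow> pscale a f \<in> carrier F"
  by (auto simp: in_keys_iff lookup_pscale)

text \<open>\<open>B\<close> is generated by the relations as a group only. It is a subspace because
  the coefficient \<open>a\<close> in each family of relations is arbitrary, so that the families
  are closed under scalars.\<close>

lemma pscale_B:
  assumes "f \<in> B"
  shows "pscale a f \<in> B"
proof -
  have rel: "pscale a f \<in> bilinearity_relations s M U" if "f \<in> bilinearity_relations s M U" for f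
    using that unfolding bilinearity_relations_def
    by (elim UnE CollectE exE conjE; simp only: pscale_diff pscale_single mult.assoc[symmetric]; blast)
  show ?thesis
    using assms unfolding bilinearity_subspace_def
  proof (induction rule: generate.induct)
    case one
    have e: "\<one>\<^bsub>add_monoid F\<^esub> = 0" by simp
    show ?case
      using generate.one[of "add_monoid F" "bilinearity_relations s M U"] unfolding e pscale_zero .
  next
    case (incl f)
    then show ?case by (intro generate.incl rel)
  next
    case (inv f)
    have "f \<in> carrier F" "pscale a f \<in> carrier F" using inv relations_in_F rel by blast+
    note neg = F_neg[OF this(1), unfolded a_inv_def] F_neg[OF this(2), unfolded a_inv_def]
    show ?case
      using generate.inv[OF rel[OF inv], of "add_monoid F"] unfolding neg pscale_minus .
  next
    case (eng f g)
    have e: "u \<otimes>\<^bsub>add_monoid F\<^esub> v = u + v" for u v by simp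
    show ?case using generate.eng[OF eng.IH] unfolding e pscale_add .
  qed
qed

text \<open>The scalar multiple of a coset is defined as a union over all its representatives; by
  \<open>pscale_B\<close> they all contribute the same coset.\<close>

lemma smult_tc:
  assumes f: "f \<in> carrier F"
  shows "a \<odot>\<^bsub>TU\<^esub> tc f = tc (pscale a f)"
proof -
  have "a \<odot>\<^bsub>TU\<^esub> tc f = (\<Union>g\<in>tc f. tc (pscale a g))"
    by (simp add: tensor_def tc_def)
  also have "\<dots> = (\<Union>g\<in>tc f. tc (pscale a f))"
  proof (intro SUP_cong refl)
    fix g assume "g \<in> tc f"
    then obtain h where h: "h \<in> B" "g = h + f" "g \<in> carrier F" by (rule mem_tcD[OF _ f])
    then show "tc (pscale a g) = tc (pscale a f)"
      using pscale_F[OF h(3), of a] pscale_F[OF f, of a] pscale_B[OF h(1), of a]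
      by (intro tc_eqI) (simp_all only: h(2) pscale_add add_diff_cancel_right')
  qed
  also have "\<dots> = tc (pscale a f)" using mem_tc[OF f] by auto
  finally show ?thesis .
qed

lemma kspace_tensor: "kspace TU"
proof (intro kspace.intro kspace_axioms.intro abelian_group_tensor)
  fix z a b assume "z \<in> carrier TU"
  then obtain f where f: "z = tc f" "f \<in> carrier F" unfolding carrier_tensor by blast
  show "a \<odot>\<^bsub>TU\<^esub> z \<in> carrier TU"
    unfolding carrier_tensor f(1) smult_tc[OF f(2)] using pscale_F[OF f(2)] by blast
  show "(a + b) \<odot>\<^bsub>TU\<^esub> z = a \<odot>\<^bsub>TU\<^esub> z \<oplus>\<^bsub>TU\<^esub> b \<odot>\<^bsub>TU\<^esub> z"
    unfolding f(1) smult_tc[OF f(2)] pscale_left by (intro tc_add pscale_F f(2))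
  show "(a * b) \<odot>\<^bsub>TU\<^esub> z = a \<odot>\<^bsub>TU\<^esub> (b \<odot>\<^bsub>TU\<^esub> z)"
    unfolding f(1) smult_tc[OF f(2)] smult_tc[OF pscale_F[OF f(2)]] pscale_pscale ..
  show "1 \<odot>\<^bsub>TU\<^esub> z = z"
    unfolding f(1) smult_tc[OF f(2)] pscale_one ..
next
  fix z y a assume "z \<in> carrier TU" "y \<in> carrier TU"
  then obtain f g where f: "z = tc f" "f \<in> carrier F" and g: "y = tc g" "g \<in> carrier F"
    unfolding carrier_tensor by blast
  have fg: "f + g \<in> carrier F" using F.a_closed[OF f(2) g(2)] by simp
  show "a \<odot>\<^bsub>TU\<^esub> (z \<oplus>\<^bsub>TU\<^esub> y) = a \<odot>\<^bsub>TU\<^esub> z \<oplus>\<^bsub>TU\<^esub> a \<odot>\<^bsub>TU\<^esub> y"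
    unfolding f(1) g(1) tc_add[OF f(2) g(2), symmetric] smult_tc[OF fg] smult_tc[OF f(2)]
      smult_tc[OF g(2)] pscale_add
    by (intro tc_add pscale_F f(2) g(2))
qed

interpretation TU: kspace TU by (rule kspace_tensor)

lemma pure_tensor_tc: "PT m t = tc (single (m, t) 1)"
  by (simp add: pure_tensor_def tc_def)

lemma pure_tensor_closed: "m \<in> carrier M \<Longrightarrow> t \<in> U \<Longrightarrow> PT m t \<in> carrier TU"
  unfolding carrier_tensor pure_tensor_tc by (intro imageI F_single)

lemma rel_B: "f \<in> bilinearity_relations s M U \<Longrightarrow> f \<in> B"
  unfolding bilinearity_subspace_def by (rule generate.incl)

lemma smult_pure_tensor:
  "m \<in> carrier M \<Longrightarrow> t \<in> U \<Longrightarrow> a \<odot>\<^bsub>TU\<^esub> PT m t = tc (single (m, t) a)"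
  unfolding pure_tensor_tc by (subst smult_tc) simp_all

lemma kbil_pure_tensor: "kbil Mm Um TU PT"
proof (rule kbilI; rule klinI)
  fix m t u assume "m \<in> carrier Mm" "t \<in> carrier Um" "u \<in> carrier Um"
  then have m: "m \<in> carrier M" and t: "t \<in> U" and u: "u \<in> U" by simp_all
  have "single (m, t \<oplus>\<^bsub>T\<^esub> u) 1
      - (single (m, t) 1 + single (m, u) 1) \<in> B"
    unfolding diff_diff_eq[symmetric] using m t u
    by (intro rel_B) (auto simp: bilinearity_relations_def)
  then have "tc (single (m, t \<oplus>\<^bsub>T\<^esub> u) 1)
      = tc (single (m, t) 1 + single (m, u) 1)"
    using F.a_closed[OF F_single[OF m t] F_single[OF m u]]
    by (intro tc_eqI F_single m U_closed t u) simp
  then show "PT m (t \<oplus>\<^bsub>Um\<^esub> u) = PT m t \<oplus>\<^bsub>TU\<^esub> PT m u"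
    unfolding pure_tensor_tc tc_add[OF F_single[OF m t] F_single[OF m u], symmetric] by simp
next
  fix m m' t assume "m \<in> carrier Mm" "m' \<in> carrier Mm" "t \<in> carrier Um"
  then have m: "m \<in> carrier M" and m': "m' \<in> carrier M" and t: "t \<in> U" by simp_all
  have "single (m \<oplus> m', t) 1
      - (single (m, t) 1 + single (m', t) 1) \<in> B"
    unfolding diff_diff_eq[symmetric] using m t m'
    by (intro rel_B) (auto simp: bilinearity_relations_def)
  then have "tc (single (m \<oplus> m', t) 1)
      = tc (single (m, t) 1 + single (m', t) 1)"
    using F.a_closed[OF F_single[OF m t] F_single[OF m' t]]
    by (intro tc_eqI F_single m m' a_closed t) simp
  then show "PT (m \<oplus>\<^bsub>Mm\<^esub> m') t = PT m t \<oplus>\<^bsub>TU\<^esub> PT m' t"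
    unfolding pure_tensor_tc tc_add[OF F_single[OF m t] F_single[OF m' t], symmetric] by simp
next
  fix a m t assume "m \<in> carrier Mm" "t \<in> carrier Um"
  then have m: "m \<in> carrier M" and t: "t \<in> U" by simp_all
  have "single (m, a \<cdot> t) 1 - single (m, t) (1 * a) \<in> B"
    using m t by (intro rel_B) (unfold bilinearity_relations_def, blast)
  then show "PT m (a \<odot>\<^bsub>Um\<^esub> t) = a \<odot>\<^bsub>TU\<^esub> PT m t"
    unfolding smult_pure_tensor[OF m t] unfolding pure_tensor_tc using m t
    by (intro tc_eqI) (simp_all add: U_closed)
next
  fix a m t assume "m \<in> carrier Mm" "t \<in> carrier Um"
  then have m: "m \<in> carrier M" and t: "t \<in> U" by simp_all
  have "single (mscale s M a m, t) 1 - single (m, t) (1 * a) \<in> B"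
    using m t by (intro rel_B) (unfold bilinearity_relations_def, blast)
  then show "PT (a \<odot>\<^bsub>Mm\<^esub> m) t = a \<odot>\<^bsub>TU\<^esub> PT m t"
    unfolding smult_pure_tensor[OF m t] unfolding pure_tensor_tc using m t
    by (intro tc_eqI) (simp_all add: mscale_closed)
qed (simp_all add: pure_tensor_closed del: tensor_simps)

lemma tensor_expansion:
  assumes "z \<in> carrier TU"
  obtains S c where "finite S" "S \<subseteq> carrier M \<times> U"
    "z = (\<Oplus>\<^bsub>TU\<^esub>k\<in>S. c k \<odot>\<^bsub>TU\<^esub> PT (fst k) (snd k))"
proof -
  obtain f where f: "z = tc f" "f \<in> carrier F" using assms unfolding carrier_tensor by blast
  have tc0: "tc 0 = \<zero>\<^bsub>TU\<^esub>"
    using B.a_rcos_const[of 0] B.zero_closed by (simp add: tc_def)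
  have "tc (\<Sum>k\<in>S. single k (c k))
      = (\<Oplus>\<^bsub>TU\<^esub>k\<in>S. c k \<odot>\<^bsub>TU\<^esub> PT (fst k) (snd k))
    \<and> (\<Sum>k\<in>S. single k (c k)) \<in> carrier F"
    if "finite S" "S \<subseteq> carrier M \<times> U" for S c
    using that
  proof (induction S rule: finite_induct)
    case empty
    show ?case by (simp add: tc0 TU.finsum_empty del: tensor_simps)
  next
    case (insert k S)
    obtain m t where k: "k = (m, t)" "m \<in> carrier M" "t \<in> U" using insert by auto
    have fin: "c k' \<odot>\<^bsub>TU\<^esub> PT (fst k') (snd k') \<in> carrier TU" if "k' \<in> insert k S" for k'
      using that insert.prems by (intro TU.smult_closed pure_tensor_closed) auto
    have 1: "single k (c k) \<in> carrier F" using k by simp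
    have 2: "(\<Sum>k\<in>S. single k (c k)) \<in> carrier F" using insert by simp
    have "(\<Oplus>\<^bsub>TU\<^esub>k\<in>insert k S. c k \<odot>\<^bsub>TU\<^esub> PT (fst k) (snd k))
        = tc (single k (c k)) \<oplus>\<^bsub>TU\<^esub> tc (\<Sum>k\<in>S. single k (c k))"
    proof -
      have "c k \<odot>\<^bsub>TU\<^esub> PT (fst k) (snd k) = tc (single k (c k))"
        unfolding k(1) fst_conv snd_conv by (rule smult_pure_tensor[OF k(2,3)])
      moreover have "tc (\<Sum>k\<in>S. single k (c k))
          = (\<Oplus>\<^bsub>TU\<^esub>k\<in>S. c k \<odot>\<^bsub>TU\<^esub> PT (fst k) (snd k))"
        using insert by simp
      moreover have "(\<Oplus>\<^bsub>TU\<^esub>k\<in>insert k S. c k \<odot>\<^bsub>TU\<^esub> PT (fst k) (snd k))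
          = c k \<odot>\<^bsub>TU\<^esub> PT (fst k) (snd k)
            \<oplus>\<^bsub>TU\<^esub> (\<Oplus>\<^bsub>TU\<^esub>k\<in>S. c k \<odot>\<^bsub>TU\<^esub> PT (fst k) (snd k))"
        by (rule TU.finsum_insert[OF insert.hyps]) (use fin in blast)+
      ultimately show ?thesis by (simp only:)
    qed
    then show ?case
      using insert.hyps tc_add[OF 1 2] F.a_closed[OF 1 2] by simp
  qed
  note sum = this
  have S: "keys f \<subseteq> carrier M \<times> U" using f(2) by simp
  from sum[OF finite_keys S, of "lookup f"]
  have "z = (\<Oplus>\<^bsub>TU\<^esub>k\<in>keys f. lookup f k \<odot>\<^bsub>TU\<^esub> PT (fst k) (snd k))"
    unfolding f(1) poly_mapping_sum_single[of f, symmetric] by (rule conjunct1)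
  with S show ?thesis by (intro that[OF finite_keys])
qed

lemma tensor_klin_eq:
  assumes Y: "kspace Y" and f: "klin TU Y f" and g: "klin TU Y g"
    and eq: "\<And>m t. m \<in> carrier M \<Longrightarrow> t \<in> U \<Longrightarrow> f (PT m t) = g (PT m t)"
    and z: "z \<in> carrier TU"
  shows "f z = g z"
proof -
  interpret Y: kspace Y by fact
  obtain S c where S: "finite S" "S \<subseteq> carrier M \<times> U"
    and z: "z = (\<Oplus>\<^bsub>TU\<^esub>k\<in>S. c k \<odot>\<^bsub>TU\<^esub> PT (fst k) (snd k))"
    using z by (rule tensor_expansion)
  have p: "PT (fst k) (snd k) \<in> carrier TU" if "k \<in> S" for k
    using S that by (intro pure_tensor_closed) auto
  have h: "h z = (\<Oplus>\<^bsub>Y\<^esub>k\<in>S. c k \<odot>\<^bsub>Y\<^esub> h (PT (fst k) (snd k)))" if h: "klin TU Y h" for h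
  proof -
    have "h z = (\<Oplus>\<^bsub>Y\<^esub>k\<in>S. h (c k \<odot>\<^bsub>TU\<^esub> PT (fst k) (snd k)))"
      unfolding z using p
      by (intro additive_finsum TU.abelian_group_axioms Y.abelian_group_axioms klin_additive[OF h] TU.smult_closed)
    also have "\<dots> = (\<Oplus>\<^bsub>Y\<^esub>k\<in>S. c k \<odot>\<^bsub>Y\<^esub> h (PT (fst k) (snd k)))"
      by (intro Y.finsum_cong' refl Pi_I Y.smult_closed klin_closed[OF h] klin_smult[OF h] p)
    finally show ?thesis .
  qed
  have fg: "f (PT (fst k) (snd k)) = g (PT (fst k) (snd k))" if "k \<in> S" for k
    using S that by (intro eq) auto
  show ?thesis
    unfolding h[OF f] h[OF g]
    by (intro Y.finsum_cong' refl Pi_I Y.smult_closed klin_closed[OF g] p) (simp_all only: fg)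
qed

context
  fixes Y :: "('k, 'h, 'y) module_scheme" and b
  assumes Y: "kspace Y" and b: "kbil Mm Um Y b"
begin

interpretation Y: kspace Y by (rule Y)

lemma b_closed: "k \<in> carrier M \<times> U \<Longrightarrow> b (fst k) (snd k) \<in> carrier Y"
  using kbil_closed[OF b] by auto

lemma lift_superset:
  assumes "finite S" "keys f \<subseteq> S" "S \<subseteq> carrier M \<times> U"
  shows "lift Y b f = (\<Oplus>\<^bsub>Y\<^esub>k\<in>S. lookup f k \<odot>\<^bsub>Y\<^esub> b (fst k) (snd k))"
  unfolding lift_def
proof (rule Y.add.finprod_mono_neutral_cong_left[OF assms(1,2) _ refl])
  show "lookup f k \<odot>\<^bsub>Y\<^esub> b (fst k) (snd k) = \<zero>\<^bsub>Y\<^esub>"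
    if "k \<in> S - keys f" for k
    using that assms(3) b_closed[of k] by (simp add: in_keys_iff subsetD Y.smult_zero)
qed (use assms(3) b_closed in \<open>blast intro: Y.smult_closed\<close>)

lemma lift_closed: "f \<in> carrier F \<Longrightarrow> lift Y b f \<in> carrier Y"
  unfolding lift_def using b_closed by (intro Y.finsum_closed Pi_I Y.smult_closed) auto

lemma lift_add:
  assumes f: "f \<in> carrier F" and g: "g \<in> carrier F"
  shows "lift Y b (f + g) = lift Y b f \<oplus>\<^bsub>Y\<^esub> lift Y b g"
proof -
  let ?S = "keys f \<union> keys g"
  have S: "finite ?S" "?S \<subseteq> carrier M \<times> U" using f g by auto
  have bc: "b (fst k) (snd k) \<in> carrier Y" if "k \<in> ?S" for k using S(2) that b_closed by blast
  have "lift Y b (f + g) = (\<Oplus>\<^bsub>Y\<^esub>k\<in>?S. lookup (f + g) k \<odot>\<^bsub>Y\<^esub> b (fst k) (snd k))"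
    using S keys_add[of f g] by (intro lift_superset)
  also have "\<dots> = (\<Oplus>\<^bsub>Y\<^esub>k\<in>?S. lookup f k \<odot>\<^bsub>Y\<^esub> b (fst k) (snd k)
      \<oplus>\<^bsub>Y\<^esub> lookup g k \<odot>\<^bsub>Y\<^esub> b (fst k) (snd k))"
    by (intro Y.finsum_cong' refl Pi_I Y.a_closed Y.smult_closed bc)
      (simp_all only: lookup_add Y.smult_l_distr bc)
  also have "\<dots> = (\<Oplus>\<^bsub>Y\<^esub>k\<in>?S. lookup f k \<odot>\<^bsub>Y\<^esub> b (fst k) (snd k))
      \<oplus>\<^bsub>Y\<^esub> (\<Oplus>\<^bsub>Y\<^esub>k\<in>?S. lookup g k \<odot>\<^bsub>Y\<^esub> b (fst k) (snd k))"
    by (intro Y.finsum_addf Pi_I Y.smult_closed bc)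
  also have "\<dots> = lift Y b f \<oplus>\<^bsub>Y\<^esub> lift Y b g"
    using lift_superset[OF S(1) _ S(2), of f] lift_superset[OF S(1) _ S(2), of g] by simp
  finally show ?thesis .
qed

lemma lift_single: "m \<in> carrier M \<Longrightarrow> t \<in> U \<Longrightarrow> lift Y b (single (m, t) a) = a \<odot>\<^bsub>Y\<^esub> b m t"
  using lift_superset[of "{(m, t)}" "single (m, t) a"] b_closed[of "(m, t)"]
  by (simp add: Y.finsum_insert Y.smult_closed)

lemma lift_zero: "lift Y b 0 = \<zero>\<^bsub>Y\<^esub>"
  by (simp add: lift_def Y.finsum_empty)

lemma additive_lift: "additive F Y (lift Y b)"
  using lift_closed lift_add by (auto simp: additive_def simp del: F_simps(1))

lemma lift_diff:
  assumes "f \<in> carrier F" "g \<in> carrier F"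
  shows "lift Y b (f - g) = lift Y b f \<ominus>\<^bsub>Y\<^esub> lift Y b g"
proof -
  have "\<ominus>\<^bsub>F\<^esub> g \<in> carrier F" by (rule F.a_inv_closed[OF assms(2)])
  then show ?thesis
    using lift_add[OF assms(1), of "- g"] additive_neg[OF F.abelian_group_axioms Y.abelian_group_axioms additive_lift assms(2)]
    by (simp only: F_neg[OF assms(2)] a_minus_def diff_conv_add_uminus)
qed

lemma lift_pscale: "f \<in> carrier F \<Longrightarrow> lift Y b (pscale a f) = a \<odot>\<^bsub>Y\<^esub> lift Y b f"
proof -
  assume f: "f \<in> carrier F"
  then have k: "keys f \<subseteq> carrier M \<times> U" by simp
  have bc: "b (fst k) (snd k) \<in> carrier Y" if "k \<in> keys f" for k using k that b_closed by blast
  have "keys (pscale a f) \<subseteq> keys f" by (auto simp: in_keys_iff lookup_pscale)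
  then have "lift Y b (pscale a f)
      = (\<Oplus>\<^bsub>Y\<^esub>k\<in>keys f. lookup (pscale a f) k \<odot>\<^bsub>Y\<^esub> b (fst k) (snd k))"
    using k by (intro lift_superset) simp_all
  also have "\<dots> = (\<Oplus>\<^bsub>Y\<^esub>k\<in>keys f. a \<odot>\<^bsub>Y\<^esub> (lookup f k \<odot>\<^bsub>Y\<^esub> b (fst k) (snd k)))"
    by (intro Y.finsum_cong' refl Pi_I Y.smult_closed bc) (simp_all only: lookup_pscale Y.smult_assoc bc)
  also have "\<dots> = a \<odot>\<^bsub>Y\<^esub> lift Y b f"
    unfolding lift_def by (intro Y.smult_finsum[symmetric] Y.smult_closed bc)
  finally show ?thesis .
qed

text \<open>Bilinearity of \<open>b\<close> annihilates each of the four families of relations, and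
  additivity extends this to the group that they generate. This makes \<open>tlift\<close> well
  defined.\<close>

lemma lift_B:
  assumes "f \<in> B"
  shows "lift Y b f = \<zero>\<^bsub>Y\<^esub>"
proof -
  have U_b: "t \<in> U \<Longrightarrow> klin Mm Y (\<lambda>m. b m t)" and M_b: "m \<in> carrier M \<Longrightarrow> klin Um Y (b m)" for m t
    using kbil_left[OF b] kbil_right[OF b] by simp_all
  have bc: "m \<in> carrier M \<Longrightarrow> t \<in> U \<Longrightarrow> b m t \<in> carrier Y" for m t
    using b_closed[of "(m, t)"] by simp
  \<comment> \<open>The common form of the two families of relations that express
    additivity.\<close>
  have rel2: "lift Y b w = lift Y b u \<oplus>\<^bsub>Y\<^esub> lift Y b v \<Longrightarrow> lift Y b (w - (u + v)) = \<zero>\<^bsub>Y\<^esub>"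
    if w: "w \<in> carrier F" and u: "u \<in> carrier F" and v: "v \<in> carrier F" for u v w
  proof -
    assume "lift Y b w = lift Y b u \<oplus>\<^bsub>Y\<^esub> lift Y b v"
    moreover have "u + v \<in> carrier F" using F.a_closed[OF u v] by simp
    ultimately show ?thesis
      using lift_diff[OF w, of "u + v"] lift_add[OF u v] lift_closed[OF w]
      by (simp only: a_minus_def Y.r_neg)
  qed
  have rel: "lift Y b f = \<zero>\<^bsub>Y\<^esub>" if "f \<in> bilinearity_relations s M U" for f
    using that unfolding bilinearity_relations_def
  proof (elim UnE CollectE exE conjE)
    fix m m' t a
    assume f: "f = single (m \<oplus> m', t) a - single (m, t) a - single (m', t) a"
      and m: "m \<in> carrier M" and m': "m' \<in> carrier M" and t: "t \<in> U"
    have "b (m \<oplus> m') t = b m t \<oplus>\<^bsub>Y\<^esub> b m' t"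
      using klin_add[OF U_b[OF t], of m m'] m m' by simp
    then show ?thesis
      unfolding f diff_diff_eq using rel2[OF F_single[OF a_closed[OF m m'] t] F_single[OF m t] F_single[OF m' t], of a a a]
        m m' t bc[OF m t] bc[OF m' t]
      by (simp add: lift_single Y.smult_r_distr)
  next
    fix m t t' a
    assume f: "f = single (m, t \<oplus>\<^bsub>T\<^esub> t') a - single (m, t) a - single (m, t') a"
      and m: "m \<in> carrier M" and t: "t \<in> U" and t': "t' \<in> U"
    have "b m (t \<oplus>\<^bsub>T\<^esub> t') = b m t \<oplus>\<^bsub>Y\<^esub> b m t'"
      using klin_add[OF M_b[OF m], of t t'] t t' by simp
    then show ?thesis
      unfolding f diff_diff_eq using rel2[OF F_single[OF m U_closed(1)[OF t t']] F_single[OF m t] F_single[OF m t'], of a a a]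
        m t' t bc[OF m t] bc[OF m t'] U_closed(1)[OF t t']
      by (simp add: lift_single Y.smult_r_distr)
  next
    fix m t a c
    assume f: "f = single (mscale s M c m, t) a - single (m, t) (a * c)"
      and m: "m \<in> carrier M" and t: "t \<in> U"
    have "b (mscale s M c m) t = c \<odot>\<^bsub>Y\<^esub> b m t"
      using klin_smult[OF U_b[OF t], of m c] m by simp
    then show ?thesis
      unfolding f using m t bc[OF m t] mscale_closed[OF m, of c]
      by (subst lift_diff) (simp_all add: lift_single Y.smult_assoc Y.smult_closed Y.r_neg a_minus_def)
  next
    fix m t a c
    assume f: "f = single (m, c \<cdot> t) a - single (m, t) (a * c)"
      and m: "m \<in> carrier M" and t: "t \<in> U"
    have "b m (c \<cdot> t) = c \<odot>\<^bsub>Y\<^esub> b m t"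
      using klin_smult[OF M_b[OF m], of t c] t by simp
    then show ?thesis
      unfolding f using m t bc[OF m t] U_closed(2)[OF t, of c]
      by (subst lift_diff) (simp_all add: lift_single Y.smult_assoc Y.smult_closed Y.r_neg a_minus_def)
  qed
  \<comment> \<open>Membership in the carrier is part of the induction, because \<open>lift\<close>
    is additive only there.\<close>
  have "f \<in> carrier F \<and> lift Y b f = \<zero>\<^bsub>Y\<^esub>"
    using assms unfolding bilinearity_subspace_def
  proof (induction rule: generate.induct)
    case one
    show ?case by (simp add: lift_zero)
  next
    case (incl f)
    then show ?case using rel relations_in_F by blast
  next
    case (inv f)
    then have f: "f \<in> carrier F" "lift Y b f = \<zero>\<^bsub>Y\<^esub>" using rel relations_in_F by blast+
    have "lift Y b (\<ominus>\<^bsub>F\<^esub> f) = \<zero>\<^bsub>Y\<^esub>"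
      using additive_neg[OF F.abelian_group_axioms Y.abelian_group_axioms additive_lift f(1)] f(2) by simp
    then show ?case using F.a_inv_closed[OF f(1)] unfolding a_inv_def by blast
  next
    case (eng f g)
    have "f \<oplus>\<^bsub>F\<^esub> g \<in> carrier F" "lift Y b (f \<oplus>\<^bsub>F\<^esub> g) = \<zero>\<^bsub>Y\<^esub>"
      using F.a_closed[of f g] lift_add[of f g] eng.IH by (simp_all del: F_simps(1))
    then show ?case by simp
  qed
  then show ?thesis by blast
qed

lemma tlift_tc:
  assumes f: "f \<in> carrier F"
  shows "tlift Y b (tc f) = lift Y b f"
proof -
  have "(SOME g. g \<in> tc f) \<in> tc f" using mem_tc[OF f] by (rule someI)
  then obtain h where h: "h \<in> B" "(SOME g. g \<in> tc f) = h + f" by (rule mem_tcD[OF _ f])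
  have "h \<in> carrier F" using B.a_Hcarr[OF h(1)] .
  then show ?thesis
    using lift_add[OF _ f, of h] lift_B[OF h(1)] lift_closed[OF f] by (simp add: tlift_def h(2))
qed

lemma klin_tlift: "klin TU Y (tlift Y b)"
proof (rule klinI)
  fix z a assume "z \<in> carrier TU"
  then obtain f where f: "z = tc f" "f \<in> carrier F" unfolding carrier_tensor by blast
  show "tlift Y b z \<in> carrier Y" unfolding f(1) tlift_tc[OF f(2)] by (rule lift_closed[OF f(2)])
  show "tlift Y b (a \<odot>\<^bsub>TU\<^esub> z) = a \<odot>\<^bsub>Y\<^esub> tlift Y b z"
    unfolding f(1) smult_tc[OF f(2)] tlift_tc[OF f(2)] tlift_tc[OF pscale_F[OF f(2)]] by (rule lift_pscale[OF f(2)])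
next
  fix z y assume "z \<in> carrier TU" "y \<in> carrier TU"
  then obtain f g where f: "z = tc f" "f \<in> carrier F" and g: "y = tc g" "g \<in> carrier F"
    unfolding carrier_tensor by blast
  have fg: "f + g \<in> carrier F" using F.a_closed[OF f(2) g(2)] by simp
  show "tlift Y b (z \<oplus>\<^bsub>TU\<^esub> y) = tlift Y b z \<oplus>\<^bsub>Y\<^esub> tlift Y b y"
    unfolding f(1) g(1) tc_add[OF f(2) g(2), symmetric] tlift_tc[OF f(2)] tlift_tc[OF g(2)] tlift_tc[OF fg]
    by (rule lift_add[OF f(2) g(2)])
qed

lemma tlift_pure: "m \<in> carrier M \<Longrightarrow> t \<in> U \<Longrightarrow> tlift Y b (PT m t) = b m t"
  unfolding pure_tensor_tc using tlift_tc[OF F_single] lift_single b_closed[of "(m, t)"]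
  by (simp add: Y.smult_one)

lemma sum_ext_tensor:
  assumes "z \<in> carrier TU"
  shows "sum_ext TU Y (carrier M \<times> U) (\<lambda>(m, t). PT m t) (\<lambda>(m, t). b m t) z = tlift Y b z"
proof -
  obtain S c where S: "finite S" "S \<subseteq> carrier M \<times> U"
    and z: "z = (\<Oplus>\<^bsub>TU\<^esub>k\<in>S. c k \<odot>\<^bsub>TU\<^esub> PT (fst k) (snd k))"
    using assms by (rule tensor_expansion)
  \<comment> \<open>\<open>sum_ext\<close> admits only plain sums of pure tensors, so each scalar is
    absorbed into the coefficient in \<open>M\<close>.\<close>
  let ?g = "\<lambda>k. (mscale s M (c k) (fst k), snd k)"
  have k: "fst k \<in> carrier M" "snd k \<in> U" if "k \<in> S" for k using S(2) that by auto
  have "c k \<odot>\<^bsub>TU\<^esub> PT (fst k) (snd k) = (\<lambda>(m, t). PT m t) (?g k)" if "k \<in> S" for k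
    using klin_smult[OF kbil_left[OF kbil_pure_tensor], of "snd k" "fst k" "c k"] k[OF that] by simp
  then have z': "z = (\<Oplus>\<^bsub>TU\<^esub>k\<in>S. (\<lambda>(m, t). PT m t) (?g k))"
    unfolding z using k
    by (intro TU.finsum_cong' refl Pi_I) (simp_all add: pure_tensor_closed mscale_closed del: tensor_simps)
  show ?thesis
  proof (rule sum_ext_eq[where r = "\<lambda>(m, t). PT m t" and b = "\<lambda>(m, t). b m t" and g = ?g,
        OF TU.abelian_group_axioms Y.abelian_group_axioms klin_additive[OF klin_tlift] _ _ S(1) _ z'])
    show "?g k \<in> carrier M \<times> U" if "k \<in> S" for k using k[OF that] mscale_closed by simp
  qed (auto simp: pure_tensor_closed tlift_pure simp del: tensor_simps)
qed

end

end

end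

subsection \<open>Decomposition of \<open>W\<^sub>p\<^sub>+\<^sub>q\<close> in \<open>W\<^sub>p \<otimes> W\<^sub>q\<close>\<close>

text \<open>\<open>klin\<close> refers to values on the carrier only, which allows a map given by a
  definite description to be replaced by its explicit formula.\<close>

lemma klin_cong:
  assumes "kspace E" and f: "klin E Y f" and eq: "\<And>z. z \<in> carrier E \<Longrightarrow> g z = f z"
  shows "klin E Y g"
proof -
  interpret E: kspace E by fact
  show ?thesis
    by (rule klinI) (simp_all add: eq E.smult_closed klin_closed[OF f] klin_add[OF f] klin_smult[OF f])
qed

text \<open>Substituting one expansion into another multiplies the coefficient matrices. Both
  bracketings of a double splitting are simplified by this rule.\<close>

lemma (in kspace) smult_combine:
  assumes fin: "finite P" "finite Q" "finite R"
    and v: "\<And>k l. k \<in> Q \<Longrightarrow> l \<in> R \<Longrightarrow> v k l \<in> carrier E"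
  shows "(\<Oplus>j\<in>P. a j \<odot> (\<Oplus>k\<in>Q. \<Oplus>l\<in>R. b j k l \<odot> v k l))
    = (\<Oplus>k\<in>Q. \<Oplus>l\<in>R. (\<Sum>j\<in>P. a j * b j k l) \<odot> v k l)"
proof -
  have sv: "k \<in> Q \<Longrightarrow> l \<in> R \<Longrightarrow> c \<odot> v k l \<in> carrier E" for c k l
    by (intro smult_closed v)
  have "(\<Oplus>j\<in>P. a j \<odot> (\<Oplus>k\<in>Q. \<Oplus>l\<in>R. b j k l \<odot> v k l))
      = (\<Oplus>j\<in>P. \<Oplus>k\<in>Q. \<Oplus>l\<in>R. (a j * b j k l) \<odot> v k l)"
  proof (intro finsum_cong' refl Pi_I finsum_closed sv)
    fix j
    have "a j \<odot> (\<Oplus>k\<in>Q. \<Oplus>l\<in>R. b j k l \<odot> v k l)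
        = (\<Oplus>k\<in>Q. a j \<odot> (\<Oplus>l\<in>R. b j k l \<odot> v k l))"
      by (intro smult_finsum finsum_closed Pi_I sv)
    also have "\<dots> = (\<Oplus>k\<in>Q. \<Oplus>l\<in>R. (a j * b j k l) \<odot> v k l)"
    proof (intro finsum_cong' refl Pi_I finsum_closed sv)
      fix k assume k: "k \<in> Q"
      have "a j \<odot> (\<Oplus>l\<in>R. b j k l \<odot> v k l) = (\<Oplus>l\<in>R. a j \<odot> (b j k l \<odot> v k l))"
        by (intro smult_finsum sv k)
      also have "\<dots> = (\<Oplus>l\<in>R. (a j * b j k l) \<odot> v k l)"
        by (intro finsum_cong' refl Pi_I sv k) (simp_all add: smult_assoc v k)
      finally show "a j \<odot> (\<Oplus>l\<in>R. b j k l \<odot> v k l) = (\<Oplus>l\<in>R. (a j * b j k l) \<odot> v k l)" .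
    qed
    finally show "a j \<odot> (\<Oplus>k\<in>Q. \<Oplus>l\<in>R. b j k l \<odot> v k l)
        = (\<Oplus>k\<in>Q. \<Oplus>l\<in>R. (a j * b j k l) \<odot> v k l)" .
  qed
  also have "\<dots> = (\<Oplus>k\<in>Q. \<Oplus>j\<in>P. \<Oplus>l\<in>R. (a j * b j k l) \<odot> v k l)"
    by (intro finsum_swap fin finsum_closed Pi_I sv)
  also have "\<dots> = (\<Oplus>k\<in>Q. \<Oplus>l\<in>R. \<Oplus>j\<in>P. (a j * b j k l) \<odot> v k l)"
    by (intro finsum_cong' refl Pi_I finsum_swap fin finsum_closed sv)
  also have "\<dots> = (\<Oplus>k\<in>Q. \<Oplus>l\<in>R. (\<Sum>j\<in>P. a j * b j k l) \<odot> v k l)"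
    by (intro finsum_cong' refl Pi_I finsum_closed sv finsum_smult v)
  finally show ?thesis .
qed

context koszul
begin

text \<open>Expand the first \<open>p\<close> letters of a word and then the last \<open>q\<close>.
  The result is the explicit way of writing \<open>w\<close> that \<open>split_ext\<close> requires;
  the scalar is absorbed into the left factor.\<close>

lemma W_pairs_expansion:
  assumes w: "w \<in> W s (p + q)"
  shows "w = (\<Oplus>\<^bsub>T\<^esub>k\<in>Inc p \<times> Inc q. (cf (fst k @ snd k) w \<cdot> wb (fst k)) \<otimes>\<^bsub>T\<^esub> wb (snd k))"
proof (rule cf_ext)
  let ?u = "\<lambda>k. (cf (fst k @ snd k) w \<cdot> wb (fst k)) \<otimes>\<^bsub>T\<^esub> wb (snd k)"
  show "(\<Oplus>\<^bsub>T\<^esub>k\<in>Inc p \<times> Inc q. ?u k) \<in> carrier T"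
    by (rule T.finsum_closed) simp
  show "w \<in> carrier T" by (rule W_in_T[OF w])
  have F: "alt (p + q) (\<lambda>K. cf K w)" using w by (simp add: W_iff)
  have hom: "t \<in> hom_part r" if "t \<in> W s r" for t r
    using that by (simp add: W_iff hom_part_def alt_def)
  fix K
  have "cf K (\<Oplus>\<^bsub>T\<^esub>k\<in>Inc p \<times> Inc q. ?u k) = (\<Sum>k\<in>Inc p \<times> Inc q. cf K (?u k))"
    by (intro cf_finsum) simp
  also have "\<dots> = (\<Sum>k\<in>Inc p \<times> Inc q. cf (fst k @ snd k) w * cf (take p K) (wb (fst k)) * cf (drop p K) (wb (snd k)))"
  proof (intro sum.cong refl)
    fix k assume "k \<in> Inc p \<times> Inc q"
    then have "wb (fst k) \<in> W s p" by (auto intro: wb_W)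
    then have "cf (fst k @ snd k) w \<cdot> wb (fst k) \<in> hom_part p"
      using subsp_W[of p] by (intro hom) (auto simp: subsp_def)
    then show "cf K (?u k) = cf (fst k @ snd k) w * cf (take p K) (wb (fst k)) * cf (drop p K) (wb (snd k))"
      by (simp add: cf_hom_mult cf_smult)
  qed
  also have "\<dots> = (\<Sum>I\<in>Inc p. \<Sum>J\<in>Inc q. cf (I @ J) w * cf (take p K) (wb I) * cf (drop p K) (wb J))"
    by (simp add: sum.cartesian_product case_prod_beta)
  also have "\<dots> = cf K w"
  proof (cases "length K = p + q")
    case True
    have "cf K w = cf (take p K @ drop p K) w" by simp
    also have "\<dots> = (\<Sum>I\<in>Inc p. cf (I @ drop p K) w * cf (take p K) (wb I))"
      using True by (intro alt_expansion_left[OF F]) simp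
    also have "\<dots> = (\<Sum>I\<in>Inc p. (\<Sum>J\<in>Inc q. cf (I @ J) w * cf (drop p K) (wb J)) * cf (take p K) (wb I))"
    proof (intro sum.cong refl)
      fix I assume "I \<in> Inc p"
      then have "length I = p" by (simp add: Inc_def words_def)
      from alt_expansion_right[OF F this, of "drop p K"]
      show "cf (I @ drop p K) w * cf (take p K) (wb I)
          = (\<Sum>J\<in>Inc q. cf (I @ J) w * cf (drop p K) (wb J)) * cf (take p K) (wb I)" by simp
    qed
    finally show ?thesis by (simp add: sum_distrib_left sum_distrib_right mult_ac)
  next
    case False
    have "cf (take p K) (wb I) * cf (drop p K) (wb J) = 0" if I: "I \<in> Inc p" and J: "J \<in> Inc q" for I J
    proof (rule ccontr)
      assume "\<not> ?thesis"
      then have ne: "cf (take p K) (wb I) \<noteq> 0" "cf (drop p K) (wb J) \<noteq> 0" by auto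
      have "take p K \<in> words p" using ne(1) hom_partD(2)[OF hom[OF wb_W[OF I]]] by blast
      moreover have "drop p K \<in> words q" using ne(2) hom_partD(2)[OF hom[OF wb_W[OF J]]] by blast
      ultimately have "K \<in> words (p + q)" by (rule words_take_drop)
      then show False using False by (simp add: words_def)
    qed
    then have "(\<Sum>I\<in>Inc p. \<Sum>J\<in>Inc q. cf (I @ J) w * cf (take p K) (wb I) * cf (drop p K) (wb J)) = 0"
      by (intro sum.neutral ballI) (simp only: mult.assoc mult_zero_right)
    moreover have "cf K w = 0" using False by (intro alt_supp[OF F]) (simp add: words_def)
    ultimately show ?thesis by simp
  qed
  finally show "cf K w = cf K (\<Oplus>\<^bsub>T\<^esub>k\<in>Inc p \<times> Inc q. ?u k)" by simp
qed

text \<open>The coefficients at \<open>I @ J\<close> make sense for every tensor, so this is an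
  additive map on all of the tensor algebra, as \<open>sum_ext_eq\<close> demands, although it is
  meant for elements of \<open>W\<^sub>p\<^sub>+\<^sub>q\<close>.\<close>

definition splitsum :: "('k, 'h, 'y) module_scheme \<Rightarrow> nat \<Rightarrow> nat
    \<Rightarrow> (('v, 'k) tens \<Rightarrow> ('v, 'k) tens \<Rightarrow> 'h) \<Rightarrow> ('v, 'k) tens \<Rightarrow> 'h" where
  "splitsum Y p q b w = (\<Oplus>\<^bsub>Y\<^esub>I\<in>Inc p. \<Oplus>\<^bsub>Y\<^esub>J\<in>Inc q. cf (I @ J) w \<odot>\<^bsub>Y\<^esub> b (wb I) (wb J))"

lemma klin_splitsum:
  assumes Y: "kspace Y" and U: "U \<subseteq> carrier T"
    and b: "\<And>I J. I \<in> Inc p \<Longrightarrow> J \<in> Inc q \<Longrightarrow> b (wb I) (wb J) \<in> carrier Y"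
  shows "klin (tmod\<lparr>carrier := U\<rparr>) Y (splitsum Y p q b)"
  unfolding splitsum_def
  by (intro klin_finsum_map[OF Y] klin_cf[OF U Y] b)

text \<open>The coefficient of a product at \<open>I @ J\<close> is \<open>cf I t * cf J u\<close>,
  so the double sum is the expansion of \<open>b t u\<close> in both arguments.\<close>

lemma splitsum_mult:
  fixes Y :: "('k, 'h, 'y) module_scheme" (structure)
  assumes Y: "kspace Y" and b: "kbil (Wm p) (Wm q) Y b" and t: "t \<in> W s p" and u: "u \<in> W s q"
  shows "splitsum Y p q b (t \<otimes>\<^bsub>T\<^esub> u) = b t u"
proof -
  interpret Y: kspace Y by fact
  have hom: "t \<in> hom_part p"
    using t by (simp add: W_iff hom_part_def alt_def)
  have bc: "I \<in> Inc p \<Longrightarrow> J \<in> Inc q \<Longrightarrow> b (wb I) (wb J) \<in> carrier Y" for I J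
    using kbil_closed[OF b] by (simp add: wb_W)
  have "b t u = (\<Oplus>I\<in>Inc p. cf I t \<odot> b (wb I) u)"
    using kbil_left[OF b, of u] u t by (intro klin_W_expansion[OF Y]) simp_all
  also have "\<dots> = splitsum Y p q b (t \<otimes>\<^bsub>T\<^esub> u)"
    unfolding splitsum_def
  proof (intro Y.finsum_cong' refl Pi_I Y.finsum_closed Y.smult_closed bc)
    fix I assume I: "I \<in> Inc p"
    have "b (wb I) u = (\<Oplus>J\<in>Inc q. cf J u \<odot> b (wb I) (wb J))"
      using kbil_right[OF b, of "wb I"] u I by (intro klin_W_expansion[OF Y]) (simp_all add: wb_W)
    then have "cf I t \<odot> b (wb I) u = (\<Oplus>J\<in>Inc q. cf I t \<odot> (cf J u \<odot> b (wb I) (wb J)))"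
      by (simp only:) (intro Y.smult_finsum Y.smult_closed bc I)
    also have "\<dots> = (\<Oplus>J\<in>Inc q. cf (I @ J) (t \<otimes>\<^bsub>T\<^esub> u) \<odot> b (wb I) (wb J))"
    proof (intro Y.finsum_cong' refl Pi_I Y.smult_closed bc I)
      fix J assume J: "J \<in> Inc q"
      have "cf (I @ J) (t \<otimes>\<^bsub>T\<^esub> u) = cf I t * cf J u"
        using I by (subst cf_hom_mult[OF hom W_in_T[OF u]]) (simp add: Inc_def words_def)
      then show "cf I t \<odot> (cf J u \<odot> b (wb I) (wb J)) = cf (I @ J) (t \<otimes>\<^bsub>T\<^esub> u) \<odot> b (wb I) (wb J)"
        by (simp only: Y.smult_assoc[OF bc[OF I J]])
    qed
    finally show "cf I t \<odot> b (wb I) u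
        = (\<Oplus>J\<in>Inc q. cf (I @ J) (t \<otimes>\<^bsub>T\<^esub> u) \<odot> b (wb I) (wb J))" .
  qed
  finally show ?thesis by (rule sym)
qed

text \<open>\<open>H\<close> and \<open>Y\<close> are kept apart because in the cup product and the
  cochain differential the target is the record \<open>M\<close>, which carries no scalar
  multiplication; \<open>Y\<close> is then \<open>Mm\<close>.\<close>

lemma split_ext_eq:
  assumes Y: "kspace Y" and H: "abelian_group H" "carrier H = carrier Y" "add H = add Y"
    and b: "kbil (Wm p) (Wm q) Y b" and w: "w \<in> W s (p + q)"
  shows "split_ext s H p q b w = splitsum Y p q b w"
  unfolding split_ext_def
proof (rule sum_ext_eq[where r = "\<lambda>(t, u). t \<otimes>\<^bsub>T\<^esub> u" and b = "\<lambda>(t, u). b t u" and A = "Inc p \<times> Inc q"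
      and g = "\<lambda>k. (cf (fst k @ snd k) w \<cdot> wb (fst k), wb (snd k))"])
  show "abelian_group T" by (rule T.abelian_group_axioms)
  show "abelian_group H" by (rule H(1))
  have bc: "I \<in> Inc p \<Longrightarrow> J \<in> Inc q \<Longrightarrow> b (wb I) (wb J) \<in> carrier Y" for I J
    using kbil_closed[OF b] by (simp add: wb_W)
  have "klin (tmod\<lparr>carrier := carrier T\<rparr>) Y (splitsum Y p q b)"
    by (rule klin_splitsum[OF Y]) (simp_all add: bc)
  then show "additive T H (splitsum Y p q b)"
    unfolding klin_def additive_def H(2,3) by simp
  show "(case k of (t, u) \<Rightarrow> t \<otimes>\<^bsub>T\<^esub> u) \<in> carrier T" if "k \<in> W s p \<times> W s q" for k
    using that by (auto simp: W_in_T)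
  show "splitsum Y p q b (case k of (t, u) \<Rightarrow> t \<otimes>\<^bsub>T\<^esub> u) = (case k of (t, u) \<Rightarrow> b t u)"
    if "k \<in> W s p \<times> W s q" for k
    using that splitsum_mult[OF Y b] by auto
  show "finite (Inc p \<times> Inc q)" by simp
  show "(cf (fst k @ snd k) w \<cdot> wb (fst k), wb (snd k)) \<in> W s p \<times> W s q" if "k \<in> Inc p \<times> Inc q" for k
    using that subsp_W[of p] wb_W by (auto simp: subsp_def)
  show "w = (\<Oplus>\<^bsub>T\<^esub>k\<in>Inc p \<times> Inc q. case (cf (fst k @ snd k) w \<cdot> wb (fst k), wb (snd k)) of (t, u) \<Rightarrow> t \<otimes>\<^bsub>T\<^esub> u)"
    unfolding prod.case by (rule W_pairs_expansion[OF w])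
qed

text \<open>The sum over cuts of a word into three parts, to which both bracketings are reduced by
  \<open>splitsum_right\<close> and \<open>splitsum_left\<close>. Their agreement is
  coassociativity.\<close>

definition trisum :: "('k, 'h, 'y) module_scheme \<Rightarrow> nat \<Rightarrow> nat \<Rightarrow> nat
    \<Rightarrow> (('v, 'k) tens \<Rightarrow> ('v, 'k) tens \<Rightarrow> ('v, 'k) tens \<Rightarrow> 'h) \<Rightarrow> ('v, 'k) tens \<Rightarrow> 'h" where
  "trisum Y p q r c w = (\<Oplus>\<^bsub>Y\<^esub>I\<in>Inc p. \<Oplus>\<^bsub>Y\<^esub>K\<in>Inc q. \<Oplus>\<^bsub>Y\<^esub>L\<in>Inc r.
     cf (I @ K @ L) w \<odot>\<^bsub>Y\<^esub> c (wb I) (wb K) (wb L))"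

text \<open>For a fixed beginning \<open>I\<close> the coefficients of \<open>w\<close> are
  alternating in the rest of the word, so the sum over \<open>J\<close> reassembles the coefficient
  at \<open>I @ K @ L\<close>.\<close>

lemma splitsum_right:
  fixes Y :: "('k, 'h, 'y) module_scheme" (structure)
  assumes Y: "kspace Y" and w: "w \<in> W s (p + (q + r))"
    and c: "\<And>I K L. I \<in> Inc p \<Longrightarrow> K \<in> Inc q \<Longrightarrow> L \<in> Inc r \<Longrightarrow> c (wb I) (wb K) (wb L) \<in> carrier Y"
  shows "splitsum Y p (q + r) (\<lambda>a v. splitsum Y q r (c a) v) w = trisum Y p q r c w"
proof -
  interpret Y: kspace Y by fact
  have F: "alt (p + (q + r)) (\<lambda>K. cf K w)" using w by (simp add: W_iff)
  show ?thesis
    unfolding splitsum_def trisum_def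
  proof (rule Y.finsum_cong'[OF refl])
    fix I assume I: "I \<in> Inc p"
    have "(\<Oplus>J\<in>Inc (q + r). cf (I @ J) w \<odot>
          (\<Oplus>K\<in>Inc q. \<Oplus>L\<in>Inc r. cf (K @ L) (wb J) \<odot> c (wb I) (wb K) (wb L)))
      = (\<Oplus>K\<in>Inc q. \<Oplus>L\<in>Inc r.
          (\<Sum>J\<in>Inc (q + r). cf (I @ J) w * cf (K @ L) (wb J)) \<odot> c (wb I) (wb K) (wb L))"
      by (intro Y.smult_combine finite_Inc c I)
    moreover have "(\<Sum>J\<in>Inc (q + r). cf (I @ J) w * cf (K @ L) (wb J)) = cf (I @ K @ L) w" for K L
      using I alt_expansion_right[OF F, of I "K @ L"] by (simp add: Inc_def words_def)
    ultimately show "(\<Oplus>J\<in>Inc (q + r). cf (I @ J) w \<odot>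
          (\<Oplus>K\<in>Inc q. \<Oplus>L\<in>Inc r. cf (K @ L) (wb J) \<odot> c (wb I) (wb K) (wb L)))
      = (\<Oplus>K\<in>Inc q. \<Oplus>L\<in>Inc r. cf (I @ K @ L) w \<odot> c (wb I) (wb K) (wb L))"
      by (simp only:)
  qed (intro Pi_I Y.finsum_closed Y.smult_closed c)
qed

lemma splitsum_left:
  fixes Y :: "('k, 'h, 'y) module_scheme" (structure)
  assumes Y: "kspace Y" and w: "w \<in> W s (p + q + r)"
    and c: "\<And>I K L. I \<in> Inc p \<Longrightarrow> K \<in> Inc q \<Longrightarrow> L \<in> Inc r \<Longrightarrow> c (wb I) (wb K) (wb L) \<in> carrier Y"
  shows "splitsum Y (p + q) r (\<lambda>t u. splitsum Y p q (\<lambda>a b. c a b u) t) w = trisum Y p q r c w"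
proof -
  interpret Y: kspace Y by fact
  have F: "alt (p + q + r) (\<lambda>K. cf K w)" using w by (simp add: W_iff)
  \<comment> \<open>The last part is moved to the outermost sum, so that the beginning of the word
    is expanded with its end fixed.\<close>
  have "splitsum Y (p + q) r (\<lambda>t u. splitsum Y p q (\<lambda>a b. c a b u) t) w
      = (\<Oplus>L\<in>Inc r. \<Oplus>J\<in>Inc (p + q). cf (J @ L) w \<odot>
          (\<Oplus>I\<in>Inc p. \<Oplus>K\<in>Inc q. cf (I @ K) (wb J) \<odot> c (wb I) (wb K) (wb L)))"
    unfolding splitsum_def
    by (intro Y.finsum_swap finite_Inc Y.finsum_closed Pi_I Y.smult_closed c)
  also have "\<dots> = (\<Oplus>L\<in>Inc r. \<Oplus>I\<in>Inc p. \<Oplus>K\<in>Inc q.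
      cf (I @ K @ L) w \<odot> c (wb I) (wb K) (wb L))"
  proof (rule Y.finsum_cong'[OF refl])
    fix L assume L: "L \<in> Inc r"
    have "(\<Oplus>J\<in>Inc (p + q). cf (J @ L) w \<odot>
          (\<Oplus>I\<in>Inc p. \<Oplus>K\<in>Inc q. cf (I @ K) (wb J) \<odot> c (wb I) (wb K) (wb L)))
      = (\<Oplus>I\<in>Inc p. \<Oplus>K\<in>Inc q.
          (\<Sum>J\<in>Inc (p + q). cf (J @ L) w * cf (I @ K) (wb J)) \<odot> c (wb I) (wb K) (wb L))"
      by (intro Y.smult_combine finite_Inc c L)
    moreover have "(\<Sum>J\<in>Inc (p + q). cf (J @ L) w * cf (I @ K) (wb J)) = cf (I @ K @ L) w" for I K
      using L alt_expansion_left[OF F, of L "I @ K"] by (simp add: Inc_def words_def)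
    ultimately show "(\<Oplus>J\<in>Inc (p + q). cf (J @ L) w \<odot>
          (\<Oplus>I\<in>Inc p. \<Oplus>K\<in>Inc q. cf (I @ K) (wb J) \<odot> c (wb I) (wb K) (wb L)))
      = (\<Oplus>I\<in>Inc p. \<Oplus>K\<in>Inc q. cf (I @ K @ L) w \<odot> c (wb I) (wb K) (wb L))"
      by (simp only:)
  qed (intro Pi_I Y.finsum_closed Y.smult_closed c)
  also have "\<dots> = (\<Oplus>I\<in>Inc p. \<Oplus>L\<in>Inc r. \<Oplus>K\<in>Inc q.
      cf (I @ K @ L) w \<odot> c (wb I) (wb K) (wb L))"
    by (intro Y.finsum_swap finite_Inc Y.finsum_closed Pi_I Y.smult_closed c)
  also have "\<dots> = trisum Y p q r c w"
    unfolding trisum_def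
    by (intro Y.finsum_cong' refl Pi_I Y.finsum_swap finite_Inc Y.finsum_closed Y.smult_closed c)
  finally show ?thesis .
qed

lemma subsp_W_int: "subsp (W_int s q)"
  using subsp_W[of "nat q"] by (auto simp: W_int_def subsp_def)

abbreviation Wi :: "int \<Rightarrow> ('k, ('v, 'k) tens) module" where
  "Wi q \<equiv> tmod\<lparr>carrier := W_int s q\<rparr>"

lemma W_int_nat: "W_int s (int q) = W s q"
  by (simp add: W_int_def)

end

context koszul_bimodule
begin

lemma kspace_chains: "kspace (chains s M q)"
  unfolding chains_def by (rule kspace_tensor[OF subsp_W_int])

lemma kbil_pure_chain: "kbil Mm (Wi q) (chains s M q) (pure_chain s M q)"
  unfolding chains_def pure_chain_def[abs_def] by (rule kbil_pure_tensor[OF subsp_W_int])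

lemma pure_chain_closed: "m \<in> carrier M \<Longrightarrow> t \<in> W_int s q \<Longrightarrow> pure_chain s M q m t \<in> carrier (chains s M q)"
  using kbil_closed[OF kbil_pure_chain] by simp

lemma chain_ext_tlift:
  assumes "kspace Y" "kbil Mm (Wi q) Y b" "z \<in> carrier (chains s M q)"
  shows "chain_ext s M q Y b z = tlift Y b z"
  using sum_ext_tensor[OF subsp_W_int assms(1,2)] assms(3)
  by (simp add: chain_ext_def chains_def pure_chain_def)

lemma klin_chain_ext:
  assumes "kspace Y" "kbil Mm (Wi q) Y b"
  shows "klin (chains s M q) Y (chain_ext s M q Y b)"
  using klin_tlift[OF subsp_W_int assms]
  by (intro klin_cong[OF kspace_chains _ chain_ext_tlift[OF assms]]) (simp_all add: chains_def)

lemma chain_ext_pure: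
  assumes "kspace Y" "kbil Mm (Wi q) Y b" "m \<in> carrier M" "t \<in> W_int s q"
  shows "chain_ext s M q Y b (pure_chain s M q m t) = b m t"
  using tlift_pure[OF subsp_W_int assms] chain_ext_tlift[OF assms(1,2) pure_chain_closed[OF assms(3,4)]]
  by (simp add: pure_chain_def)

lemma chains_klin_eq:
  assumes "kspace Y" "klin (chains s M q) Y f" "klin (chains s M q) Y g"
    and "\<And>m t. m \<in> carrier M \<Longrightarrow> t \<in> W_int s q \<Longrightarrow> f (pure_chain s M q m t) = g (pure_chain s M q m t)"
    and "z \<in> carrier (chains s M q)"
  shows "f z = g z"
  using tensor_klin_eq[OF subsp_W_int, of Y q f g z] assms by (simp add: chains_def pure_chain_def)

end

lemma klin_id: "klin E E (\<lambda>z. z)"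
  by (rule klinI) simp_all

context koszul
begin

lemma splitsum_cong:
  assumes Y: "kspace Y" and b: "\<And>I J. I \<in> Inc p \<Longrightarrow> J \<in> Inc q \<Longrightarrow> b' (wb I) (wb J) \<in> carrier Y"
    and eq: "\<And>I J. I \<in> Inc p \<Longrightarrow> J \<in> Inc q \<Longrightarrow> b (wb I) (wb J) = b' (wb I) (wb J)"
  shows "splitsum Y p q b w = splitsum Y p q b' w"
proof -
  interpret Y: kspace Y by fact
  show ?thesis
    unfolding splitsum_def
    by (intro Y.finsum_cong' refl Pi_I Y.finsum_closed Y.smult_closed b) (simp_all only: eq)
qed

lemma splitsum_klin:
  assumes Y: "kspace Y" and Z: "kspace Z" and \<phi>: "klin Y Z \<phi>"
    and b: "\<And>I J. I \<in> Inc p \<Longrightarrow> J \<in> Inc q \<Longrightarrow> b (wb I) (wb J) \<in> carrier Y"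
  shows "\<phi> (splitsum Y p q b w) = splitsum Z p q (\<lambda>t u. \<phi> (b t u)) w"
proof -
  interpret Y: kspace Y by fact
  interpret Z: kspace Z by fact
  note [intro] = Y.finsum_closed Y.smult_closed Z.finsum_closed Z.smult_closed klin_closed[OF \<phi>]
  note sum = additive_finsum[OF Y.abelian_group_axioms Z.abelian_group_axioms klin_additive[OF \<phi>]]
  have "\<phi> (splitsum Y p q b w)
      = (\<Oplus>\<^bsub>Z\<^esub>I\<in>Inc p. \<phi> (\<Oplus>\<^bsub>Y\<^esub>J\<in>Inc q. cf (I @ J) w \<odot>\<^bsub>Y\<^esub> b (wb I) (wb J)))"
    unfolding splitsum_def by (intro sum Y.finsum_closed Pi_I Y.smult_closed b)
  also have "\<dots> = splitsum Z p q (\<lambda>t u. \<phi> (b t u)) w"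
    unfolding splitsum_def
  proof (rule Z.finsum_cong'[OF refl])
    fix I assume I: "I \<in> Inc p"
    have "\<phi> (\<Oplus>\<^bsub>Y\<^esub>J\<in>Inc q. cf (I @ J) w \<odot>\<^bsub>Y\<^esub> b (wb I) (wb J))
        = (\<Oplus>\<^bsub>Z\<^esub>J\<in>Inc q. \<phi> (cf (I @ J) w \<odot>\<^bsub>Y\<^esub> b (wb I) (wb J)))"
      by (intro sum Y.smult_closed b I)
    also have "\<dots> = (\<Oplus>\<^bsub>Z\<^esub>J\<in>Inc q. cf (I @ J) w \<odot>\<^bsub>Z\<^esub> \<phi> (b (wb I) (wb J)))"
      by (intro Z.finsum_cong' refl Pi_I Z.smult_closed klin_closed[OF \<phi>] klin_smult[OF \<phi>] b I)
    finally show "\<phi> (\<Oplus>\<^bsub>Y\<^esub>J\<in>Inc q. cf (I @ J) w \<odot>\<^bsub>Y\<^esub> b (wb I) (wb J))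
        = (\<Oplus>\<^bsub>Z\<^esub>J\<in>Inc q. cf (I @ J) w \<odot>\<^bsub>Z\<^esub> \<phi> (b (wb I) (wb J)))" .
  qed (intro Pi_I Z.finsum_closed Z.smult_closed klin_closed[OF \<phi>] b)
  finally show ?thesis .
qed

lemma splitsum_closed:
  assumes Y: "kspace Y" and b: "\<And>I J. I \<in> Inc p \<Longrightarrow> J \<in> Inc q \<Longrightarrow> b (wb I) (wb J) \<in> carrier Y"
  shows "splitsum Y p q b w \<in> carrier Y"
proof -
  interpret Y: kspace Y by fact
  show ?thesis unfolding splitsum_def by (intro Y.finsum_closed Pi_I Y.smult_closed b)
qed

lemma trisum_closed:
  assumes Y: "kspace Y"
    and c: "\<And>I K L. I \<in> Inc p \<Longrightarrow> K \<in> Inc q \<Longrightarrow> L \<in> Inc r \<Longrightarrow> c (wb I) (wb K) (wb L) \<in> carrier Y"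
  shows "trisum Y p q r c w \<in> carrier Y"
proof -
  interpret Y: kspace Y by fact
  show ?thesis unfolding trisum_def by (intro Y.finsum_closed Pi_I Y.smult_closed c)
qed

text \<open>A left cup factor reads the first letters of \<open>omega\<close>, but in a left cap
  product the same cochain reads the last letters. Rotating its block past the other two reconciles
  them, with the sign of \<open>alt_rotate\<close>.\<close>

lemma trisum_rotate:
  fixes Y :: "('k, 'h, 'y) module_scheme" (structure)
  assumes Y: "kspace Y" and n: "q + (p + r) = n"
    and c: "\<And>K I L. K \<in> Inc q \<Longrightarrow> I \<in> Inc p \<Longrightarrow> L \<in> Inc r \<Longrightarrow> c (wb K) (wb I) (wb L) \<in> carrier Y"
  shows "trisum Y q p r c omega = (- 1) ^ (q * (p + r)) \<odot> trisum Y p r q (\<lambda>t u a. c a t u) omega"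
proof -
  interpret Y: kspace Y by fact
  let ?e = "(- 1) ^ (q * (p + r)) :: 'k"
  have rot: "cf (K @ I @ L) omega = ?e * cf (I @ L @ K) omega"
    if "K \<in> Inc q" "I \<in> Inc p" "L \<in> Inc r" for I K L
    using alt_rotate[OF alt_omega, of K "I @ L"] that by (simp add: Inc_def words_def)
  have "trisum Y q p r c omega = (\<Oplus>I\<in>Inc p. \<Oplus>K\<in>Inc q. \<Oplus>L\<in>Inc r.
      cf (K @ I @ L) omega \<odot> c (wb K) (wb I) (wb L))"
    unfolding trisum_def by (intro Y.finsum_swap finite_Inc Y.finsum_closed Pi_I Y.smult_closed c)
  also have "\<dots> = (\<Oplus>I\<in>Inc p. \<Oplus>L\<in>Inc r. \<Oplus>K\<in>Inc q.
      cf (K @ I @ L) omega \<odot> c (wb K) (wb I) (wb L))"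
  proof (rule Y.finsum_cong'[OF refl])
    fix I assume I: "I \<in> Inc p"
    show "(\<Oplus>K\<in>Inc q. \<Oplus>L\<in>Inc r. cf (K @ I @ L) omega \<odot> c (wb K) (wb I) (wb L))
        = (\<Oplus>L\<in>Inc r. \<Oplus>K\<in>Inc q. cf (K @ I @ L) omega \<odot> c (wb K) (wb I) (wb L))"
      by (intro Y.finsum_swap finite_Inc Y.smult_closed c I)
  qed (intro Pi_I Y.finsum_closed Y.smult_closed c)
  also have "\<dots> = (\<Oplus>I\<in>Inc p. \<Oplus>L\<in>Inc r. \<Oplus>K\<in>Inc q.
      ?e \<odot> (cf (I @ L @ K) omega \<odot> c (wb K) (wb I) (wb L)))"
    by (intro Y.finsum_cong' refl Pi_I Y.finsum_closed Y.smult_closed c)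
      (simp_all only: rot Y.smult_assoc c)
  also have "\<dots> = (\<Oplus>I\<in>Inc p. \<Oplus>L\<in>Inc r. ?e \<odot> (\<Oplus>K\<in>Inc q.
      cf (I @ L @ K) omega \<odot> c (wb K) (wb I) (wb L)))"
    by (intro Y.finsum_cong' refl Pi_I Y.finsum_closed Y.smult_closed Y.smult_finsum[symmetric] c)
  also have "\<dots> = (\<Oplus>I\<in>Inc p. ?e \<odot> (\<Oplus>L\<in>Inc r. \<Oplus>K\<in>Inc q.
      cf (I @ L @ K) omega \<odot> c (wb K) (wb I) (wb L)))"
    by (intro Y.finsum_cong' refl Pi_I Y.finsum_closed Y.smult_closed Y.smult_finsum[symmetric] c)
  also have "\<dots> = ?e \<odot> trisum Y p r q (\<lambda>t u a. c a t u) omega"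
    unfolding trisum_def
    by (intro Y.finsum_closed Pi_I Y.smult_closed Y.smult_finsum[symmetric] c)
  finally show ?thesis .
qed

end

subsection \<open>The map \<open>\<theta>\<^sub>M\<close>\<close>

context koszul_bimodule
begin

lemma neg_pow_M: "m \<in> carrier M \<Longrightarrow> neg_pow M k m = mscale s M ((- 1) ^ k) m"
proof -
  assume m: "m \<in> carrier M"
  have "\<ominus>\<^bsub>M\<^esub> m = mscale s M (- 1) m"
  proof (rule minus_equality)
    show "mscale s M (- 1) m \<oplus> m = \<zero>"
      using Mm.l_neg[of m] Mm.smult_neg_one[of m] m by simp
  qed (use m in \<open>simp_all add: mscale_closed\<close>)
  then show ?thesis using Mm.smult_one[of m] m by (simp add: neg_pow_def)
qed

lemma cochain_iff:
  "f \<in> carrier (Co p) \<longleftrightarrow> f \<in> extensional (W s p) \<and> klin (Wm p) Mm f"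
  by (auto simp: cochains_def klin_def additive_def PiE_def)

lemma cochain_klin: "f \<in> carrier (Co p) \<Longrightarrow> klin (Wm p) Mm f"
  by (simp add: cochain_iff)

lemma cochain_closed: "f \<in> carrier (Co p) \<Longrightarrow> t \<in> W s p \<Longrightarrow> f t \<in> carrier M"
  using klin_closed[OF cochain_klin] by simp

lemma kspace_Wm: "kspace (Wm p)"
  by (rule kspace_tmod[OF subsp_W])

lemma cochainI:
  assumes "klin (Wm p) Mm f"
  shows "(\<lambda>t\<in>W s p. f t) \<in> carrier (Co p)"
  unfolding cochain_iff using klin_cong[OF kspace_Wm assms, of "\<lambda>t\<in>W s p. f t"] by simp

lemma cochain_eqI:
  assumes f: "f \<in> carrier (Co p)" and g: "g \<in> carrier (Co p)"
    and eq: "\<And>I. I \<in> Inc p \<Longrightarrow> f (wb I) = g (wb I)"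
  shows "f = g"
proof (rule extensionalityI)
  show "f \<in> extensional (W s p)" "g \<in> extensional (W s p)" using f g by (simp_all add: cochain_iff)
  fix t assume t: "t \<in> W s p"
  show "f t = g t"
    unfolding klin_W_expansion[OF Mm.kspace_axioms cochain_klin[OF f] t]
      klin_W_expansion[OF Mm.kspace_axioms cochain_klin[OF g] t]
    using cochain_closed[OF g] by (intro Mm.finsum_cong' refl) (auto simp: eq wb_W mscale_closed)
qed

text \<open>Cap products and the chain differential apply \<open>split_ext\<close> inside
  \<open>chain_ext\<close>. The outer extension makes sense once the inner one is bilinear in the
  coefficient and the element of \<open>W\<^sub>p\<^sub>+\<^sub>q\<close>.\<close>

lemma chain_split:
  assumes Y: "kspace Y"
    and c: "\<And>m. m \<in> carrier M \<Longrightarrow> kbil (Wm p) (Wm q) Y (c m)"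
    and c': "\<And>t u. t \<in> W s p \<Longrightarrow> u \<in> W s q \<Longrightarrow> klin Mm Y (\<lambda>m. c m t u)"
  shows "kbil Mm (Wi (int (p + q))) Y (\<lambda>m w. split_ext s Y p q (c m) w)"
    and "m \<in> carrier M \<Longrightarrow> w \<in> W s (p + q) \<Longrightarrow> split_ext s Y p q (c m) w = splitsum Y p q (c m) w"
proof -
  have Ya: "abelian_group Y" using Y by (simp add: kspace_def)
  have eq: "split_ext s Y p q (c m) w = splitsum Y p q (c m) w" if "m \<in> carrier M" "w \<in> W s (p + q)" for m w
    using that by (intro split_ext_eq[OF Y Ya refl refl c])
  have cc: "c m (wb I) (wb J) \<in> carrier Y" if "m \<in> carrier M" "I \<in> Inc p" "J \<in> Inc q" for m I J
    using kbil_closed[OF c[OF that(1)]] that by (simp add: wb_W)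
  show "kbil Mm (Wi (int (p + q))) Y (\<lambda>m w. split_ext s Y p q (c m) w)"
    unfolding W_int_nat
  proof (rule kbilI)
    fix m assume "m \<in> carrier Mm"
    then have m: "m \<in> carrier M" by simp
    have "klin (Wm (p + q)) Y (splitsum Y p q (c m))"
      using W_in_T by (intro klin_splitsum[OF Y] cc m) blast
    then show "klin (Wm (p + q)) Y (split_ext s Y p q (c m))"
      by (rule klin_cong[OF kspace_Wm]) (simp add: eq[OF m])
  next
    fix w assume "w \<in> carrier (Wm (p + q))"
    then have w: "w \<in> W s (p + q)" by simp
    have "klin Mm Y (\<lambda>m. splitsum Y p q (c m) w)"
      unfolding splitsum_def
      by (intro klin_finsum_map[OF Y] klin_smult_map[OF Y] c' wb_W)
    then show "klin Mm Y (\<lambda>m. split_ext s Y p q (c m) w)"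
      by (rule klin_cong[OF Mm.kspace_axioms]) (simp add: eq[OF _ w])
  qed
  show "m \<in> carrier M \<Longrightarrow> w \<in> W s (p + q) \<Longrightarrow> split_ext s Y p q (c m) w = splitsum Y p q (c m) w"
    by (rule eq)
qed

text \<open>The inner sum has already given the first \<open>p\<close> letters to \<open>f\<close>,
  and \<open>c\<close> splits the remaining \<open>q + r\<close>. Linearity moves the extension
  inside the sum, where it acts on pure chains, and \<open>splitsum_right\<close> merges the two
  splittings.\<close>

lemma chain_ext_split_splitsum:
  assumes Y: "kspace Y"
    and c: "\<And>m. m \<in> carrier M \<Longrightarrow> kbil (Wm q) (Wm r) Y (c m)"
    and c': "\<And>t u. t \<in> W s q \<Longrightarrow> u \<in> W s r \<Longrightarrow> klin Mm Y (\<lambda>m. c m t u)"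
    and f: "\<And>I. I \<in> Inc p \<Longrightarrow> f (wb I) \<in> carrier M"
    and w: "w \<in> W s (p + (q + r))"
  shows "chain_ext s M (int (q + r)) Y (\<lambda>m w. split_ext s Y q r (c m) w)
      (splitsum (Ch (q + r)) p (q + r) (\<lambda>t u. Pc (q + r) (f t) u) w)
    = trisum Y p q r (\<lambda>t a u. c (f t) a u) w"
proof -
  have split1: "kbil Mm (Wi (int (q + r))) Y (\<lambda>m w. split_ext s Y q r (c m) w)"
    by (rule chain_split(1)[OF Y c c'])
  have split2: "split_ext s Y q r (c m) w = splitsum Y q r (c m) w" if "m \<in> carrier M" "w \<in> W s (q + r)" for m w
    by (rule chain_split(2)[OF Y c c' that])
  let ?\<phi> = "chain_ext s M (int (q + r)) Y (\<lambda>m w. split_ext s Y q r (c m) w)"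
  have \<phi>: "klin (Ch (q + r)) Y ?\<phi>"
    by (rule klin_chain_ext[OF Y split1])
  have cc: "c m (wb I) (wb J) \<in> carrier Y" if "m \<in> carrier M" "I \<in> Inc q" "J \<in> Inc r" for m I J
    using kbil_closed[OF c[OF that(1)]] that by (simp add: wb_W)
  have "?\<phi> (splitsum (Ch (q + r)) p (q + r) (\<lambda>t u. Pc (q + r) (f t) u) w)
      = splitsum Y p (q + r) (\<lambda>t u. ?\<phi> (Pc (q + r) (f t) u)) w"
    by (intro splitsum_klin[OF kspace_chains Y \<phi>] pure_chain_closed f)
      (simp_all only: W_int_nat wb_W)
  also have "\<dots> = splitsum Y p (q + r) (\<lambda>t u. splitsum Y q r (c (f t)) u) w"
  proof (rule splitsum_cong[OF Y])
    fix I J assume I: "I \<in> Inc p" and J: "J \<in> Inc (q + r)"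
    show "splitsum Y q r (c (f (wb I))) (wb J) \<in> carrier Y"
      by (intro splitsum_closed[OF Y] cc f I)
    have "?\<phi> (Pc (q + r) (f (wb I)) (wb J)) = split_ext s Y q r (c (f (wb I))) (wb J)"
      by (rule chain_ext_pure[OF Y split1 f[OF I]]) (simp_all only: W_int_nat wb_W J)
    then show "?\<phi> (Pc (q + r) (f (wb I)) (wb J)) = splitsum Y q r (c (f (wb I))) (wb J)"
      using split2[OF f[OF I] wb_W[OF J]] by simp
  qed
  also have "\<dots> = trisum Y p q r (\<lambda>t a u. c (f t) a u) w"
    by (rule splitsum_right[OF Y w]) (intro cc f)
  finally show ?thesis .
qed

lemma klin_pure_left: "t \<in> W s r \<Longrightarrow> klin Mm (Ch r) (\<lambda>m. Pc r m t)"
  and klin_pure_right: "m \<in> carrier M \<Longrightarrow> klin (Wm r) (Ch r) (Pc r m)"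
  using kbil_left[OF kbil_pure_chain, of t "int r"] kbil_right[OF kbil_pure_chain, of m "int r"]
  by (simp_all add: W_int_nat)

lemma pure_closed: "m \<in> carrier M \<Longrightarrow> t \<in> W s r \<Longrightarrow> Pc r m t \<in> carrier (Ch r)"
  using pure_chain_closed[of m t "int r"] by (simp add: W_int_nat)

text \<open>The fundamental chain has coefficients in \<open>A\<close>, so the chain lemmas are
  needed for these coefficients too.\<close>

interpretation S: koszul_bimodule s n x "self_bimodule s"
  by (intro koszul_bimodule.intro koszul_axioms sym_bimodule_self)

lemma theta_eq:
  assumes f: "f \<in> carrier (Co p)" and n: "p + r = n"
  shows "Theta p f = (- 1) ^ (p * n) \<odot>\<^bsub>Ch r\<^esub>
    splitsum (Ch r) p r (\<lambda>t u. Pc r (f t) u) omega"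
proof -
  let ?H = "Ch r"
  interpret H: kspace ?H by (rule kspace_chains)
  let ?c = "\<lambda>m t u. Pc r (lact M m (f t)) u"
  let ?b = "\<lambda>m w. split_ext s ?H p r (?c m) w"
  have c: "kbil (Wm p) (Wm r) ?H (?c m)" if "m \<in> carrier (self_bimodule s)" for m
  proof (rule kbilI)
    fix t assume "t \<in> carrier (Wm p)"
    then show "klin (Wm r) ?H (?c m t)"
      using that by (intro klin_pure_right lact_closed cochain_closed[OF f]) simp_all
  next
    fix u assume "u \<in> carrier (Wm r)"
    then show "klin (Wm p) ?H (\<lambda>t. ?c m t u)"
      using that by (intro klin_compose[OF klin_compose[OF cochain_klin[OF f] klin_lact] klin_pure_left]) simp_all
  qed
  have c': "klin Am ?H (\<lambda>m. ?c m t u)" if "t \<in> W s p" "u \<in> W s r" for t u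
    using that by (intro klin_compose[OF klin_lact' klin_pure_left] cochain_closed[OF f])
  have one: "\<one>\<^bsub>A\<^esub> \<in> carrier (self_bimodule s)" by simp
  have b: "kbil Am (Wi (int n)) ?H ?b"
    using S.chain_split(1)[OF kspace_chains c c'] unfolding n .
  have "chain_ext s (self_bimodule s) (int n) ?H ?b (pure_chain s (self_bimodule s) (int n) \<one>\<^bsub>A\<^esub> omega)
      = ?b \<one>\<^bsub>A\<^esub> omega"
    by (rule S.chain_ext_pure[OF kspace_chains b one]) (simp only: W_int_nat omega_W)
  also have "\<dots> = splitsum ?H p r (?c \<one>\<^bsub>A\<^esub>) omega"
    using S.chain_split(2)[OF kspace_chains c c' one, of omega] omega_W unfolding n by blast
  also have "\<dots> = splitsum ?H p r (\<lambda>t u. Pc r (f t) u) omega"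
    by (rule splitsum_cong[OF kspace_chains])
      (simp_all add: pure_closed cochain_closed[OF f] wb_W lact_one)
  finally have "chain_ext s (self_bimodule s) (int n) ?H ?b (fundamental_chain s n x)
      = splitsum ?H p r (\<lambda>t u. Pc r (f t) u) omega"
    unfolding fundamental_chain_def .
  moreover have "int n - int p = int r" "nat (int n) - p = r" "\<not> int p > int n" using n by auto
  moreover have "splitsum ?H p r (\<lambda>t u. Pc r (f t) u) omega \<in> carrier ?H"
    by (rule splitsum_closed[OF kspace_chains]) (simp add: pure_closed cochain_closed[OF f] wb_W)
  ultimately show ?thesis
    unfolding theta_def cap_right_def Let_def by (simp add: H.neg_pow_smult)
qed

lemma theta_beyond: "n < p \<Longrightarrow> Theta p f = \<zero>\<^bsub>chains s M (int n - int p)\<^esub>"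
  by (simp add: theta_def cap_right_def)

lemma theta_sum_closed:
  "f \<in> carrier (Co p) \<Longrightarrow>
    splitsum (Ch r) p r (\<lambda>t u. Pc r (f t) u) omega \<in> carrier (Ch r)"
  by (rule splitsum_closed[OF kspace_chains]) (simp add: pure_closed cochain_closed wb_W)

lemma theta_closed:
  assumes f: "f \<in> carrier (Co p)"
  shows "Theta p f \<in> carrier (chains s M (int n - int p))"
proof (cases "p \<le> n")
  case True
  then have n: "p + (n - p) = n" "int n - int p = int (n - p)" by auto
  show ?thesis
    unfolding n(2) theta_eq[OF f n(1)]
    by (intro kspace.smult_closed[OF kspace_chains] theta_sum_closed f)
next
  case False
  then show ?thesis
    using kspace_chains by (simp add: theta_beyond kspace_def abelian_group_def abelian_monoid.zero_closed)
qed

section \<open>Bijectivity in coordinates\<close>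

text \<open>The coefficient in \<open>M\<close> of a chain at the basis element of \<open>W\<^sub>r\<close> indexed by \<open>J\<close>.\<close>

definition kappa :: "nat list \<Rightarrow> nat \<Rightarrow> ('m \<times> ('v, 'k) tens \<Rightarrow>\<^sub>0 'k) set \<Rightarrow> 'm" where
  "kappa J r = chain_ext s M (int r) Mm (\<lambda>m t. mscale s M (cf J t) m)"

lemma kbil_kappa: "kbil Mm (Wi (int r)) Mm (\<lambda>m t. mscale s M (cf J t) m)"
proof (rule kbilI)
  fix m assume "m \<in> carrier Mm"
  then show "klin (Wi (int r)) Mm (\<lambda>t. mscale s M (cf J t) m)"
    using klin_cf[of "W_int s (int r)" Mm m J] Mm.kspace_axioms W_in_T
    unfolding W_int_nat by (simp add: subset_iff)
next
  fix t
  show "klin Mm Mm (\<lambda>m. mscale s M (cf J t) m)"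
    using klin_smult_map[OF Mm.kspace_axioms klin_id, of "cf J t"] by simp
qed

lemma klin_kappa: "klin (Ch r) Mm (kappa J r)"
  unfolding kappa_def by (rule klin_chain_ext[OF Mm.kspace_axioms kbil_kappa])

lemma kappa_pure: "m \<in> carrier M \<Longrightarrow> t \<in> W s r \<Longrightarrow> kappa J r (Pc r m t) = mscale s M (cf J t) m"
  unfolding kappa_def
  by (rule chain_ext_pure[OF Mm.kspace_axioms kbil_kappa]) (simp_all only: W_int_nat)

text \<open>The space \<open>Ch r\<close> is a direct sum of copies of \<open>M\<close> indexed by
  \<open>Inc r\<close>, and \<open>kappa\<close> reads off the components. Both sides are linear, so
  pure chains suffice, and there the claim is the expansion of \<open>t\<close> in the
  basis.\<close>

lemma chain_expansion:
  assumes z: "z \<in> carrier (Ch r)"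
  shows "z = (\<Oplus>\<^bsub>Ch r\<^esub>J\<in>Inc r. Pc r (kappa J r z) (wb J))"
proof (rule chains_klin_eq[OF kspace_chains klin_id _ _ z])
  interpret H: kspace "Ch r" by (rule kspace_chains)
  show "klin (Ch r) (Ch r)
      (\<lambda>z. \<Oplus>\<^bsub>Ch r\<^esub>J\<in>Inc r. Pc r (kappa J r z) (wb J))"
    by (intro klin_finsum_map[OF kspace_chains] klin_compose[OF klin_kappa klin_pure_left] wb_W)
  fix m t assume m: "m \<in> carrier M" and "t \<in> W_int s (int r)"
  then have t: "t \<in> W s r" by (simp only: W_int_nat)
  have "Pc r m t
      = (\<Oplus>\<^bsub>Ch r\<^esub>J\<in>Inc r. cf J t \<odot>\<^bsub>Ch r\<^esub> Pc r m (wb J))"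
    by (rule klin_W_expansion[OF kspace_chains klin_pure_right[OF m] t])
  also have "\<dots> = (\<Oplus>\<^bsub>Ch r\<^esub>J\<in>Inc r.
      Pc r (kappa J r (Pc r m t)) (wb J))"
  proof (intro H.finsum_cong' refl Pi_I pure_closed klin_closed[OF klin_kappa, simplified] wb_W m t)
    fix J assume J: "J \<in> Inc r"
    show "cf J t \<odot>\<^bsub>Ch r\<^esub> Pc r m (wb J)
        = Pc r (kappa J r (Pc r m t)) (wb J)"
      using klin_smult[OF klin_pure_left[OF wb_W[OF J]], of m "cf J t"] m by (simp add: kappa_pure[OF m t])
  qed
  finally show "Pc r m t = (\<Oplus>\<^bsub>Ch r\<^esub>J\<in>Inc r.
      Pc r (kappa J r (Pc r m t)) (wb J))" .
qed

text \<open>In the double sum for \<open>theta\<close>, \<open>kappa\<close> selects the word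
  \<open>J\<close> in the second factor, and \<open>cf_omega_append\<close> then leaves only
  \<open>compl J\<close> in the first.\<close>

lemma kappa_theta:
  assumes f: "f \<in> carrier (Co p)" and n: "p + r = n" and J: "J \<in> Inc r"
  shows "kappa J r (Theta p f)
    = mscale s M ((- 1) ^ (p * n) * of_int (eps (compl J @ J))) (f (wb (compl J)))"
proof -
  have cJ: "compl J \<in> Inc p" using compl_Inc[OF J] n by force
  have fc: "f (wb I) \<in> carrier M" if "I \<in> Inc p" for I by (intro cochain_closed[OF f] wb_W that)
  have "kappa J r (splitsum (Ch r) p r (\<lambda>t u. Pc r (f t) u) omega)
      = splitsum Mm p r (\<lambda>t u. kappa J r (Pc r (f t) u)) omega"
    by (intro splitsum_klin[OF kspace_chains Mm.kspace_axioms klin_kappa] pure_closed fc wb_W)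
  also have "\<dots> = splitsum Mm p r (\<lambda>t u. mscale s M (cf J u) (f t)) omega"
    by (rule splitsum_cong[OF Mm.kspace_axioms]) (simp_all add: kappa_pure fc wb_W mscale_closed)
  also have "\<dots> = (\<Oplus>\<^bsub>Mm\<^esub>I\<in>Inc p. mscale s M (cf (I @ J) omega) (f (wb I)))"
    unfolding splitsum_def
  proof (rule Mm.finsum_cong'[OF refl])
    show "(\<lambda>I. mscale s M (cf (I @ J) omega) (f (wb I))) \<in> Inc p \<rightarrow> carrier Mm"
      by (simp add: fc mscale_closed)
    fix I assume I: "I \<in> Inc p"
    have "(\<Oplus>\<^bsub>Mm\<^esub>J'\<in>Inc r. cf (I @ J') omega \<odot>\<^bsub>Mm\<^esub> mscale s M (cf J (wb J')) (f (wb I)))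
        = cf (I @ J) omega \<odot>\<^bsub>Mm\<^esub> mscale s M (cf J (wb J)) (f (wb I))"
    proof (rule Mm.finsum_eq_single[OF finite_Inc J])
      fix J' assume J': "J' \<in> Inc r" "J' \<noteq> J"
      then show "cf (I @ J') omega \<odot>\<^bsub>Mm\<^esub> mscale s M (cf J (wb J')) (f (wb I)) = \<zero>\<^bsub>Mm\<^esub>"
        using Mm.smult_assoc[of "f (wb I)" "cf (I @ J') omega" 0] Mm.smult_zero[of "f (wb I)"] fc[OF I]
        by (simp add: cf_wb_Inc[OF J'(1) J])
    qed (simp add: mscale_closed fc I)
    also have "\<dots> = mscale s M (cf (I @ J) omega) (f (wb I))"
      using Mm.smult_one[of "f (wb I)"] fc[OF I] by (simp add: cf_wb_Inc[OF J J])
    finally show "(\<Oplus>\<^bsub>Mm\<^esub>J'\<in>Inc r. cf (I @ J') omega \<odot>\<^bsub>Mm\<^esub> mscale s M (cf J (wb J')) (f (wb I)))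
        = mscale s M (cf (I @ J) omega) (f (wb I))" .
  qed
  also have "\<dots> = mscale s M (cf (compl J @ J) omega) (f (wb (compl J)))"
  proof (rule Mm.finsum_eq_single[OF finite_Inc cJ])
    fix I assume I: "I \<in> Inc p" "I \<noteq> compl J"
    then have "J \<noteq> compl I" using compl_compl[OF I(1)] by auto
    then show "mscale s M (cf (I @ J) omega) (f (wb I)) = \<zero>\<^bsub>Mm\<^esub>"
      using Mm.smult_zero[of "f (wb I)"] fc[OF I(1)] by (simp add: cf_omega_append[OF I(1) J])
  qed (simp add: mscale_closed fc cJ)
  also have "cf (compl J @ J) omega = of_int (eps (compl J @ J))"
    using cf_omega_append[OF cJ J] compl_compl[OF J] by simp
  finally have "kappa J r (splitsum (Ch r) p r (\<lambda>t u. Pc r (f t) u) omega)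
      = mscale s M (of_int (eps (compl J @ J))) (f (wb (compl J)))" .
  then show ?thesis
    unfolding theta_eq[OF f n]
    using klin_smult[OF klin_kappa theta_sum_closed[OF f], of J r]
      Mm.smult_assoc[of "f (wb (compl J))"] fc[OF cJ] by simp
qed

text \<open>Each sign in \<open>kappa_theta\<close> is its own inverse, so the equation is solved
  for the value of \<open>f\<close> by multiplying with the same sign.\<close>

lemma sign_square:
  assumes "J \<in> Inc r"
  shows "((- 1) ^ k * of_int (eps (compl J @ J))) * ((- 1) ^ k * of_int (eps (compl J @ J))) = (1 :: 'k)"
proof -
  have "distinct (compl J @ J)"
    using assms by (auto simp: compl_def Inc_def words_def strict_sorted_iff)
  then have "of_int (eps (compl J @ J) * eps (compl J @ J)) = (1 :: 'k)" by (simp add: eps_square)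
  moreover have "(- 1) ^ k * (- 1) ^ k = (1 :: 'k)" by (simp add: power_mult_distrib[symmetric])
  ultimately show ?thesis by (simp add: mult_ac)
qed

lemma theta_bij:
  assumes n: "p + r = n"
  shows "bij_betw (Theta p) (carrier (Co p)) (carrier (Ch r))"
proof (rule bij_betwI')
  have ir: "int r = int n - int p" using n by simp
  let ?e = "\<lambda>J. (- 1) ^ (p * n) * of_int (eps (compl J @ J)) :: 'k"
  have cI: "compl I \<in> Inc r" if "I \<in> Inc p" for I using compl_Inc[OF that] n by force
  show "Theta p f \<in> carrier (Ch r)" if "f \<in> carrier (Co p)" for f
    using theta_closed[OF that] by (simp only: ir)
  show "Theta p f = Theta p g \<longleftrightarrow> f = g"
    if f: "f \<in> carrier (Co p)" and g: "g \<in> carrier (Co p)" for f g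
  proof
    assume eq: "Theta p f = Theta p g"
    show "f = g"
    proof (rule cochain_eqI[OF f g])
      fix I assume I: "I \<in> Inc p"
      have val: "h (wb I) = mscale s M (?e (compl I)) (kappa (compl I) r (Theta p h))"
        if h: "h \<in> carrier (Co p)" for h
      proof -
        have hc: "h (wb I) \<in> carrier M" by (intro cochain_closed[OF h] wb_W I)
        show ?thesis
          unfolding kappa_theta[OF h n cI[OF I]] compl_compl[OF I]
          using Mm.smult_assoc[of "h (wb I)" "?e (compl I)" "?e (compl I)"] Mm.smult_one[of "h (wb I)"] hc
            sign_square[OF cI[OF I], of "p * n"]
          by (simp only: bmod_simps compl_compl[OF I])
      qed
      show "f (wb I) = g (wb I)" by (simp only: val[OF f] val[OF g] eq)
    qed
  qed simp
  show "\<exists>f\<in>carrier (Co p). z = Theta p f"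
    if z: "z \<in> carrier (Ch r)" for z
  proof -
    have kz: "kappa J r z \<in> carrier M" for J using klin_closed[OF klin_kappa z] by simp
    \<comment> \<open>The preimage is prescribed on the basis: its value at \<open>wb I\<close> is
      \<open>kappa_theta\<close> solved for that value, with \<open>J = compl I\<close>.\<close>
    let ?g = "\<lambda>t. \<Oplus>\<^bsub>Mm\<^esub>I\<in>Inc p. cf I t \<odot>\<^bsub>Mm\<^esub> mscale s M (?e (compl I)) (kappa (compl I) r z)"
    have vc: "mscale s M a (kappa J r z) \<in> carrier Mm" for a J by (simp add: mscale_closed kz)
    have "klin (Wm p) Mm ?g"
      using W_in_T by (intro klin_finsum_map[OF Mm.kspace_axioms] klin_cf[OF _ Mm.kspace_axioms] vc) blast
    then have f: "(\<lambda>t\<in>W s p. ?g t) \<in> carrier (Co p)" by (rule cochainI)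
    let ?f = "\<lambda>t\<in>W s p. ?g t"
    have fI: "?f (wb I) = mscale s M (?e (compl I)) (kappa (compl I) r z)" if I: "I \<in> Inc p" for I
    proof -
      have "?f (wb I) = ?g (wb I)" by (simp only: restrict_apply' wb_W[OF I])
      also have "\<dots> = cf I (wb I) \<odot>\<^bsub>Mm\<^esub> mscale s M (?e (compl I)) (kappa (compl I) r z)"
      proof (rule Mm.finsum_eq_single[OF finite_Inc I])
        fix I' assume "I' \<in> Inc p" "I' \<noteq> I"
        then show "cf I' (wb I) \<odot>\<^bsub>Mm\<^esub> mscale s M (?e (compl I')) (kappa (compl I') r z) = \<zero>\<^bsub>Mm\<^esub>"
          using Mm.smult_zero[OF vc] by (simp add: cf_wb_Inc[OF I])
      qed (intro Mm.smult_closed vc)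
      also have "\<dots> = mscale s M (?e (compl I)) (kappa (compl I) r z)"
        using Mm.smult_one[OF vc] by (simp add: cf_wb_Inc[OF I I])
      finally show ?thesis .
    qed
    have k: "kappa J r (Theta p ?f) = kappa J r z" if J: "J \<in> Inc r" for J
    proof -
      have cJ: "compl J \<in> Inc p" using compl_Inc[OF J] n by force
      show ?thesis
        unfolding kappa_theta[OF f n J] fI[OF cJ] compl_compl[OF J]
        using Mm.smult_assoc[of "kappa J r z" "?e J" "?e J"] Mm.smult_one[of "kappa J r z"] kz
          sign_square[OF J, of "p * n"]
        by (simp only: bmod_simps)
    qed
    have th: "Theta p ?f \<in> carrier (Ch r)"
      using theta_closed[OF f] by (simp only: ir)
    interpret H: kspace "Ch r" by (rule kspace_chains)
    have "z = (\<Oplus>\<^bsub>Ch r\<^esub>J\<in>Inc r. Pc r (kappa J r z) (wb J))"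
      by (rule chain_expansion[OF z])
    also have "\<dots> = (\<Oplus>\<^bsub>Ch r\<^esub>J\<in>Inc r. Pc r (kappa J r (Theta p ?f)) (wb J))"
    proof (rule H.finsum_cong'[OF refl])
      show "(\<lambda>J. Pc r (kappa J r (Theta p ?f)) (wb J)) \<in> Inc r \<rightarrow> carrier (Ch r)"
        using klin_closed[OF klin_kappa th] by (intro Pi_I pure_closed wb_W) simp_all
    qed (simp only: k)
    also have "\<dots> = Theta p ?f"
      by (rule chain_expansion[OF th, symmetric])
    finally show ?thesis using f by blast
  qed
qed

lemma klin_eval: "t \<in> W s p \<Longrightarrow> klin (Co p) Mm (\<lambda>f. f t)"
  by (rule klinI) (simp_all add: cochain_closed, simp_all add: cochains_def)

lemma cochain_add_closed:
  "f \<in> carrier (Co p) \<Longrightarrow> g \<in> carrier (Co p)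
    \<Longrightarrow> f \<oplus>\<^bsub>Co p\<^esub> g \<in> carrier (Co p)"
  using cochainI[OF klin_add_map[OF Mm.kspace_axioms cochain_klin cochain_klin]] by (simp add: cochains_def)

lemma cochain_smult_closed:
  "f \<in> carrier (Co p) \<Longrightarrow> a \<odot>\<^bsub>Co p\<^esub> f \<in> carrier (Co p)"
  using cochainI[OF klin_smult_map[OF Mm.kspace_axioms cochain_klin]] by (simp add: cochains_def)

lemma klin_theta: "klin (Co p) (chains s M (int n - int p)) (Theta p)"
proof -
  let ?H = "chains s M (int n - int p)"
  interpret H: kspace ?H by (rule kspace_chains)
  obtain \<Phi> where \<Phi>: "klin (Co p) ?H \<Phi>"
    and eq: "\<And>f. f \<in> carrier (Co p) \<Longrightarrow> Theta p f = \<Phi> f"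
  proof (cases "p \<le> n")
    case True
    then have n: "p + (n - p) = n" "int n - int p = int (n - p)" by auto
    have "klin (Co p) ?H (\<lambda>f. (- 1) ^ (p * n) \<odot>\<^bsub>?H\<^esub>
        splitsum ?H p (n - p) (\<lambda>t u. Pc (n - p) (f t) u) omega)"
      unfolding splitsum_def n(2)
      by (intro klin_smult_map klin_finsum_map kspace_chains klin_compose[OF klin_eval klin_pure_left] wb_W)
    then show ?thesis
      by (rule that) (simp only: theta_eq[OF _ n(1)] n(2))
  next
    case False
    \<comment> \<open>The zero map is written as an empty sum, so that its linearity is an instance
      of \<open>klin_finsum_map\<close>.\<close>
    have "klin (Co p) ?H (\<lambda>f. \<Oplus>\<^bsub>?H\<^esub>i\<in>{}. \<zero>\<^bsub>?H\<^esub>)"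
      by (rule klin_finsum_map[OF kspace_chains]) simp
    then show ?thesis
      by (rule that) (use False in \<open>simp add: theta_beyond H.finsum_empty\<close>)
  qed
  show ?thesis
    by (rule klinI) (simp_all add: eq cochain_add_closed cochain_smult_closed
        klin_closed[OF \<Phi>] klin_add[OF \<Phi>] klin_smult[OF \<Phi>])
qed

section \<open>Compatibility with the two actions of cochains\<close>

lemma kbil_ract:
  assumes f: "klin (Wm p) Mm f" and g: "klin (Wm q) Am g"
  shows "kbil (Wm p) (Wm q) Mm (\<lambda>t u. ract M (f t) (g u))"
  using klin_closed[OF f] klin_closed[OF g]
  by (intro kbilI klin_compose[OF g klin_ract'] klin_compose[OF f klin_ract]) simp_all

lemma kbil_lact:
  assumes g: "klin (Wm q) Am g" and f: "klin (Wm p) Mm f"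
  shows "kbil (Wm q) (Wm p) Mm (\<lambda>u t. lact M (g u) (f t))"
  using klin_closed[OF f] klin_closed[OF g]
  by (intro kbilI klin_compose[OF f klin_lact] klin_compose[OF g klin_lact']) simp_all

text \<open>The product \<open>mu\<close> stands for \<open>ract M\<close> or \<open>lact M\<close>,
  so both cup products are treated at once, whichever factor has coefficients in
  \<open>A\<close>.\<close>

context
  fixes mu :: "'a \<Rightarrow> 'b \<Rightarrow> 'm" and f :: "('v, 'k) tens \<Rightarrow> 'a" and g :: "('v, 'k) tens \<Rightarrow> 'b" and p q :: nat
  assumes b: "kbil (Wm p) (Wm q) Mm (\<lambda>t u. mu (f t) (g u))"
begin

lemma cup_eq:
  assumes w: "w \<in> W s (p + q)"
  shows "cup s M mu p q f g w = mscale s M ((- 1) ^ (p * q)) (splitsum Mm p q (\<lambda>t u. mu (f t) (g u)) w)"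
proof -
  have bc: "mu (f (wb I)) (g (wb J)) \<in> carrier Mm" if "I \<in> Inc p" "J \<in> Inc q" for I J
    using kbil_closed[OF b] that by (simp add: wb_W)
  have "split_ext s M p q (\<lambda>t u. mu (f t) (g u)) w = splitsum Mm p q (\<lambda>t u. mu (f t) (g u)) w"
    by (rule split_ext_eq[OF Mm.kspace_axioms abelian_group_axioms _ _ b w]) simp_all
  moreover have "splitsum Mm p q (\<lambda>t u. mu (f t) (g u)) w \<in> carrier M"
    unfolding bmod_simps(1)[of s M, symmetric] by (rule splitsum_closed[OF Mm.kspace_axioms]) (rule bc)
  ultimately show ?thesis using w by (simp add: cup_def neg_pow_M)
qed

lemma cup_cochain: "cup s M mu p q f g \<in> carrier (Co (p + q))"
proof -
  have bc: "mu (f (wb I)) (g (wb J)) \<in> carrier Mm" if "I \<in> Inc p" "J \<in> Inc q" for I J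
    using kbil_closed[OF b] that by (simp add: wb_W)
  have "klin (Wm (p + q)) Mm (splitsum Mm p q (\<lambda>t u. mu (f t) (g u)))"
    using W_in_T by (intro klin_splitsum[OF Mm.kspace_axioms] bc) blast
  from klin_smult_map[OF Mm.kspace_axioms this, of "(- 1) ^ (p * q)"]
  have "klin (Wm (p + q)) Mm (cup s M mu p q f g)"
    by (rule klin_cong[OF kspace_Wm]) (simp add: cup_eq)
  then show ?thesis by (simp add: cochain_iff cup_def)
qed

text \<open>\<open>theta\<close> separates the last \<open>r\<close> letters of \<open>omega\<close>
  and the cup product then splits the first \<open>p + q\<close>, which is the bracketing of
  \<open>splitsum_left\<close>. The exponent adds the sign of \<open>theta\<close> in degree
  \<open>p + q\<close> to that of the cup product.\<close>

lemma theta_cup: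
  assumes n: "p + q + r = n"
  shows "Theta (p + q) (cup s M mu p q f g)
    = (- 1) ^ ((p + q) * n + p * q) \<odot>\<^bsub>Ch r\<^esub>
      trisum (Ch r) p q r (\<lambda>t u v. Pc r (mu (f t) (g u)) v) omega"
proof -
  let ?H = "Ch r" and ?P = "Pc r"
  interpret H: kspace ?H by (rule kspace_chains)
  have bc: "mu (f (wb I)) (g (wb J)) \<in> carrier Mm" if "I \<in> Inc p" "J \<in> Inc q" for I J
    using kbil_closed[OF b] that by (simp add: wb_W)
  have pc: "?P (mu (f (wb I)) (g (wb J))) (wb L) \<in> carrier ?H" if "I \<in> Inc p" "J \<in> Inc q" "L \<in> Inc r" for I J L
    using bc[OF that(1,2)] that(3) by (intro pure_closed wb_W) simp_all
  have sc: "splitsum ?H p q (\<lambda>a b. ?P (mu (f a) (g b)) (wb L)) t \<in> carrier ?H" if "L \<in> Inc r" for t L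
    by (intro splitsum_closed[OF kspace_chains] pc that)
  have bs: "splitsum Mm p q (\<lambda>t u. mu (f t) (g u)) w \<in> carrier Mm" for w
    by (rule splitsum_closed[OF Mm.kspace_axioms]) (rule bc)
  let ?e = "(- 1) ^ (p * q) :: 'k"
  have "splitsum ?H (p + q) r (\<lambda>t u. ?P (cup s M mu p q f g t) u) omega
      = splitsum ?H (p + q) r (\<lambda>t u. ?e \<odot>\<^bsub>?H\<^esub> splitsum ?H p q (\<lambda>a b. ?P (mu (f a) (g b)) u) t) omega"
  proof (rule splitsum_cong[OF kspace_chains])
    fix J L assume J: "J \<in> Inc (p + q)" and L: "L \<in> Inc r"
    show "?e \<odot>\<^bsub>?H\<^esub> splitsum ?H p q (\<lambda>a b. ?P (mu (f a) (g b)) (wb L)) (wb J) \<in> carrier ?H"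
      by (intro H.smult_closed sc L)
    note \<phi> = klin_pure_left[OF wb_W[OF L]]
    have "?P (cup s M mu p q f g (wb J)) (wb L)
        = ?e \<odot>\<^bsub>?H\<^esub> ?P (splitsum Mm p q (\<lambda>t u. mu (f t) (g u)) (wb J)) (wb L)"
      using klin_smult[OF \<phi>, of "splitsum Mm p q (\<lambda>t u. mu (f t) (g u)) (wb J)" ?e]
        bs by (simp add: cup_eq[OF wb_W[OF J]])
    also have "?P (splitsum Mm p q (\<lambda>t u. mu (f t) (g u)) (wb J)) (wb L)
        = splitsum ?H p q (\<lambda>a b. ?P (mu (f a) (g b)) (wb L)) (wb J)"
      by (rule splitsum_klin[OF Mm.kspace_axioms kspace_chains \<phi>]) (rule bc)
    finally show "?P (cup s M mu p q f g (wb J)) (wb L)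
        = ?e \<odot>\<^bsub>?H\<^esub> splitsum ?H p q (\<lambda>a b. ?P (mu (f a) (g b)) (wb L)) (wb J)" .
  qed
  also have "\<dots> = ?e \<odot>\<^bsub>?H\<^esub> splitsum ?H (p + q) r (\<lambda>t u. splitsum ?H p q (\<lambda>a b. ?P (mu (f a) (g b)) u) t) omega"
    by (rule splitsum_klin[symmetric, OF kspace_chains kspace_chains klin_smult_map[OF kspace_chains klin_id]])
      (rule sc)
  also have "splitsum ?H (p + q) r (\<lambda>t u. splitsum ?H p q (\<lambda>a b. ?P (mu (f a) (g b)) u) t) omega
      = trisum ?H p q r (\<lambda>t u v. ?P (mu (f t) (g u)) v) omega"
  proof (rule splitsum_left[OF kspace_chains])
    show "omega \<in> W s (p + q + r)" using omega_W by (simp only: n)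
  qed (rule pc)
  finally have "splitsum ?H (p + q) r (\<lambda>t u. ?P (cup s M mu p q f g t) u) omega
      = ?e \<odot>\<^bsub>?H\<^esub> trisum ?H p q r (\<lambda>t u v. ?P (mu (f t) (g u)) v) omega" .
  moreover have "trisum ?H p q r (\<lambda>t u v. ?P (mu (f t) (g u)) v) omega \<in> carrier ?H"
    by (intro trisum_closed[OF kspace_chains] pc)
  ultimately show ?thesis
    unfolding theta_eq[OF cup_cochain n] by (simp add: H.smult_assoc[symmetric] power_add)
qed

end

lemma kbil_pure_ract:
  assumes m: "m \<in> carrier M" and g: "klin (Wm q) Am g"
  shows "kbil (Wm q) (Wm r) (Ch r) (\<lambda>u v. Pc r (ract M m (g u)) v)"
  using klin_closed[OF g] m
  by (intro kbilI klin_pure_right klin_compose[OF klin_compose[OF g klin_ract'[OF m]] klin_pure_left])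
    (simp_all add: ract_closed)

lemma kbil_pure_lact:
  assumes m: "m \<in> carrier M" and g: "klin (Wm q) Am g"
  shows "kbil (Wm r) (Wm q) (Ch r) (\<lambda>v u. Pc r (lact M (g u) m) v)"
  using klin_closed[OF g] m
  by (intro kbilI klin_pure_right klin_compose[OF klin_compose[OF g klin_lact'[OF m]] klin_pure_left])
    (simp_all add: lact_closed)

text \<open>The other bracketing: \<open>f\<close> takes the first \<open>p\<close> letters, and the
  cap product splits the remaining \<open>q + r\<close> with \<open>g\<close> in front.\<close>

lemma theta_cap_right:
  assumes f: "f \<in> carrier (Co p)" and g: "klin (Wm q) Am g" and n: "p + q + r = n"
  shows "cap_right s M M (ract M) (int n - int p) q (Theta p f) g
    = (- 1) ^ (q * (q + r) + p * n) \<odot>\<^bsub>Ch r\<^esub>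
      trisum (Ch r) p q r (\<lambda>t u v. Pc r (ract M (f t) (g u)) v) omega"
proof -
  let ?H = "Ch r" and ?P = "Pc r"
  interpret H: kspace ?H by (rule kspace_chains)
  let ?c = "\<lambda>m u v. ?P (ract M m (g u)) v"
  have gc: "g u \<in> carrier A" if "u \<in> W s q" for u using klin_closed[OF g] that by simp
  have c: "kbil (Wm q) (Wm r) ?H (?c m)" if "m \<in> carrier M" for m
    by (rule kbil_pure_ract[OF that g])
  have c': "klin Mm ?H (\<lambda>m. ?c m u v)" if "u \<in> W s q" "v \<in> W s r" for u v
    using that by (intro klin_compose[OF klin_ract klin_pure_left] gc)
  let ?\<phi> = "chain_ext s M (int (q + r)) ?H (\<lambda>m w. split_ext s ?H q r (?c m) w)"
  let ?S = "splitsum (Ch (q + r)) p (q + r) (\<lambda>t u. Pc (q + r) (f t) u) omega"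
  have w: "omega \<in> W s (p + (q + r))" using omega_W by (simp only: n add.assoc[symmetric])
  have \<phi>: "klin (Ch (q + r)) ?H ?\<phi>"
    by (rule klin_chain_ext[OF kspace_chains chain_split(1)[where c = ?c, OF kspace_chains c c']])
  have fc: "f (wb I) \<in> carrier M" if "I \<in> Inc p" for I by (intro cochain_closed[OF f] wb_W that)
  have 1: "?\<phi> ?S = trisum ?H p q r (\<lambda>t a u. ?c (f t) a u) omega"
    by (rule chain_ext_split_splitsum[where c = ?c and f = f, OF kspace_chains c c' fc w])
  have 2: "Theta p f = (- 1) ^ (p * n) \<odot>\<^bsub>Ch (q + r)\<^esub> ?S"
    using n by (intro theta_eq f) simp
  have 3: "?S \<in> carrier (Ch (q + r))" by (rule theta_sum_closed[OF f])
  have tri: "trisum ?H p q r (\<lambda>t a u. ?c (f t) a u) omega \<in> carrier ?H"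
    by (rule trisum_closed[OF kspace_chains]) (simp add: pure_closed ract_closed fc gc wb_W)
  have d: "int n - int p = int (q + r)" "int (q + r) - int q = int r" "nat (int (q + r)) = q + r" "q + r - q = r"
    using n by auto
  have d': "\<not> int q > int (q + r)" by simp
  have "neg_pow ?H (q * (q + r)) (?\<phi> (Theta p f))
      = (- 1) ^ (q * (q + r) + p * n) \<odot>\<^bsub>?H\<^esub> trisum ?H p q r (\<lambda>t a u. ?c (f t) a u) omega"
    unfolding 2 klin_smult[OF \<phi> 3] 1 using tri
    by (simp add: H.neg_pow_smult H.smult_closed H.smult_assoc[symmetric] power_add)
  then show ?thesis
    unfolding cap_right_def Let_def d if_not_P[OF d'] .
qed

text \<open>Here \<open>g\<close> reads the last \<open>q\<close> of the letters that
  \<open>f\<close> leaves, so the blocks occur in the order \<open>p\<close>, \<open>r\<close>,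
  \<open>q\<close>.\<close>

lemma theta_cap_left:
  assumes f: "f \<in> carrier (Co p)" and g: "klin (Wm q) Am g" and n: "p + q + r = n"
  shows "cap_left s M M (lact M) q (int n - int p) g (Theta p f)
    = (- 1) ^ (r * q + p * n) \<odot>\<^bsub>Ch r\<^esub>
      trisum (Ch r) p r q (\<lambda>t v u. Pc r (lact M (g u) (f t)) v) omega"
proof -
  let ?H = "Ch r" and ?P = "Pc r"
  interpret H: kspace ?H by (rule kspace_chains)
  let ?c = "\<lambda>m v u. ?P (lact M (g u) m) v"
  have gc: "g u \<in> carrier A" if "u \<in> W s q" for u using klin_closed[OF g] that by simp
  have c: "kbil (Wm r) (Wm q) ?H (?c m)" if "m \<in> carrier M" for m
    by (rule kbil_pure_lact[OF that g])
  have c': "klin Mm ?H (\<lambda>m. ?c m v u)" if "v \<in> W s r" "u \<in> W s q" for u v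
    using that by (intro klin_compose[OF klin_lact klin_pure_left] gc)
  let ?\<phi> = "chain_ext s M (int (r + q)) ?H (\<lambda>m w. split_ext s ?H r q (?c m) w)"
  let ?S = "splitsum (Ch (r + q)) p (r + q) (\<lambda>t u. Pc (r + q) (f t) u) omega"
  have nn: "p + (r + q) = n" using n by simp
  have w: "omega \<in> W s (p + (r + q))" using omega_W by (simp only: nn)
  have \<phi>: "klin (Ch (r + q)) ?H ?\<phi>"
    by (rule klin_chain_ext[OF kspace_chains chain_split(1)[where c = ?c, OF kspace_chains c c']])
  have fc: "f (wb I) \<in> carrier M" if "I \<in> Inc p" for I by (intro cochain_closed[OF f] wb_W that)
  have 1: "?\<phi> ?S = trisum ?H p r q (\<lambda>t a u. ?c (f t) a u) omega"
    by (rule chain_ext_split_splitsum[where c = ?c and f = f, OF kspace_chains c c' fc w])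
  have 2: "Theta p f = (- 1) ^ (p * n) \<odot>\<^bsub>Ch (r + q)\<^esub> ?S"
    by (rule theta_eq[OF f nn])
  have 3: "?S \<in> carrier (Ch (r + q))" by (rule theta_sum_closed[OF f])
  have tri: "trisum ?H p r q (\<lambda>t a u. ?c (f t) a u) omega \<in> carrier ?H"
    by (rule trisum_closed[OF kspace_chains]) (simp add: pure_closed lact_closed fc gc wb_W)
  have d: "int n - int p = int (r + q)" "int (r + q) - int q = int r" "nat (int (r + q)) = r + q" "r + q - q = r"
    using n by auto
  have d': "\<not> int q > int (r + q)" by simp
  have "neg_pow ?H (r * q) (?\<phi> (Theta p f))
      = (- 1) ^ (r * q + p * n) \<odot>\<^bsub>?H\<^esub> trisum ?H p r q (\<lambda>t a u. ?c (f t) a u) omega"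
    unfolding 2 klin_smult[OF \<phi> 3] 1 using tri
    by (simp add: H.neg_pow_smult H.smult_closed H.smult_assoc[symmetric] power_add)
  then show ?thesis
    unfolding cap_left_def Let_def d if_not_P[OF d'] .
qed

lemma sign_cong: "even j = even k \<Longrightarrow> (- 1) ^ j = ((- 1) ^ k :: 'k)"
  by (simp add: minus_one_power_iff)

lemma zero_chains: "\<zero>\<^bsub>chains s M q\<^esub> \<in> carrier (chains s M q)"
  using kspace_chains[of q] by (simp add: kspace_def abelian_group_def abelian_monoid.zero_closed)

text \<open>Both sides reduce to the same \<open>trisum\<close>. The cochain \<open>g\<close> is
  only asked to be linear on \<open>W s q\<close>, not extensional, so that \<open>sclass s\<close>
  may be used as the inclusion of \<open>V\<close> in \<open>A\<close>.\<close>

lemma theta_cup_right: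
  assumes f: "f \<in> carrier (Co p)" and g: "klin (Wm q) Am g"
  shows "Theta (p + q) (cup s M (ract M) p q f g)
    = cap_right s M M (ract M) (int n - int p) q (Theta p f) g"
proof (cases "p + q \<le> n")
  case True
  define r where "r = n - (p + q)"
  with True have n: "p + q + r = n" by simp
  \<comment> \<open>With \<open>n = p + q + r\<close> the left exponent exceeds the right one by
    \<open>2 * p * q\<close>.\<close>
  have e: "even ((p + q) * n + p * q) = even (q * (q + r) + p * n)"
    unfolding n[symmetric] by (cases "even p"; cases "even q"; cases "even r"; simp)
  show ?thesis
    unfolding theta_cup[where mu = "ract M" and f = f and g = g, OF kbil_ract[OF cochain_klin[OF f] g] n]
      theta_cap_right[OF f g n] sign_cong[OF e] ..
next
  case False
  then have "int q > int n - int p" "int n - int (p + q) = int n - int p - int q" by auto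
  then show ?thesis using False by (simp add: theta_beyond cap_right_def Let_def diff_diff_eq)
qed

lemma theta_cup_left:
  assumes f: "f \<in> carrier (Co p)" and g: "klin (Wm q) Am g"
  shows "Theta (q + p) (cup s M (lact M) q p g f)
    = neg_pow (chains s M (int n - int (q + p))) (n * q)
        (cap_left s M M (lact M) q (int n - int p) g (Theta p f))"
proof (cases "p + q \<le> n")
  case True
  define r where "r = n - (p + q)"
  with True have n: "p + q + r = n" by simp
  let ?H = "Ch r"
  interpret H: kspace ?H by (rule kspace_chains)
  have n': "q + p + r = n" and n'': "q + (p + r) = n" and H: "int n - int (q + p) = int r"
    using n by auto
  have gc: "g u \<in> carrier A" if "u \<in> W s q" for u using klin_closed[OF g] that by simp
  have pc: "Pc r (lact M (g (wb K)) (f (wb I))) (wb L) \<in> carrier ?H"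
    if "K \<in> Inc q" "I \<in> Inc p" "L \<in> Inc r" for I K L
    using that by (intro pure_closed lact_closed gc cochain_closed[OF f] wb_W)
  let ?t = "trisum ?H p r q (\<lambda>t v u. Pc r (lact M (g u) (f t)) v) omega"
  have t: "?t \<in> carrier ?H"
    by (rule trisum_closed[OF kspace_chains]) (rule pc)
  have "Theta (q + p) (cup s M (lact M) q p g f)
      = (- 1) ^ ((q + p) * n + q * p) \<odot>\<^bsub>?H\<^esub> trisum ?H q p r (\<lambda>u t v. Pc r (lact M (g u) (f t)) v) omega"
    by (rule theta_cup[where mu = "lact M" and f = g and g = f, OF kbil_lact[OF g cochain_klin[OF f]] n'])
  \<comment> \<open>The block read by \<open>g\<close> is rotated from the front to the back, where
    the left cap product expects it.\<close>
  also have "trisum ?H q p r (\<lambda>u t v. Pc r (lact M (g u) (f t)) v) omega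
      = (- 1) ^ (q * (p + r)) \<odot>\<^bsub>?H\<^esub> ?t"
    by (rule trisum_rotate[OF kspace_chains n'']) (rule pc)
  also have "(- 1) ^ ((q + p) * n + q * p) \<odot>\<^bsub>?H\<^esub> ((- 1) ^ (q * (p + r)) \<odot>\<^bsub>?H\<^esub> ?t)
      = (- 1) ^ ((q + p) * n + q * p + q * (p + r)) \<odot>\<^bsub>?H\<^esub> ?t"
    by (simp only: H.smult_assoc[OF t, symmetric] power_add)
  \<comment> \<open>Again the two exponents differ by \<open>2 * p * q\<close>.\<close>
  also have "(- 1) ^ ((q + p) * n + q * p + q * (p + r)) = ((- 1) ^ (n * q + (r * q + p * n)) :: 'k)"
    unfolding n[symmetric]
    by (rule sign_cong) (cases "even p"; cases "even q"; cases "even r"; simp)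
  also have "(- 1) ^ (n * q + (r * q + p * n)) \<odot>\<^bsub>?H\<^esub> ?t
      = neg_pow ?H (n * q) ((- 1) ^ (r * q + p * n) \<odot>\<^bsub>?H\<^esub> ?t)"
    using t by (simp add: H.neg_pow_smult H.smult_closed H.smult_assoc[symmetric] power_add)
  also have "(- 1) ^ (r * q + p * n) \<odot>\<^bsub>?H\<^esub> ?t = cap_left s M M (lact M) q (int n - int p) g (Theta p f)"
    by (rule theta_cap_left[OF f g n, symmetric])
  finally show ?thesis unfolding H .
next
  case False
  then have *: "int q > int n - int p" "int n - int (q + p) = int n - int p - int q" by auto
  interpret H: kspace "chains s M (int n - int p - int q)" by (rule kspace_chains)
  have "Theta (q + p) (cup s M (lact M) q p g f) = \<zero>\<^bsub>chains s M (int n - int (q + p))\<^esub>"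
    using False by (intro theta_beyond) simp
  then show ?thesis
    unfolding cap_left_def Let_def *(2) using *(1) by (simp add: H.neg_pow_zero)
qed

section \<open>Compatibility with the differentials\<close>

lemma klin_sclass: "klin (Wm p) Am (sclass s)"
proof (rule klinI)
  fix t u a assume "t \<in> carrier (Wm p)"
  then have t: "t \<in> carrier T" using W_in_T by simp
  then show "sclass s t \<in> carrier Am" by simp
  show "sclass s (a \<odot>\<^bsub>Wm p\<^esub> t) = a \<odot>\<^bsub>Am\<^esub> sclass s t"
    using t by (simp add: mscale_self ring_hom_mult[OF sclass_hom])
next
  fix t u assume "t \<in> carrier (Wm p)" "u \<in> carrier (Wm p)"
  then have "t \<in> carrier T" "u \<in> carrier T" using W_in_T by simp_all
  then show "sclass s (t \<oplus>\<^bsub>Wm p\<^esub> u) = sclass s t \<oplus>\<^bsub>Am\<^esub> sclass s u"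
    by (simp add: ring_hom_add[OF sclass_hom])
qed

text \<open>A cup product with a 1-cochain carries the sign \<open>(- 1) ^ p\<close>. The prefactor
  cancels it in the first term, and in the second it is exactly the sign in the
  differential.\<close>

lemma cochain_diff_eq:
  assumes f: "f \<in> carrier (Co p)"
  shows "cochain_diff s M p f
    = (- 1) ^ p \<odot>\<^bsub>Co (Suc p)\<^esub> cup s M (ract M) p 1 f (sclass s)
      \<oplus>\<^bsub>Co (Suc p)\<^esub> (- 1) \<odot>\<^bsub>Co (Suc p)\<^esub> cup s M (lact M) 1 p (sclass s) f"
proof
  fix w
  note br = kbil_ract[OF cochain_klin[OF f] klin_sclass[of 1]]
  note bl = kbil_lact[OF klin_sclass[of 1] cochain_klin[OF f]]
  show "cochain_diff s M p f w
    = ((- 1) ^ p \<odot>\<^bsub>Co (Suc p)\<^esub> cup s M (ract M) p 1 f (sclass s)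
      \<oplus>\<^bsub>Co (Suc p)\<^esub> (- 1) \<odot>\<^bsub>Co (Suc p)\<^esub> cup s M (lact M) 1 p (sclass s) f) w"
  proof (cases "w \<in> W s (Suc p)")
    case True
    then have w: "w \<in> W s (p + 1)" "w \<in> W s (1 + p)" unfolding Suc_eq_plus1 add.commute[of 1 p] by assumption+
    let ?r = "split_ext s M p 1 (\<lambda>t y. ract M (f t) (sclass s y)) w"
    let ?l = "split_ext s M 1 p (\<lambda>y t. lact M (sclass s y) (f t)) w"
    have r: "?r = splitsum Mm p 1 (\<lambda>t y. ract M (f t) (sclass s y)) w"
      by (rule split_ext_eq[OF Mm.kspace_axioms abelian_group_axioms _ _ br w(1)]) simp_all
    have l: "?l = splitsum Mm 1 p (\<lambda>y t. lact M (sclass s y) (f t)) w"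
      by (rule split_ext_eq[OF Mm.kspace_axioms abelian_group_axioms _ _ bl w(2)]) simp_all
    have rc: "?r \<in> carrier M"
      unfolding r bmod_simps(1)[of s M, symmetric]
      by (rule splitsum_closed[OF Mm.kspace_axioms]) (rule kbil_closed[OF br]; simp add: wb_W)
    have lc: "?l \<in> carrier M"
      unfolding l bmod_simps(1)[of s M, symmetric]
      by (rule splitsum_closed[OF Mm.kspace_axioms]) (rule kbil_closed[OF bl]; simp add: wb_W)
    have cr: "cup s M (ract M) p 1 f (sclass s) w = neg_pow M p ?r"
      using w(1) by (simp add: cup_def)
    have cl: "cup s M (lact M) 1 p (sclass s) f w = neg_pow M p ?l"
      using w(2) by (simp add: cup_def)
    have "mscale s M ((- 1) ^ p) (neg_pow M p ?r) = ?r"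
      using rc by (simp add: neg_pow_M[symmetric] neg_pow_closed neg_pow_neg_pow) (simp add: neg_pow_def)
    moreover have "mscale s M (- 1) (neg_pow M p ?l) = \<ominus> neg_pow M p ?l"
      using neg_pow_M[of "neg_pow M p ?l" 1] lc by (simp add: neg_pow_closed) (simp add: neg_pow_def)
    ultimately show ?thesis
      using True by (simp add: cochain_diff_def cochains_def cr cl a_minus_def)
  next
    case False
    then show ?thesis by (simp add: cochain_diff_def cochains_def)
  qed
qed

text \<open>The right cap product with a 1-cochain carries the sign \<open>(- 1) ^ Suc r\<close>,
  which the prefactor cancels; the left one carries \<open>(- 1) ^ r\<close>, which the factor
  \<open>- 1\<close> turns into the sign in the differential.\<close>

lemma chain_diff_eq:
  assumes z: "z \<in> carrier (Ch (Suc r))"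
  shows "chain_diff s M (int (Suc r)) z
    = (- 1) ^ Suc r \<odot>\<^bsub>Ch r\<^esub> cap_right s M M (ract M) (int (Suc r)) 1 z (sclass s)
      \<oplus>\<^bsub>Ch r\<^esub> (- 1) \<odot>\<^bsub>Ch r\<^esub> cap_left s M M (lact M) 1 (int (Suc r)) (sclass s) z"
    (is ?eq)
    and "cap_right s M M (ract M) (int (Suc r)) 1 z (sclass s) \<in> carrier (Ch r)" (is ?right)
    and "cap_left s M M (lact M) 1 (int (Suc r)) (sclass s) z \<in> carrier (Ch r)" (is ?left)
proof -
  let ?H = "Ch r" and ?P = "Pc r"
  interpret H: kspace ?H by (rule kspace_chains)
  let ?c1 = "\<lambda>m y t. ?P (ract M m (sclass s y)) t" and ?c2 = "\<lambda>m t y. ?P (lact M (sclass s y) m) t"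
  let ?b1 = "\<lambda>m w. split_ext s ?H 1 r (?c1 m) w" and ?b2 = "\<lambda>m w. split_ext s ?H r 1 (?c2 m) w"
  let ?e = "(- 1) ^ Suc r :: 'k"
  let ?b = "\<lambda>m w. ?b1 m w \<oplus>\<^bsub>?H\<^esub> neg_pow ?H (Suc r) (?b2 m w)"
  note g = klin_sclass[of 1]
  have gc: "sclass s u \<in> carrier A" if "u \<in> W s p" for u p using that W_in_T by simp
  have c1: "kbil (Wm 1) (Wm r) ?H (?c1 m)" if "m \<in> carrier M" for m
    by (rule kbil_pure_ract[OF that g])
  have c1': "klin Mm ?H (\<lambda>m. ?c1 m u v)" if "u \<in> W s 1" "v \<in> W s r" for u v
    using that by (intro klin_compose[OF klin_ract klin_pure_left] gc)
  have c2: "kbil (Wm r) (Wm 1) ?H (?c2 m)" if "m \<in> carrier M" for m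
    by (rule kbil_pure_lact[OF that g])
  have c2': "klin Mm ?H (\<lambda>m. ?c2 m v u)" if "v \<in> W s r" "u \<in> W s 1" for u v
    using that by (intro klin_compose[OF klin_lact klin_pure_left] gc)
  have b1: "kbil Mm (Wi (int (Suc r))) ?H ?b1"
    using chain_split(1)[where c = ?c1, OF kspace_chains c1 c1'] unfolding plus_1_eq_Suc .
  have b2: "kbil Mm (Wi (int (Suc r))) ?H ?b2"
    using chain_split(1)[where c = ?c2, OF kspace_chains c2 c2'] unfolding Suc_eq_plus1 .
  have np: "neg_pow ?H (Suc r) (?b2 m w) = ?e \<odot>\<^bsub>?H\<^esub> ?b2 m w" if "m \<in> carrier M" "w \<in> W_int s (int (Suc r))" for m w
    using kbil_closed[OF b2, of m w] that by (intro H.neg_pow_smult) simp_all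
  have b: "kbil Mm (Wi (int (Suc r))) ?H ?b"
  proof (rule kbilI)
    fix m assume m: "m \<in> carrier Mm"
    show "klin (Wi (int (Suc r))) ?H (?b m)"
      using m np
      by (intro klin_cong[OF kspace_tmod[OF subsp_W_int]
            klin_add_map[OF kspace_chains kbil_right[OF b1 m] klin_smult_map[OF kspace_chains kbil_right[OF b2 m]]]])
        simp
  next
    fix w assume w: "w \<in> carrier (Wi (int (Suc r)))"
    show "klin Mm ?H (\<lambda>m. ?b m w)"
      using w np
      by (intro klin_cong[OF Mm.kspace_axioms
            klin_add_map[OF kspace_chains kbil_left[OF b1 w] klin_smult_map[OF kspace_chains kbil_left[OF b2 w]]]])
        simp
  qed
  let ?\<phi> = "chain_ext s M (int (Suc r)) ?H ?b"
  let ?\<phi>1 = "chain_ext s M (int (Suc r)) ?H ?b1" and ?\<phi>2 = "chain_ext s M (int (Suc r)) ?H ?b2"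
  note \<phi>1 = klin_chain_ext[OF kspace_chains b1] and \<phi>2 = klin_chain_ext[OF kspace_chains b2]
  have \<phi>1z: "?\<phi>1 z \<in> carrier ?H" and \<phi>2z: "?\<phi>2 z \<in> carrier ?H"
    by (rule klin_closed[OF \<phi>1 z], rule klin_closed[OF \<phi>2 z])
  \<comment> \<open>The differential extends the sum of two bilinear maps, whereas the cap products
    extend them separately. The two sides are linear and agree on pure chains.\<close>
  have \<phi>: "?\<phi> z = ?\<phi>1 z \<oplus>\<^bsub>?H\<^esub> ?e \<odot>\<^bsub>?H\<^esub> ?\<phi>2 z"
  proof (rule chains_klin_eq[OF kspace_chains klin_chain_ext[OF kspace_chains b]
        klin_add_map[OF kspace_chains \<phi>1 klin_smult_map[OF kspace_chains \<phi>2]] _ z])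
    fix m t assume m: "m \<in> carrier M" and t: "t \<in> W_int s (int (Suc r))"
    show "?\<phi> (Pc (Suc r) m t) = ?\<phi>1 (Pc (Suc r) m t)
        \<oplus>\<^bsub>?H\<^esub> ?e \<odot>\<^bsub>?H\<^esub> ?\<phi>2 (Pc (Suc r) m t)"
      unfolding chain_ext_pure[OF kspace_chains b m t] chain_ext_pure[OF kspace_chains b1 m t]
        chain_ext_pure[OF kspace_chains b2 m t] np[OF m t] ..
  qed
  have d: "int (Suc r) - 1 = int r" "int (Suc r) - int 1 = int r" "nat (int (Suc r)) = Suc r"
    "Suc r - 1 = r" by simp_all
  have d': "\<not> int (Suc r) \<le> 0" "\<not> int 1 > int (Suc r)" by simp_all
  have right: "cap_right s M M (ract M) (int (Suc r)) 1 z (sclass s) = ?e \<odot>\<^bsub>?H\<^esub> ?\<phi>1 z"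
    unfolding cap_right_def Let_def d if_not_P[OF d'(2)] using \<phi>1z by (simp only: H.neg_pow_smult mult_1)
  have left: "cap_left s M M (lact M) 1 (int (Suc r)) (sclass s) z = (- 1) ^ r \<odot>\<^bsub>?H\<^esub> ?\<phi>2 z"
    unfolding cap_left_def Let_def d if_not_P[OF d'(2)] using \<phi>2z by (simp only: H.neg_pow_smult mult_1_right)
  show ?right ?left
    unfolding right left by (intro H.smult_closed \<phi>1z \<phi>2z)+
  have cd: "chain_diff s M (int (Suc r)) z = ?\<phi> z"
    unfolding chain_diff_def Let_def d if_not_P[OF d'(1)] ..
  have "?e * ?e = 1" unfolding power_mult_distrib[symmetric] by simp
  then have 1: "?e \<odot>\<^bsub>?H\<^esub> (?e \<odot>\<^bsub>?H\<^esub> ?\<phi>1 z) = ?\<phi>1 z"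
    by (simp only: H.smult_assoc[OF \<phi>1z, symmetric] H.smult_one[OF \<phi>1z])
  have 2: "(- 1) \<odot>\<^bsub>?H\<^esub> ((- 1) ^ r \<odot>\<^bsub>?H\<^esub> ?\<phi>2 z) = ?e \<odot>\<^bsub>?H\<^esub> ?\<phi>2 z"
    by (simp only: H.smult_assoc[OF \<phi>2z, symmetric] power_Suc)
  show ?eq
    unfolding right left cd \<phi> 1 2 ..
qed

lemma theta_diff:
  assumes f: "f \<in> carrier (Co p)"
  shows "Theta (Suc p) (cochain_diff s M p f)
    = neg_pow (chains s M (int n - int (Suc p))) n (chain_diff s M (int n - int p) (Theta p f))"
proof (cases "Suc p \<le> n")
  case True
  define r where "r = n - Suc p"
  with True have n: "p + Suc r = n" and d: "int n - int (Suc p) = int r" "int n - int p = int (Suc r)" by auto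
  let ?H = "Ch r" and ?t = "Theta p f"
  interpret H: kspace ?H by (rule kspace_chains)
  let ?cr = "cup s M (ract M) p 1 f (sclass s)" and ?cl = "cup s M (lact M) 1 p (sclass s) f"
  let ?R = "cap_right s M M (ract M) (int (Suc r)) 1 ?t (sclass s)"
  let ?L = "cap_left s M M (lact M) 1 (int (Suc r)) (sclass s) ?t"
  have cr: "?cr \<in> carrier (Co (Suc p))"
    using cup_cochain[where mu = "ract M" and f = f and g = "sclass s", OF kbil_ract[OF cochain_klin[OF f] klin_sclass[of 1]]]
    unfolding Suc_eq_plus1[symmetric] .
  have cl: "?cl \<in> carrier (Co (Suc p))"
    using cup_cochain[where mu = "lact M" and f = "sclass s" and g = f, OF kbil_lact[OF klin_sclass[of 1] cochain_klin[OF f]]]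
    unfolding plus_1_eq_Suc .
  have t: "?t \<in> carrier (Ch (Suc r))"
    using theta_closed[OF f] unfolding d .
  note R = chain_diff_eq(2)[OF t] and L = chain_diff_eq(3)[OF t]
  have \<theta>r: "Theta (Suc p) ?cr = ?R"
    using theta_cup_right[OF f klin_sclass[of 1]] unfolding d Suc_eq_plus1[symmetric] .
  have \<theta>l: "Theta (Suc p) ?cl = (- 1) ^ n \<odot>\<^bsub>?H\<^esub> ?L"
    using theta_cup_left[OF f klin_sclass[of 1]] H.neg_pow_smult[OF L]
    unfolding plus_1_eq_Suc d mult_1_right by simp
  have "Theta (Suc p) (cochain_diff s M p f)
      = (- 1) ^ p \<odot>\<^bsub>?H\<^esub> ?R \<oplus>\<^bsub>?H\<^esub> (- 1) \<odot>\<^bsub>?H\<^esub> ((- 1) ^ n \<odot>\<^bsub>?H\<^esub> ?L)"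
    unfolding cochain_diff_eq[OF f] klin_add[OF klin_theta cochain_smult_closed[OF cr] cochain_smult_closed[OF cl]]
      klin_smult[OF klin_theta cr] klin_smult[OF klin_theta cl] \<theta>r \<theta>l d ..
  also have "\<dots> = (- 1) ^ n \<odot>\<^bsub>?H\<^esub> ((- 1) ^ Suc r \<odot>\<^bsub>?H\<^esub> ?R \<oplus>\<^bsub>?H\<^esub> (- 1) \<odot>\<^bsub>?H\<^esub> ?L)"
  proof -
    \<comment> \<open>Indeed \<open>n + Suc r = p + 2 * Suc r\<close>.\<close>
    have "even p = even (n + Suc r)"
      unfolding n[symmetric] by (cases "even p"; cases "even r"; simp)
    then have "(- 1) ^ p = ((- 1) ^ n * (- 1) ^ Suc r :: 'k)"
      unfolding power_add[symmetric] by (rule sign_cong)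
    then show ?thesis
      by (simp only: H.smult_r_distr H.smult_closed R L H.smult_assoc[symmetric] mult.commute[of "(- 1) ^ n" "- 1"])
  qed
  also have "\<dots> = neg_pow ?H n (chain_diff s M (int (Suc r)) ?t)"
    unfolding chain_diff_eq(1)[OF t] using R L
    by (intro H.neg_pow_smult[symmetric] H.a_closed H.smult_closed)
  finally show ?thesis unfolding d .
next
  case False
  have d: "int n - int p - 1 = int n - int (Suc p)" by simp
  interpret H: kspace "chains s M (int n - int (Suc p))" by (rule kspace_chains)
  \<comment> \<open>The chain degree \<open>int n - int p\<close> is at most 0, and there
    \<open>chain_diff\<close> is zero by definition; this includes \<open>p = n\<close>.\<close>
  have "chain_diff s M (int n - int p) (Theta p f) = \<zero>\<^bsub>chains s M (int n - int (Suc p))\<^esub>"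
    unfolding chain_diff_def Let_def d using False by simp
  moreover have "Theta (Suc p) (cochain_diff s M p f) = \<zero>\<^bsub>chains s M (int n - int (Suc p))\<^esub>"
    using False by (intro theta_beyond) simp
  ultimately show ?thesis by (simp only: H.neg_pow_zero)
qed

text \<open>Both spaces are zero: there is no increasing word of length \<open>p > n\<close> on
  which a cochain could be nonzero, and \<open>W_int\<close> is zero in negative degrees.\<close>

lemma theta_bij_beyond:
  assumes p: "n < p"
  shows "bij_betw (Theta p) (carrier (Co p)) (carrier (chains s M (int n - int p)))"
proof -
  let ?H = "chains s M (int n - int p)"
  interpret H: kspace ?H by (rule kspace_chains)
  have W0: "W_int s (int n - int p) = {\<zero>\<^bsub>T\<^esub>}" using p by (simp add: W_int_def)
  have zero: "z = \<zero>\<^bsub>?H\<^esub>" if z: "z \<in> carrier ?H" for z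
  proof (rule chains_klin_eq[OF kspace_chains klin_id _ _ z])
    show "klin ?H ?H (\<lambda>z. \<zero>\<^bsub>?H\<^esub>)"
      using additive_zero[OF H.abelian_group_axioms H.abelian_group_axioms H.additive_smult]
      by (intro klinI) simp_all
    fix m t assume m: "m \<in> carrier M" and "t \<in> W_int s (int n - int p)"
    then have t: "t = \<zero>\<^bsub>T\<^esub>" using W0 by simp
    interpret Wi: kspace "Wi (int n - int p)" by (rule kspace_tmod[OF subsp_W_int])
    show "pure_chain s M (int n - int p) m t = \<zero>\<^bsub>?H\<^esub>"
      using additive_zero[OF Wi.abelian_group_axioms H.abelian_group_axioms
          klin_additive[OF kbil_right[OF kbil_pure_chain]], of m] m by (simp add: t)
  qed
  have eq: "f = g" if "f \<in> carrier (Co p)" "g \<in> carrier (Co p)" for f g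
    by (rule cochain_eqI[OF that]) (simp add: Inc_empty[OF p])
  \<comment> \<open>The zero cochain, written as a sum, shows that there is a cochain at
    all.\<close>
  have "klin (Wm p) Mm (splitsum Mm p 0 (\<lambda>t u. \<zero>))"
    using W_in_T by (intro klin_splitsum[OF Mm.kspace_axioms]) auto
  from cochainI[OF this] obtain f where f: "f \<in> carrier (Co p)" by blast
  then have C: "carrier (Co p) = {f}" using eq by blast
  have "carrier ?H = {\<zero>\<^bsub>?H\<^esub>}" using zero zero_chains by blast
  then show ?thesis unfolding C by (simp add: bij_betw_def theta_beyond[OF p])
qed

lemma dg_bimodule_iso_theta: "dg_bimodule_iso s M n (Theta)"
proof -
  have "bij_betw (Theta p) (carrier (Co p)) (carrier (chains s M (int n - int p)))" for p
  proof (cases "p \<le> n")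
    case True
    then have "p + (n - p) = n" "int n - int p = int (n - p)" by auto
    then show ?thesis using theta_bij by metis
  qed (simp add: theta_bij_beyond)
  moreover have "klin (Wm q) Am g" if "g \<in> carrier (cochains s (self_bimodule s) q)" for q g
    using S.cochain_klin[OF that] .
  ultimately show ?thesis
    unfolding dg_bimodule_iso_def
    by (intro conjI allI ballI klin_add[OF klin_theta] klin_smult[OF klin_theta] theta_cup_right theta_cup_left theta_diff)
qed

end

theorem theorem1p6:
  fixes s :: "'k::field \<Rightarrow> 'v::ab_group_add \<Rightarrow> 'v"
    and n :: nat
    and x :: "nat \<Rightarrow> 'v"
    and M :: "(('v, 'k) symm, 'm) bimodule"
  assumes "vector_space s"
    and "n \<ge> 1"
    and "inj_on x {1..n}"
    and "\<not> module.dependent s (x ` {1..n})"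
    and "module.span s (x ` {1..n}) = UNIV"
    and "sym_bimodule s M"
  shows "dg_bimodule_iso s M n (theta s M n x)"
proof -
  interpret koszul_bimodule s n x M
    using assms by (intro koszul_bimodule.intro koszul.intro koszul_axioms.intro)
  show ?thesis by (rule dg_bimodule_iso_theta)
qed

end
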